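(* Let $\mathcal{M}$ be a connected Riemannian manifold, $\mathbb{Y}$ a Euclidean space, $f:\mathcal{M}\to\mathbb{R}$ and $g:\mathcal{M}\to\mathbb{Y}$ continuously differentiable, and $\theta:\mathbb{Y}\to(-\infty,\infty]$ proper closed convex. Let $(\bar{x},\bar{y})$ be a KKT pair of $\min_{x\in\mathcal{M}}f(x)+\theta(g(x))$ and $R_{\bar x}$ a retraction at $\bar x$. The manifold strong variational sufficient condition holds at $(\bar{x},\bar{y})$ with respect to $R_{\bar{x}}$ at level $\rho>0$ if and only if the manifold augmented tilt stability (at level $\rho$) holds at $\bar{x}$ with respect to $R_{\bar{x}}$.
   Context: $(\bar x,\bar y)$ is a KKT pair if $\operatorname{grad}f(\bar x)+Dg(\bar x)^*\bar y=0$ and $\bar y\in\partial\theta(g(\bar x))$. A retraction is a smooth map $R:T\mathcal{M}\to\mathcal{M}$ with $R_x(0_x)=x$, $DR_x(0_x)=\mathrm{id}$. $r_{R_{\bar x}}>0$ is the supremum of radii $r$ such that $R_{\bar x}$ is a well-defined diffeomorphism on $B_{\bar x}(r)=\{v\in T_{\bar x}\mathcal{M}:\|v\|<r\}$. $\varphi^\rho(x,b)=f(x)+\theta(g(x)+b)+\frac\rho2\|b\|^2$; $\varphi^\rho_{R_{\bar x}}(\xi,b)=\varphi^\rho(R_{\bar x}(\xi),b)$ for $\xi\in B_{\bar x}(r_{R_{\bar x}})$ and $+\infty$ for other $\xi\in T_{\bar x}\mathcal{M}$; $l^\rho(x,y)=\inf_b\{\varphi^\rho(x,b)-\langle y,b\rangle\}$,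 $l^\rho_{R_{\bar x}}(\xi,y)=\inf_b\{\varphi^\rho_{R_{\bar x}}(\xi,b)-\langle y,b\rangle\}$. A lsc function $h_0$ on a Euclidean space is variationally strongly convex with respect to $(\bar w,\bar z)\in\operatorname{gph}\partial h_0$ if there are convex open neighborhoods $\mathcal{N}$ of $\bar w$, $\mathcal{Z}$ of $\bar z$ and a proper lsc convex function $h\le h_0$ on $\mathcal{N}$, strongly convex on $\mathcal{N}$, with $(\mathcal{N}\times\mathcal{Z})\cap\operatorname{gph}\partial h=(\mathcal{N}\times\mathcal{Z})\cap\operatorname{gph}\partial h_0$ and $h(w)=h_0(w)$ for all $(w,z)$ in this common set. The manifold strong variational sufficient condition under $R_{\bar x}$ with respect to $(\bar x,\bar y)$ at level $\rho$ means that $\varphi^\rho_{R_{\bar x}}$ is variationally strongly convex with respect to $((0_{\bar x},0),(0_{\bar x},\bar y))\in\operatorname{gph}\partial\varphi^\rho_{R_{\bar x}}$. Manifold augmented tilt stability at $\bar x$ with respect to $R_{\bar x}$ (for the multiplier $\bar y$ and level $\rho$): there exist a closed convex neighborhood $\mathcal{W}\times\mathcal{Y}$ of $(0_{\bar x},\bar y)$, $\mathcal{W}\subseteq B_{\bar x}(r_{R_{\bar x}})$, on which $l^\rho_{R_{\bar x}}$ is convex in $\xi\in\mathcal{W}$ for each $y\in\mathcal{Y}$ and concave in $y\in\mathcal{Y}$ for each $\xi\in\mathcal{W}$, and a neighborhood $\mathcal{V}$ of $0_{\bar x}$ in $T_{\bar x}\mathcal{M}$, such that the mapping $(v,y)\mapsto\operatorname{argmin}_{x\in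 R_{\bar x}(\mathcal{W})}\{l^\rho(x,y)-\langle v,R_{\bar x}^{-1}(x)\rangle\}$ is single-valued and Lipschitz continuous on $\mathcal{V}\times\mathcal{Y}$. *)

theory Defs
  imports "HOL-Analysis.Analysis"
begin

section \<open>Differentiability of order k in Euclidean spaces\<close>

text \<open>Only used on open sets, so that the Frechet derivative is the two-sided one. Finite
  dimension makes continuity of all partial derivatives the same as continuity of the derivative.\<close>

fun Ck_on :: "nat \<Rightarrow> 'a::euclidean_space set \<Rightarrow> ('a \<Rightarrow> 'b::real_normed_vector) \<Rightarrow> bool" where
  "Ck_on 0 S f \<longleftrightarrow> continuous_on S f"
| "Ck_on (Suc k) S f \<longleftrightarrow>
     (\<forall>x\<in>S. f differentiable at x) \<and> (\<forall>v. Ck_on k S (\<lambda>x. frechet_derivative f (at x) v))"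

definition smooth_on :: "'a::euclidean_space set \<Rightarrow> ('a \<Rightarrow> 'b::real_normed_vector) \<Rightarrow> bool" where
  "smooth_on S f \<longleftrightarrow> (\<forall>k. Ck_on k S f)"


section \<open>Riemannian manifolds\<close>

text \<open>A chart is a pair of its domain and its coordinate map into the model space
  \<^typ>\<open>'e\<close>, whose dimension is the dimension of the manifold.

  The tangent space at a point \<open>x\<close> is realised as \<^typ>\<open>'e\<close>: the vector
  \<open>v\<close> stands for the tangent vector at \<open>x\<close> whose coordinates in the preferred chart
  \<open>chart_at x\<close> are \<open>v\<close>. Accordingly \<open>metric x\<close> is the inner product of
  the tangent space at \<open>x\<close>, written in that chart; it is in general different from
  the inner product of the type \<^typ>\<open>'e\<close>, whose vector space structure and
  topology are the only features of that type that carry meaning for tangent vectors.\<close>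

type_synonym ('m, 'e) chart = "'m set \<times> ('m \<Rightarrow> 'e)"

record ('m, 'e) riem =
  mtop :: "'m topology"
  atlas :: "('m, 'e) chart set"
  chart_at :: "'m \<Rightarrow> ('m, 'e) chart"
  metric :: "'m \<Rightarrow> 'e \<Rightarrow> 'e \<Rightarrow> real"

definition chart_inv :: "('m, 'e) chart \<Rightarrow> 'e \<Rightarrow> 'm" where
  "chart_inv c = inv_into (fst c) (snd c)"

definition is_chart :: "'m topology \<Rightarrow> ('m, 'e::euclidean_space) chart \<Rightarrow> bool" where
  "is_chart X c \<longleftrightarrow> openin X (fst c) \<and> open (snd c ` fst c) \<and>
     homeomorphic_map (subtopology X (fst c)) (top_of_set (snd c ` fst c)) (snd c)"

definition smooth_manifold :: "('m, 'e::euclidean_space) riem \<Rightarrow> bool" where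
  "smooth_manifold M \<longleftrightarrow>
     Hausdorff_space (mtop M) \<and> second_countable (mtop M) \<and>
     (\<forall>c\<in>atlas M. is_chart (mtop M) c) \<and>
     topspace (mtop M) = (\<Union>c\<in>atlas M. fst c) \<and>
     (\<forall>c\<in>atlas M. \<forall>d\<in>atlas M. smooth_on (snd c ` (fst c \<inter> fst d)) (snd d \<circ> chart_inv c)) \<and>
     (\<forall>x\<in>topspace (mtop M). chart_at M x \<in> atlas M \<and> x \<in> fst (chart_at M x))"

text \<open>\<open>tangent_of M c x u\<close> is the tangent vector at \<open>x\<close> (in the preferred chart) that has
  coordinates \<open>u\<close> in the chart \<open>c\<close>.\<close>

definition tangent_of :: "('m, 'e::euclidean_space) riem \<Rightarrow> ('m, 'e) chart \<Rightarrow> 'm \<Rightarrow> 'e \<Rightarrow> 'e" where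
  "tangent_of M c x u = frechet_derivative (snd (chart_at M x) \<circ> chart_inv c) (at (snd c x)) u"

definition is_inner_product :: "('v::real_vector \<Rightarrow> 'v \<Rightarrow> real) \<Rightarrow> bool" where
  "is_inner_product ip \<longleftrightarrow>
     (\<forall>u. linear (ip u)) \<and> (\<forall>u v. ip u v = ip v u) \<and> (\<forall>u. u \<noteq> 0 \<longrightarrow> 0 < ip u u)"

definition ip_norm :: "('v \<Rightarrow> 'v \<Rightarrow> real) \<Rightarrow> 'v \<Rightarrow> real" where
  "ip_norm ip v = sqrt (ip v v)"

definition riemannian_manifold :: "('m, 'e::euclidean_space) riem \<Rightarrow> bool" where
  "riemannian_manifold M \<longleftrightarrow>
     smooth_manifold M \<and>
     (\<forall>x\<in>topspace (mtop M). is_inner_product (metric M x)) \<and>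
     (\<forall>c\<in>atlas M. \<forall>u v. smooth_on (snd c ` fst c)
        (\<lambda>z. let x = chart_inv c z in metric M x (tangent_of M c x u) (tangent_of M c x v)))"


subsection \<open>Differentiable maps\<close>

definition C1_on_manifold ::
    "('m, 'e::euclidean_space) riem \<Rightarrow> ('m \<Rightarrow> 'b::real_normed_vector) \<Rightarrow> bool" where
  "C1_on_manifold M F \<longleftrightarrow> (\<forall>c\<in>atlas M. Ck_on 1 (snd c ` fst c) (F \<circ> chart_inv c))"

definition mderiv ::
    "('m, 'e::euclidean_space) riem \<Rightarrow> ('m \<Rightarrow> 'b::real_normed_vector) \<Rightarrow> 'm \<Rightarrow> 'e \<Rightarrow> 'b" where
  "mderiv M F x = frechet_derivative (F \<circ> chart_inv (chart_at M x)) (at (snd (chart_at M x) x))"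

definition mgrad :: "('m, 'e::euclidean_space) riem \<Rightarrow> ('m \<Rightarrow> real) \<Rightarrow> 'm \<Rightarrow> 'e" where
  "mgrad M f x = (THE v. \<forall>\<xi>. metric M x v \<xi> = mderiv M f x \<xi>)"

definition mderiv_adjoint ::
    "('m, 'e::euclidean_space) riem \<Rightarrow> ('m \<Rightarrow> 'y::real_inner) \<Rightarrow> 'm \<Rightarrow> 'y \<Rightarrow> 'e" where
  "mderiv_adjoint M g x y = (THE v. \<forall>\<xi>. metric M x v \<xi> = y \<bullet> mderiv M g x \<xi>)"

text \<open>Smoothness of a map from an open set \<open>S\<close> of a Euclidean space into the manifold; openness
  of the preimages of chart domains is the continuity part.\<close>

definition smooth_into ::
    "('m, 'e::euclidean_space) riem \<Rightarrow> 'v::euclidean_space set \<Rightarrow> ('v \<Rightarrow> 'm) \<Rightarrow> bool" where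
  "smooth_into M S F \<longleftrightarrow>
     F ` S \<subseteq> topspace (mtop M) \<and>
     (\<forall>c\<in>atlas M. open (S \<inter> F -` fst c) \<and> smooth_on (S \<inter> F -` fst c) (snd c \<circ> F))"

definition diffeo_onto_image ::
    "('m, 'e::euclidean_space) riem \<Rightarrow> 'v::euclidean_space set \<Rightarrow> ('v \<Rightarrow> 'm) \<Rightarrow> bool" where
  "diffeo_onto_image M S F \<longleftrightarrow>
     smooth_into M S F \<and> inj_on F S \<and> openin (mtop M) (F ` S) \<and>
     (\<forall>c\<in>atlas M. smooth_on (snd c ` (fst c \<inter> F ` S)) (inv_into S F \<circ> chart_inv c))"


subsection \<open>Riemannian distance\<close>

definition piecewise_C1_curve :: "('m, 'e::euclidean_space) riem \<Rightarrow> (real \<Rightarrow> 'm) \<Rightarrow> bool" where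
  "piecewise_C1_curve M \<gamma> \<longleftrightarrow>
     pathin (mtop M) \<gamma> \<and>
     (\<forall>c\<in>atlas M. \<forall>a b. 0 \<le> a \<and> a \<le> b \<and> b \<le> 1 \<and> \<gamma> ` {a..b} \<subseteq> fst c \<longrightarrow>
        (snd c \<circ> \<gamma>) piecewise_C1_differentiable_on {a..b})"

definition velocity :: "('m, 'e::euclidean_space) riem \<Rightarrow> (real \<Rightarrow> 'm) \<Rightarrow> real \<Rightarrow> 'e" where
  "velocity M \<gamma> t = vector_derivative (snd (chart_at M (\<gamma> t)) \<circ> \<gamma>) (at t)"

definition curve_length :: "('m, 'e::euclidean_space) riem \<Rightarrow> (real \<Rightarrow> 'm) \<Rightarrow> ennreal" where
  "curve_length M \<gamma> =
     (\<integral>\<^sup>+ t\<in>{0..1}. ennreal (ip_norm (metric M (\<gamma> t)) (velocity M \<gamma> t)) \<partial>lborel)"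

definition riem_dist :: "('m, 'e::euclidean_space) riem \<Rightarrow> 'm \<Rightarrow> 'm \<Rightarrow> ennreal" where
  "riem_dist M p q = (INF \<gamma>\<in>{\<gamma>. piecewise_C1_curve M \<gamma> \<and> \<gamma> 0 = p \<and> \<gamma> 1 = q}. curve_length M \<gamma>)"


subsection \<open>Retractions\<close>

text \<open>\<open>R x v\<close> is the value of the retraction at the tangent vector \<open>v\<close> at \<open>x\<close>. Smoothness on the
  tangent bundle is expressed in its standard charts: \<open>(z, u)\<close> are the coordinates of the base
  point and of the tangent vector in the chart \<open>c\<close>.\<close>

definition tangent_retraction :: "('m, 'e::euclidean_space) riem \<Rightarrow> ('m \<Rightarrow> 'e \<Rightarrow> 'm) \<Rightarrow> bool" where
  "tangent_retraction M R \<longleftrightarrow>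
     (\<forall>c\<in>atlas M. smooth_into M (snd c ` fst c \<times> UNIV)
        (\<lambda>(z, u). let x = chart_inv c z in R x (tangent_of M c x u))) \<and>
     (\<forall>x\<in>topspace (mtop M).
        R x 0 = x \<and> ((snd (chart_at M x) \<circ> R x) has_derivative id) (at 0))"

definition tangent_ball :: "('m, 'e::euclidean_space) riem \<Rightarrow> 'm \<Rightarrow> ereal \<Rightarrow> 'e set" where
  "tangent_ball M x r = {v. ereal (ip_norm (metric M x) v) < r}"

definition retraction_radius ::
    "('m, 'e::euclidean_space) riem \<Rightarrow> ('m \<Rightarrow> 'e \<Rightarrow> 'm) \<Rightarrow> 'm \<Rightarrow> ereal" where
  "retraction_radius M R x =
     Sup {ereal r | r. 0 < r \<and> diffeo_onto_image M (tangent_ball M x (ereal r)) (R x)}"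

definition retraction_ball ::
    "('m, 'e::euclidean_space) riem \<Rightarrow> ('m \<Rightarrow> 'e \<Rightarrow> 'm) \<Rightarrow> 'm \<Rightarrow> 'e set" where
  "retraction_ball M R x = tangent_ball M x (retraction_radius M R x)"

definition retraction_inv ::
    "('m, 'e::euclidean_space) riem \<Rightarrow> ('m \<Rightarrow> 'e \<Rightarrow> 'm) \<Rightarrow> 'm \<Rightarrow> 'm \<Rightarrow> 'e" where
  "retraction_inv M R x = inv_into (retraction_ball M R x) (R x)"


section \<open>Variational analysis on Euclidean spaces\<close>

text \<open>The inner product is an explicit argument \<open>ip\<close>, because the notions are needed on tangent
  spaces with their Riemannian inner product.\<close>

definition proper_fun :: "('v \<Rightarrow> ereal) \<Rightarrow> bool" where
  "proper_fun h \<longleftrightarrow> (\<forall>x. h x \<noteq> -\<infinity>) \<and> (\<exists>x. h x \<noteq> \<infinity>)"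

definition lsc_at :: "('v::topological_space \<Rightarrow> ereal) \<Rightarrow> 'v \<Rightarrow> bool" where
  "lsc_at h x \<longleftrightarrow> h x \<le> Liminf (nhds x) h"

definition ereal_convex_on :: "'v::real_vector set \<Rightarrow> ('v \<Rightarrow> ereal) \<Rightarrow> bool" where
  "ereal_convex_on S h \<longleftrightarrow>
     convex S \<and>
     (\<forall>x\<in>S. \<forall>y\<in>S. \<forall>u\<ge>0. \<forall>v\<ge>0. u + v = 1 \<longrightarrow>
        h (u *\<^sub>R x + v *\<^sub>R y) \<le> ereal u * h x + ereal v * h y)"

definition ereal_concave_on :: "'v::real_vector set \<Rightarrow> ('v \<Rightarrow> ereal) \<Rightarrow> bool" where
  "ereal_concave_on S h \<longleftrightarrow> ereal_convex_on S (\<lambda>x. - h x)"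

definition strongly_convex_on ::
    "('v::real_vector \<Rightarrow> 'v \<Rightarrow> real) \<Rightarrow> 'v set \<Rightarrow> ('v \<Rightarrow> ereal) \<Rightarrow> bool" where
  "strongly_convex_on ip S h \<longleftrightarrow>
     convex S \<and>
     (\<exists>s>0. \<forall>x\<in>S. \<forall>y\<in>S. \<forall>u\<ge>0. \<forall>v\<ge>0. u + v = 1 \<longrightarrow>
        h (u *\<^sub>R x + v *\<^sub>R y) + ereal (s / 2 * u * v * (ip_norm ip (x - y))\<^sup>2)
          \<le> ereal u * h x + ereal v * h y)"

text \<open>Regular (Frechet) subgradients, and general (limiting) subgradients as limits of regular ones
  along sequences with convergent function values. For proper lsc convex functions both are the
  subgradients of convex analysis.\<close>

definition regular_subdiff ::
    "('v::euclidean_space \<Rightarrow> 'v \<Rightarrow> real) \<Rightarrow> ('v \<Rightarrow> ereal) \<Rightarrow> 'v \<Rightarrow> 'v set" where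
  "regular_subdiff ip h x =
     {v. \<bar>h x\<bar> \<noteq> \<infinity> \<and>
         (\<forall>\<epsilon>>0. \<forall>\<^sub>F w in nhds x.
            h x + ereal (ip v (w - x) - \<epsilon> * ip_norm ip (w - x)) \<le> h w)}"

definition subdiff ::
    "('v::euclidean_space \<Rightarrow> 'v \<Rightarrow> real) \<Rightarrow> ('v \<Rightarrow> ereal) \<Rightarrow> 'v \<Rightarrow> 'v set" where
  "subdiff ip h x =
     {v. \<bar>h x\<bar> \<noteq> \<infinity> \<and>
         (\<exists>xs vs. xs \<longlonglongrightarrow> x \<and> (\<lambda>k. h (xs k)) \<longlonglongrightarrow> h x \<and> vs \<longlonglongrightarrow> v \<and>
            (\<forall>k. vs k \<in> regular_subdiff ip h (xs k)))}"

definition gph_subdiff ::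
    "('v::euclidean_space \<Rightarrow> 'v \<Rightarrow> real) \<Rightarrow> ('v \<Rightarrow> ereal) \<Rightarrow> ('v \<times> 'v) set" where
  "gph_subdiff ip h = {(x, v). v \<in> subdiff ip h x}"

text \<open>Lower semicontinuity of \<open>h0\<close> is required near \<open>w\<close> only: a function extended by infinity
  outside an open ball need not be lsc at the boundary of that ball.\<close>

definition variationally_strongly_convex ::
    "('v::euclidean_space \<Rightarrow> 'v \<Rightarrow> real) \<Rightarrow> ('v \<Rightarrow> ereal) \<Rightarrow> 'v \<Rightarrow> 'v \<Rightarrow> bool" where
  "variationally_strongly_convex ip h0 w z \<longleftrightarrow>
     (w, z) \<in> gph_subdiff ip h0 \<and> (\<forall>\<^sub>F x in nhds w. lsc_at h0 x) \<and>
     (\<exists>N Z h. open N \<and> convex N \<and> w \<in> N \<and> open Z \<and> convex Z \<and> z \<in> Z \<and>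
        proper_fun h \<and> (\<forall>x. lsc_at h x) \<and> ereal_convex_on UNIV h \<and>
        (\<forall>x\<in>N. h x \<le> h0 x) \<and> strongly_convex_on ip N h \<and>
        (N \<times> Z) \<inter> gph_subdiff ip h = (N \<times> Z) \<inter> gph_subdiff ip h0 \<and>
        (\<forall>(x, v) \<in> (N \<times> Z) \<inter> gph_subdiff ip h0. h x = h0 x))"

definition prod_ip ::
    "('v \<Rightarrow> 'v \<Rightarrow> real) \<Rightarrow> ('v \<times> 'y::real_inner) \<Rightarrow> ('v \<times> 'y) \<Rightarrow> real" where
  "prod_ip ip p q = ip (fst p) (fst q) + snd p \<bullet> snd q"


section \<open>Composite optimization on a manifold\<close>

definition KKT_pair ::
    "('m, 'e::euclidean_space) riem \<Rightarrow> ('m \<Rightarrow> real) \<Rightarrow> ('m \<Rightarrow> 'y::euclidean_space) \<Rightarrow>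
      ('y \<Rightarrow> ereal) \<Rightarrow> 'm \<Rightarrow> 'y \<Rightarrow> bool" where
  "KKT_pair M f g \<theta> x y \<longleftrightarrow>
     x \<in> topspace (mtop M) \<and>
     mgrad M f x + mderiv_adjoint M g x y = 0 \<and> y \<in> subdiff (\<bullet>) \<theta> (g x)"

definition phi ::
    "('m \<Rightarrow> real) \<Rightarrow> ('m \<Rightarrow> 'y::euclidean_space) \<Rightarrow> ('y \<Rightarrow> ereal) \<Rightarrow> real \<Rightarrow> 'm \<Rightarrow> 'y \<Rightarrow> ereal" where
  "phi f g \<theta> \<rho> x b = ereal (f x) + \<theta> (g x + b) + ereal (\<rho> / 2 * (norm b)\<^sup>2)"

definition aug_lagrangian ::
    "('m \<Rightarrow> real) \<Rightarrow> ('m \<Rightarrow> 'y::euclidean_space) \<Rightarrow> ('y \<Rightarrow> ereal) \<Rightarrow> real \<Rightarrow> 'm \<Rightarrow> 'y \<Rightarrow> ereal" where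
  "aug_lagrangian f g \<theta> \<rho> x y = (INF b. phi f g \<theta> \<rho> x b - ereal (y \<bullet> b))"

definition phi_R ::
    "('m, 'e::euclidean_space) riem \<Rightarrow> ('m \<Rightarrow> real) \<Rightarrow> ('m \<Rightarrow> 'y::euclidean_space) \<Rightarrow>
      ('y \<Rightarrow> ereal) \<Rightarrow> ('m \<Rightarrow> 'e \<Rightarrow> 'm) \<Rightarrow> 'm \<Rightarrow> real \<Rightarrow> 'e \<Rightarrow> 'y \<Rightarrow> ereal" where
  "phi_R M f g \<theta> R x \<rho> \<xi> b =
     (if \<xi> \<in> retraction_ball M R x then phi f g \<theta> \<rho> (R x \<xi>) b else \<infinity>)"

definition aug_lagrangian_R ::
    "('m, 'e::euclidean_space) riem \<Rightarrow> ('m \<Rightarrow> real) \<Rightarrow> ('m \<Rightarrow> 'y::euclidean_space) \<Rightarrow>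
      ('y \<Rightarrow> ereal) \<Rightarrow> ('m \<Rightarrow> 'e \<Rightarrow> 'm) \<Rightarrow> 'm \<Rightarrow> real \<Rightarrow> 'e \<Rightarrow> 'y \<Rightarrow> ereal" where
  "aug_lagrangian_R M f g \<theta> R x \<rho> \<xi> y = (INF b. phi_R M f g \<theta> R x \<rho> \<xi> b - ereal (y \<bullet> b))"

definition manifold_strong_variational_sufficiency ::
    "('m, 'e::euclidean_space) riem \<Rightarrow> ('m \<Rightarrow> real) \<Rightarrow> ('m \<Rightarrow> 'y::euclidean_space) \<Rightarrow>
      ('y \<Rightarrow> ereal) \<Rightarrow> ('m \<Rightarrow> 'e \<Rightarrow> 'm) \<Rightarrow> 'm \<Rightarrow> 'y \<Rightarrow> real \<Rightarrow> bool" where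
  "manifold_strong_variational_sufficiency M f g \<theta> R x y \<rho> \<longleftrightarrow>
     variationally_strongly_convex (prod_ip (metric M x))
       (\<lambda>(\<xi>, b). phi_R M f g \<theta> R x \<rho> \<xi> b) (0, 0) (0, y)"

text \<open>Since the minimizers are points of the manifold, Lipschitz continuity is measured in the
  Riemannian distance on the side of the values.\<close>

definition manifold_augmented_tilt_stability ::
    "('m, 'e::euclidean_space) riem \<Rightarrow> ('m \<Rightarrow> real) \<Rightarrow> ('m \<Rightarrow> 'y::euclidean_space) \<Rightarrow>
      ('y \<Rightarrow> ereal) \<Rightarrow> ('m \<Rightarrow> 'e \<Rightarrow> 'm) \<Rightarrow> 'm \<Rightarrow> 'y \<Rightarrow> real \<Rightarrow> bool" where
  "manifold_augmented_tilt_stability M f g \<theta> R x y \<rho> \<longleftrightarrow>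
     (\<exists>W Y. closed W \<and> convex W \<and> 0 \<in> interior W \<and> W \<subseteq> retraction_ball M R x \<and>
        closed Y \<and> convex Y \<and> y \<in> interior Y \<and>
        (\<forall>\<eta>\<in>Y. ereal_convex_on W (\<lambda>\<xi>. aug_lagrangian_R M f g \<theta> R x \<rho> \<xi> \<eta>)) \<and>
        (\<forall>\<xi>\<in>W. ereal_concave_on Y (\<lambda>\<eta>. aug_lagrangian_R M f g \<theta> R x \<rho> \<xi> \<eta>)) \<and>
        (\<exists>V. 0 \<in> interior V \<and>
           (\<exists>m. (\<forall>v\<in>V. \<forall>\<eta>\<in>Y.
                   {p. is_arg_min
                         (\<lambda>p. aug_lagrangian f g \<theta> \<rho> p \<eta>
                                - ereal (metric M x v (retraction_inv M R x p)))
                         (\<lambda>p. p \<in> R x ` W) p} = {m v \<eta>}) \<and>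
                (\<exists>L\<ge>0. \<forall>v\<in>V. \<forall>\<eta>\<in>Y. \<forall>v'\<in>V. \<forall>\<eta>'\<in>Y.
                   riem_dist M (m v \<eta>) (m v' \<eta>')
                     \<le> ennreal (L * ip_norm (prod_ip (metric M x)) ((v, \<eta>) - (v', \<eta>')))))))"

end

theory Submission
  imports Defs
begin

text \<open>
Write \<open>\<xi>\<close> for tangent vectors at the reference point and pull the problem back along the retraction.
The perturbed objective becomes
\<open>\<phi> (\<xi>, b) = F \<xi> + \<theta> (G \<xi> + b) + \<rho>/2 |b|\<^sup>2\<close> on a neighbourhood of zero, and minimizing
\<open>\<phi> (\<xi>, b) - y \<bullet> b\<close> over \<open>b\<close> is, after completing the square, the evaluation of a Moreau envelope
of \<open>\<theta>\<close>. Hence the augmented Lagrangian \<open>l \<xi> y\<close> is finite, concave in \<open>y\<close> and continuously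
differentiable in \<open>\<xi>\<close>, the inner minimizer \<open>\<beta> \<xi> y\<close> is unique and Lipschitz, and with \<open>gr \<xi> y\<close> for the
\<open>\<xi>\<close>-gradient of \<open>l\<close> the subgradients of \<open>\<phi>\<close> at points with \<open>\<xi>\<close> near zero are exactly the pairs
\<open>((\<xi>, \<beta> \<xi> y), (gr \<xi> y, y))\<close> (lemmas \<open>gr_beta_in_gph\<close> and \<open>gph_cases\<close>). The KKT conditions say that
\<open>\<beta>\<close> and \<open>gr\<close> vanish at \<open>(0, ybar)\<close>, which makes the reference pair one of them.

Variational strong convexity of \<open>\<phi>\<close> is used through uniform quadratic growth: near the reference pair every
subgradient supports \<open>\<phi>\<close> from below up to a quadratic of fixed positive curvature. The growth follows from
the convex minorant. Conversely, growth together with local surjectivity of the subgradient mapping gives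
back a minorant, namely the supremum of all these supporting quadratics
(lemma \<open>variationally_strongly_convexI\<close>).

From sufficiency to tilt stability, growth of \<open>\<phi>\<close> at the points \<open>(\<xi>, \<beta> \<xi> y)\<close> is growth of \<open>l\<close> in \<open>\<xi>\<close>, uniform
in \<open>y\<close>. So \<open>l\<close> is convex in \<open>\<xi>\<close> with a strongly monotone gradient, and the minimizers of the tilted
functions are unique and depend on \<open>(v, y)\<close> in a Lipschitz way.

From tilt stability to sufficiency, compare the minimizer \<open>\<xi>1\<close> for the tilt \<open>v1 = gr \<xi>1 y\<close> with the one for
\<open>v1 + t (\<xi>2 - \<xi>1)\<close>. It has moved by at most a multiple of \<open>t |\<xi>2 - \<xi>1|\<close>, and the two minimality
inequalities combine to growth of \<open>l\<close> from \<open>\<xi>1\<close> to \<open>\<xi>2\<close>. Adding the \<open>\<rho>\<close>-strong convexity of \<open>\<phi>\<close> in \<open>b\<close>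
yields growth of \<open>\<phi>\<close>. The subgradient mapping is locally onto because the tilted minimizer is an interior
point of the domain, where its tilt equals the gradient.

Lipschitz continuity is measured in the Riemannian distance of the minimizers, so that distance has to be
compared with the norm in retraction coordinates on both sides. The upper bound measures the image of a
segment. The lower bound follows every curve up to its first exit from a chart ball.
\<close>

section \<open>Inner products on Euclidean spaces\<close>

lemma inner_product_linear: "is_inner_product ip \<Longrightarrow> linear (ip u)"
  and inner_product_commute: "is_inner_product ip \<Longrightarrow> ip u v = ip v u"
  and inner_product_pos: "is_inner_product ip \<Longrightarrow> u \<noteq> 0 \<Longrightarrow> 0 < ip u u"
  by (simp_all add: is_inner_product_def)

lemma inner_product_bilinear:
  assumes "is_inner_product ip"
  shows "bilinear ip"
proof -
  have "(\<lambda>x. ip x y) = ip y" for y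
    using inner_product_commute[OF assms] by auto
  then show ?thesis
    using inner_product_linear[OF assms] by (simp add: bilinear_def)
qed

lemma inner_product_bounded_bilinear:
  fixes ip :: "'a::euclidean_space \<Rightarrow> 'a \<Rightarrow> real"
  assumes "is_inner_product ip"
  shows "bounded_bilinear ip"
  using inner_product_bilinear[OF assms] by (simp add: bilinear_conv_bounded_bilinear)

lemma inner_product_nonneg: "is_inner_product ip \<Longrightarrow> 0 \<le> ip u u"
  by (cases "u = 0") (simp_all add: inner_product_pos less_imp_le linear_0[OF inner_product_linear])

lemma ip_norm_nonneg: "is_inner_product ip \<Longrightarrow> 0 \<le> ip_norm ip u"
  by (simp add: ip_norm_def inner_product_nonneg)

lemma ip_norm_sq: "is_inner_product ip \<Longrightarrow> (ip_norm ip u)\<^sup>2 = ip u u"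
  by (simp add: ip_norm_def inner_product_nonneg)

lemma ip_norm_scale:
  assumes "is_inner_product ip"
  shows "ip_norm ip (t *\<^sub>R u) = \<bar>t\<bar> * ip_norm ip u"
proof -
  have "ip (t *\<^sub>R u) (t *\<^sub>R u) = t\<^sup>2 * ip u u"
    using inner_product_bilinear[OF assms]
    by (simp add: bilinear_lmul bilinear_rmul power2_eq_square)
  then show ?thesis
    by (simp add: ip_norm_def real_sqrt_mult)
qed

lemma is_inner_product_prod_ip:
  assumes "is_inner_product ip"
  shows "is_inner_product (prod_ip ip)"
  unfolding is_inner_product_def
proof (intro conjI allI impI)
  fix u :: "'a \<times> 'b"
  have lin: "linear (ip (fst u))" by (rule inner_product_linear[OF assms])
  show "linear (prod_ip ip u)"
    by (rule linearI)
      (simp_all add: prod_ip_def linear_add[OF lin] linear_scale[OF lin] inner_add_right distrib_left)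
  show "0 < prod_ip ip u u" if "u \<noteq> 0"
  proof (cases "fst u = 0")
    case True
    then have "snd u \<noteq> 0" using that by (metis prod.collapse zero_prod_def)
    then show ?thesis
      unfolding prod_ip_def using inner_product_nonneg[OF assms] by (intro add_nonneg_pos) auto
  next
    case False
    then show ?thesis
      unfolding prod_ip_def using inner_product_pos[OF assms] by (intro add_pos_nonneg) auto
  qed
next
  show "\<And>u v :: 'a \<times> 'b. prod_ip ip u v = prod_ip ip v u"
    by (simp add: prod_ip_def inner_commute inner_product_commute[OF assms])
qed

lemma is_inner_product_inner: "is_inner_product ((\<bullet>) :: 'a::real_inner \<Rightarrow> 'a \<Rightarrow> real)"
  unfolding is_inner_product_def
  by (auto intro!: linearI simp: inner_commute inner_add_right)

lemma ip_norm_inner: "ip_norm (\<bullet>) = (norm :: 'a::real_inner \<Rightarrow> real)"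
  by (simp add: ip_norm_def norm_eq_sqrt_inner fun_eq_iff)

lemma norm_diff_sq: "(norm (x - y))\<^sup>2 = (norm x)\<^sup>2 - 2 * (x \<bullet> y) + (norm (y :: 'a::real_inner))\<^sup>2"
  by (simp add: power2_norm_eq_inner inner_diff_left inner_diff_right inner_commute)

text \<open>A positive definite form is bounded below on the compact unit sphere, so it defines the
  same topology as the Euclidean inner product, with one constant for all comparisons.\<close>

lemma inner_product_norm_equivalence:
  fixes ip :: "'a::euclidean_space \<Rightarrow> 'a \<Rightarrow> real"
  assumes ip: "is_inner_product ip"
  obtains C where "C > 0" "\<And>u. norm u \<le> C * ip_norm ip u" "\<And>u. ip_norm ip u \<le> C * norm u"
    "\<And>u v. \<bar>ip u v\<bar> \<le> C * norm u * norm v"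
proof -
  interpret bb: bounded_bilinear ip by (rule inner_product_bounded_bilinear[OF ip])
  obtain K where K: "K > 0" "\<And>u v. norm (ip u v) \<le> norm u * norm v * K"
    using bb.pos_bounded by blast
  have "\<exists>m>0. \<forall>u. norm u = 1 \<longrightarrow> m \<le> ip u u"
  proof -
    have cont: "continuous_on (sphere (0::'a) 1) (\<lambda>u. ip u u)"
      by (intro bb.continuous_on continuous_intros)
    obtain e :: 'a where e: "e \<in> Basis" using nonempty_Basis by blast
    then have "sphere (0::'a) 1 \<noteq> {}" by (auto intro!: exI[of _ e])
    then obtain u0 where u0: "u0 \<in> sphere (0::'a) 1" "\<forall>u\<in>sphere 0 1. ip u0 u0 \<le> ip u u"
      using continuous_attains_inf[OF compact_sphere _ cont] by blast
    then have "u0 \<noteq> 0" by auto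
    then have "0 < ip u0 u0" by (rule inner_product_pos[OF ip])
    with u0 show ?thesis by (intro exI[of _ "ip u0 u0"]) auto
  qed
  then obtain m where m: "m > 0" "\<And>u. norm u = 1 \<Longrightarrow> m \<le> ip u u" by blast
  have lower: "sqrt m * norm u \<le> ip_norm ip u" for u
  proof (cases "u = 0")
    case True
    then show ?thesis by (simp add: ip_norm_nonneg[OF ip])
  next
    case False
    define w where "w = u /\<^sub>R norm u"
    have "norm w = 1" "u = norm u *\<^sub>R w" using False by (auto simp: w_def)
    have "sqrt m \<le> ip_norm ip w"
      using m(2)[OF \<open>norm w = 1\<close>] by (simp add: ip_norm_def)
    then have "sqrt m * norm u \<le> norm u * ip_norm ip w"
      by (metis mult.commute mult_left_mono norm_ge_zero)
    also have "\<dots> = ip_norm ip u"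
      by (metis \<open>u = norm u *\<^sub>R w\<close> abs_norm_cancel ip ip_norm_scale)
    finally show ?thesis .
  qed
  have upper: "ip_norm ip u \<le> sqrt K * norm u" for u
  proof -
    have "ip u u \<le> K * (norm u)\<^sup>2"
      using K(2)[of u u] by (simp add: power2_eq_square mult.commute mult.left_commute)
    then show ?thesis
      unfolding ip_norm_def by (metis norm_ge_zero real_sqrt_le_mono real_sqrt_mult real_sqrt_unique)
  qed
  define C where "C = max (max (sqrt K) K) (1 / sqrt m)"
  have C: "C > 0" "sqrt K \<le> C" "K \<le> C" "1 / sqrt m \<le> C"
    using K(1) by (auto simp: C_def)
  show ?thesis
  proof
    show "C > 0" by fact
    show "norm u \<le> C * ip_norm ip u" for u
    proof -
      have "norm u \<le> (1 / sqrt m) * ip_norm ip u"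
        using lower[of u] m(1) by (simp add: field_simps)
      also have "\<dots> \<le> C * ip_norm ip u"
        using C(4) by (intro mult_right_mono ip_norm_nonneg[OF ip]) auto
      finally show ?thesis .
    qed
    show "ip_norm ip u \<le> C * norm u" for u
      using upper[of u] mult_right_mono[OF C(2) norm_ge_zero[of u]] by linarith
    show "\<bar>ip u v\<bar> \<le> C * norm u * norm v" for u v
    proof -
      have "\<bar>ip u v\<bar> \<le> K * (norm u * norm v)" using K(2)[of u v] by (simp add: mult_ac)
      also have "\<dots> \<le> C * (norm u * norm v)" using C(3) by (intro mult_right_mono) auto
      finally show ?thesis by (simp add: mult_ac)
    qed
  qed
qed

lemma inner_product_ext:
  assumes ip: "is_inner_product ip" and "\<And>u. ip v u = ip w u"
  shows "v = w"
proof (rule ccontr)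
  assume "v \<noteq> w"
  then have "0 < ip (v - w) (v - w)" by (simp add: inner_product_pos[OF ip])
  moreover have "ip (v - w) (v - w) = ip v (v - w) - ip w (v - w)"
    using inner_product_bilinear[OF ip] by (simp add: bilinear_lsub)
  ultimately show False using assms(2) by simp
qed

lemma inner_product_representation:
  fixes ip :: "'a::euclidean_space \<Rightarrow> 'a \<Rightarrow> real"
  assumes ip: "is_inner_product ip" and "linear k"
  shows "\<exists>v. \<forall>u. ip v u = k u"
proof -
  have bl: "bilinear ip" by (rule inner_product_bilinear[OF ip])
  define T where "T v = (\<Sum>b\<in>Basis. ip v b *\<^sub>R b)" for v
  have ipT: "ip v u = T v \<bullet> u" for u v
  proof -
    have "ip v u = ip v (\<Sum>b\<in>Basis. (u \<bullet> b) *\<^sub>R b)" by (simp add: euclidean_representation)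
    also have "\<dots> = (\<Sum>b\<in>Basis. (u \<bullet> b) * ip v b)"
      using inner_product_linear[OF ip, of v] by (simp add: linear_sum linear_scale)
    finally show ?thesis
      by (simp add: T_def inner_sum_left inner_commute[of u] mult.commute)
  qed
  have "linear T"
    unfolding T_def using bl
    by (auto intro!: linearI simp: bilinear_ladd bilinear_lmul algebra_simps sum.distrib scaleR_sum_right)
  moreover have "inj T"
    using inner_product_ext[OF ip] by (auto intro!: injI simp: ipT)
  ultimately have "surj T" by (simp add: linear_injective_imp_surjective)
  define k' where "k' = (\<Sum>b\<in>Basis. k b *\<^sub>R b)"
  obtain v where v: "T v = k'" using \<open>surj T\<close> by (metis surjD)
  have "ip v u = k u" for u
  proof -
    have "k u = k (\<Sum>b\<in>Basis. (u \<bullet> b) *\<^sub>R b)" by (simp add: euclidean_representation)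
    also have "\<dots> = (\<Sum>b\<in>Basis. (u \<bullet> b) * k b)"
      using \<open>linear k\<close> by (simp add: linear_sum linear_scale)
    finally have "k u = k' \<bullet> u"
      by (simp add: k'_def inner_sum_left inner_commute[of u] mult.commute)
    then show ?thesis using v ipT by simp
  qed
  then show ?thesis by blast
qed

section \<open>Subgradients under strong convexity\<close>

lemmas eventually_at_right_unit = eventually_at_right_real[of 0 "1::real", OF zero_less_one]

lemma lsc_at_eventually: "lsc_at h x \<Longrightarrow> a < h x \<Longrightarrow> \<forall>\<^sub>F w in nhds x. a < h w"
  by (simp add: lsc_at_def le_Liminf_iff)

lemma lsc_at_sequentially:
  assumes "lsc_at h x" "xs \<longlonglongrightarrow> x" "\<And>n. h (xs n) \<le> ereal (c n)" "c \<longlonglongrightarrow> c0"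
  shows "h x \<le> ereal c0"
proof (rule ccontr)
  assume "\<not> h x \<le> ereal c0"
  then obtain a where a: "ereal c0 < a" "a < h x" using dense by (meson linorder_not_le)
  have "\<forall>\<^sub>F n in sequentially. a < h (xs n)"
    using eventually_compose_filterlim[OF lsc_at_eventually[OF assms(1) a(2)] assms(2)] .
  moreover have "\<forall>\<^sub>F n in sequentially. ereal (c n) < a"
    by (rule order_tendstoD(2)[OF tendsto_ereal[OF assms(4)] a(1)])
  ultimately have "\<forall>\<^sub>F n in sequentially. False"
  proof eventually_elim
    case (elim n)
    then show ?case using assms(3)[of n] by order
  qed
  then show False by simp
qed

lemma regular_subdiff_subset_subdiff: "regular_subdiff ip h x \<subseteq> subdiff ip h x"
proof
  fix v assume v: "v \<in> regular_subdiff ip h x"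
  then have "\<bar>h x\<bar> \<noteq> \<infinity>" by (simp add: regular_subdiff_def)
  then show "v \<in> subdiff ip h x"
    unfolding subdiff_def using v
    by (intro CollectI conjI exI[of _ "\<lambda>_. x"] exI[of _ "\<lambda>_. v"]) auto
qed

lemma regular_subdiffI:
  assumes ip: "is_inner_product ip" and "\<bar>h x\<bar> \<noteq> \<infinity>"
    and "\<And>w. h x + ereal (ip v (w - x)) \<le> h w"
  shows "v \<in> regular_subdiff ip h x"
proof -
  have "h x + ereal (ip v (w - x) - e * ip_norm ip (w - x)) \<le> h w" if "e > 0" for e w
  proof -
    have "h x + ereal (ip v (w - x) - e * ip_norm ip (w - x)) \<le> h x + ereal (ip v (w - x))"
      using that ip_norm_nonneg[OF ip, of "w - x"] by (intro add_left_mono) auto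
    then show ?thesis using assms(3)[of w] by (rule order_trans)
  qed
  then show ?thesis
    using assms(2) by (simp add: regular_subdiff_def)
qed

text \<open>Strong convexity along the segment from \<open>x\<close> to \<open>w\<close> turns the first-order inequality
  near \<open>x\<close> into a quadratic lower bound at \<open>w\<close>: divide by the step length and let it
  tend to zero. The case \<open>s = 0\<close> covers convex functions.\<close>

lemma regular_subgradient_growth:
  fixes ip :: "'a::euclidean_space \<Rightarrow> 'a \<Rightarrow> real"
  assumes ip: "is_inner_product ip" and v: "v \<in> regular_subdiff ip h x"
    and conv: "\<And>t. 0 < t \<Longrightarrow> t < 1 \<Longrightarrow>
      h ((1 - t) *\<^sub>R x + t *\<^sub>R w) + ereal (s / 2 * (1 - t) * t * (ip_norm ip (x - w))\<^sup>2)
        \<le> ereal (1 - t) * h x + ereal t * h w"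
    and "h w \<noteq> -\<infinity>"
  shows "h x + ereal (ip v (w - x) + s / 2 * (ip_norm ip (w - x))\<^sup>2) \<le> h w"
proof (cases "h w")
  case (real c)
  obtain a where a: "h x = ereal a" using v by (auto simp: regular_subdiff_def)
  define n where "n = ip_norm ip (w - x)"
  have n_sym: "ip_norm ip (x - w) = n"
    using ip_norm_scale[OF ip, of "-1" "w - x"] by (simp add: n_def)
  have key: "ip v (w - x) - e * n \<le> c - a - s / 2 * n\<^sup>2" if "e > 0" for e
  proof -
    have "\<forall>\<^sub>F u in nhds x. h x + ereal (ip v (u - x) - e * ip_norm ip (u - x)) \<le> h u"
      using v that by (simp add: regular_subdiff_def)
    moreover have "((\<lambda>t. (1 - t) *\<^sub>R x + t *\<^sub>R w) \<longlongrightarrow> x) (at_right (0::real))"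
      by (auto intro!: tendsto_eq_intros)
    ultimately have "\<forall>\<^sub>F t in at_right (0::real). h x + ereal (ip v (((1 - t) *\<^sub>R x + t *\<^sub>R w) - x)
        - e * ip_norm ip (((1 - t) *\<^sub>R x + t *\<^sub>R w) - x)) \<le> h ((1 - t) *\<^sub>R x + t *\<^sub>R w)"
      by (rule eventually_compose_filterlim)
    moreover have "\<forall>\<^sub>F t in at_right (0::real). 0 < t \<and> t < 1"
      using eventually_at_right_unit by (auto elim!: eventually_mono)
    ultimately have "\<forall>\<^sub>F t in at_right (0::real). ip v (w - x) - e * n \<le> c - a - s / 2 * (1 - t) * n\<^sup>2"
    proof eventually_elim
      case (elim t)
      have "((1 - t) *\<^sub>R x + t *\<^sub>R w) - x = t *\<^sub>R (w - x)" by (simp add: algebra_simps)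
      then have 1: "h x + ereal (t * ip v (w - x) - e * (t * n)) \<le> h ((1 - t) *\<^sub>R x + t *\<^sub>R w)"
        using elim by (simp add: linear_scale[OF inner_product_linear[OF ip]] ip_norm_scale[OF ip] n_def)
      have "h x + ereal (t * ip v (w - x) - e * (t * n)) + ereal (s / 2 * (1 - t) * t * n\<^sup>2)
          \<le> ereal (1 - t) * h x + ereal t * h w"
        using order_trans[OF add_right_mono[OF 1] conv[of t, unfolded n_sym]] elim by blast
      then have "a + (t * ip v (w - x) - e * (t * n)) + s / 2 * (1 - t) * t * n\<^sup>2 \<le> (1 - t) * a + t * c"
        by (simp add: a real)
      then have "t * (ip v (w - x) - e * n) \<le> t * (c - a - s / 2 * (1 - t) * n\<^sup>2)"
        by (simp add: algebra_simps)
      then show ?case using elim by (simp only: mult_le_cancel_left_pos)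
    qed
    moreover have "((\<lambda>t. c - a - s / 2 * (1 - t) * n\<^sup>2) \<longlongrightarrow> c - a - s / 2 * n\<^sup>2) (at_right 0)"
      by (auto intro!: tendsto_eq_intros)
    ultimately show ?thesis
      using tendsto_lowerbound trivial_limit_at_right_real by blast
  qed
  have "((\<lambda>e. ip v (w - x) - e * n) \<longlongrightarrow> ip v (w - x)) (at_right 0)"
    by (auto intro!: tendsto_eq_intros)
  moreover have "\<forall>\<^sub>F e in at_right (0::real). ip v (w - x) - e * n \<le> c - a - s / 2 * n\<^sup>2"
    using eventually_at_right_unit key by (auto elim!: eventually_mono)
  ultimately have "ip v (w - x) \<le> c - a - s / 2 * n\<^sup>2"
    using tendsto_upperbound trivial_limit_at_right_real by blast
  then show ?thesis by (simp add: a real n_def)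
qed (use assms(4) in auto)

text \<open>The bound passes to limiting subgradients, because these come with convergent function
  values.\<close>

lemma subgradient_growth:
  fixes ip :: "'a::euclidean_space \<Rightarrow> 'a \<Rightarrow> real"
  assumes ip: "is_inner_product ip" and v: "v \<in> subdiff ip h x"
    and N: "open N" "x \<in> N" and w: "w \<in> N" "h w \<noteq> -\<infinity>"
    and conv: "\<And>x t. x \<in> N \<Longrightarrow> 0 < t \<Longrightarrow> t < 1 \<Longrightarrow>
      h ((1 - t) *\<^sub>R x + t *\<^sub>R w) + ereal (s / 2 * (1 - t) * t * (ip_norm ip (x - w))\<^sup>2)
        \<le> ereal (1 - t) * h x + ereal t * h w"
  shows "h x + ereal (ip v (w - x) + s / 2 * (ip_norm ip (w - x))\<^sup>2) \<le> h w"
proof -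
  interpret bb: bounded_bilinear ip by (rule inner_product_bounded_bilinear[OF ip])
  obtain xs vs where xs: "xs \<longlonglongrightarrow> x" "(\<lambda>k. h (xs k)) \<longlonglongrightarrow> h x" "vs \<longlonglongrightarrow> v"
    "\<And>k. vs k \<in> regular_subdiff ip h (xs k)"
    using v by (auto simp: subdiff_def)
  have "\<forall>\<^sub>F k in sequentially. xs k \<in> N" using xs(1) N topological_tendstoD by blast
  then have le: "\<forall>\<^sub>F k in sequentially.
      h (xs k) + ereal (ip (vs k) (w - xs k) + s / 2 * ip (w - xs k) (w - xs k)) \<le> h w"
  proof eventually_elim
    case (elim k)
    show ?case
      using regular_subgradient_growth[OF ip xs(4)[of k] conv[OF elim] w(2)]
      unfolding ip_norm_sq[OF ip] .
  qed
  have "(\<lambda>k. ip (vs k) (w - xs k) + s / 2 * ip (w - xs k) (w - xs k))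
      \<longlonglongrightarrow> ip v (w - x) + s / 2 * ip (w - x) (w - x)"
    using xs by (intro tendsto_intros bb.tendsto)
  then have "(\<lambda>k. h (xs k) + ereal (ip (vs k) (w - xs k) + s / 2 * ip (w - xs k) (w - xs k)))
      \<longlonglongrightarrow> h x + ereal (ip v (w - x) + s / 2 * ip (w - x) (w - x))"
    using v by (intro tendsto_add_ereal xs tendsto_ereal) (auto simp: subdiff_def)
  from tendsto_upperbound[OF this le] show ?thesis
    by (simp add: ip_norm_sq[OF ip])
qed

lemma convex_subgradient:
  fixes ip :: "'a::euclidean_space \<Rightarrow> 'a \<Rightarrow> real"
  assumes ip: "is_inner_product ip" and "proper_fun h" "ereal_convex_on UNIV h"
    and v: "v \<in> subdiff ip h x"
  shows "h x + ereal (ip v (w - x)) \<le> h w"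
proof -
  have "h x + ereal (ip v (w - x) + 0 / 2 * (ip_norm ip (w - x))\<^sup>2) \<le> h w"
  proof (rule subgradient_growth[OF ip v open_UNIV])
    show "h w \<noteq> -\<infinity>" using assms(2) by (simp add: proper_fun_def)
    show "h ((1 - t) *\<^sub>R x + t *\<^sub>R w) + ereal (0 / 2 * (1 - t) * t * (ip_norm ip (x - w))\<^sup>2)
        \<le> ereal (1 - t) * h x + ereal t * h w" if "0 < t" "t < 1" for x t
      using assms(3) that by (simp add: ereal_convex_on_def zero_ereal_def[symmetric])
  qed auto
  then show ?thesis by simp
qed

section \<open>Variational strong convexity as uniform quadratic growth\<close>

text \<open>The convex minorant has the same subgradients and values near the reference pair, and it lies below
  \<open>\<phi>\<close> everywhere on the neighbourhood, so its growth is inherited.\<close>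

lemma variationally_strongly_convex_growth:
  fixes ip :: "'a::euclidean_space \<Rightarrow> 'a \<Rightarrow> real"
  assumes ip: "is_inner_product ip" and vsc: "variationally_strongly_convex ip \<phi> w z"
  obtains N Z s where "open N" "w \<in> N" "open Z" "z \<in> Z" "s > 0"
    "\<And>x v u. (x, v) \<in> gph_subdiff ip \<phi> \<Longrightarrow> x \<in> N \<Longrightarrow> v \<in> Z \<Longrightarrow> u \<in> N \<Longrightarrow>
      \<phi> x + ereal (ip v (u - x) + s / 2 * (ip_norm ip (u - x))\<^sup>2) \<le> \<phi> u"
proof -
  obtain N Z h where N: "open N" "convex N" "w \<in> N" and Z: "open Z" "z \<in> Z"
    and h: "proper_fun h" "\<forall>x\<in>N. h x \<le> \<phi> x" and sc: "strongly_convex_on ip N h"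
    and gph: "(N \<times> Z) \<inter> gph_subdiff ip h = (N \<times> Z) \<inter> gph_subdiff ip \<phi>"
    and eq: "\<forall>(x, v) \<in> (N \<times> Z) \<inter> gph_subdiff ip \<phi>. h x = \<phi> x"
    using vsc unfolding variationally_strongly_convex_def by blast
  obtain s where s: "s > 0"
    "\<And>x y u v. x\<in>N \<Longrightarrow> y\<in>N \<Longrightarrow> u\<ge>0 \<Longrightarrow> v\<ge>0 \<Longrightarrow> u + v = 1 \<Longrightarrow>
        h (u *\<^sub>R x + v *\<^sub>R y) + ereal (s / 2 * u * v * (ip_norm ip (x - y))\<^sup>2)
          \<le> ereal u * h x + ereal v * h y"
    using sc unfolding strongly_convex_on_def by blast
  show ?thesis
  proof (rule that[OF N(1,3) Z s(1)])
    fix x v u assume xv: "(x, v) \<in> gph_subdiff ip \<phi>" "x \<in> N" "v \<in> Z" and u: "u \<in> N"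
    then have "(x, v) \<in> gph_subdiff ip h" and "h x = \<phi> x" using gph eq by auto
    then have "v \<in> subdiff ip h x" by (simp add: gph_subdiff_def)
    from subgradient_growth[OF ip this N(1) xv(2) u, of s]
    have "h x + ereal (ip v (u - x) + s / 2 * (ip_norm ip (u - x))\<^sup>2) \<le> h u"
      using h(1) s(2) u by (auto simp: proper_fun_def)
    then show "\<phi> x + ereal (ip v (u - x) + s / 2 * (ip_norm ip (u - x))\<^sup>2) \<le> \<phi> u"
      using \<open>h x = \<phi> x\<close> h(2) u by (metis order_trans)
  qed
qed

text \<open>Affine functions turn the convexity inequality into an equality, so the defect of an affine function plus a quadratic comes from the quadratic alone.\<close>

lemma quadratic_convexity_defect:
  assumes ip: "is_inner_product ip" and t: "t + t' = 1"
  shows "ip v (t *\<^sub>R u + t' *\<^sub>R w - x) + s / 2 * ip (t *\<^sub>R u + t' *\<^sub>R w - x) (t *\<^sub>R u + t' *\<^sub>R w - x)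
      + s / 2 * t * t' * ip (u - w) (u - w)
    = t * (ip v (u - x) + s / 2 * ip (u - x) (u - x)) + t' * (ip v (w - x) + s / 2 * ip (w - x) (w - x))"
proof -
  define a b where "a = u - x" and "b = w - x"
  have x: "t *\<^sub>R u + t' *\<^sub>R w - x = t *\<^sub>R a + t' *\<^sub>R b"
    using scaleR_left_distrib[of t t' x] t by (simp add: a_def b_def algebra_simps)
  have uw: "u - w = a - b" by (simp add: a_def b_def)
  note bl = inner_product_bilinear[OF ip]
  have ab: "ip b a = ip a b" by (rule inner_product_commute[OF ip])
  have t': "t' = 1 - t" using t by simp
  show ?thesis
    unfolding x uw a_def[symmetric] b_def[symmetric]
    by (simp add: bilinear_ladd[OF bl] bilinear_radd[OF bl] bilinear_lmul[OF bl] bilinear_rmul[OF bl]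
        bilinear_lsub[OF bl] bilinear_rsub[OF bl] ab t' field_simps)
qed

text \<open>All supporting quadratics have the same second-order part, so their supremum \<open>h\<close> is strongly convex and
  lower semicontinuous on the whole space, and growth says that it is a minorant touching \<open>\<phi>\<close> at the base points.
  It remains to exclude further subgradients \<open>(x, v)\<close> of \<open>h\<close>. By surjectivity \<open>v\<close> is a subgradient of
  \<open>\<phi>\<close>, hence of \<open>h\<close>, at some \<open>x1\<close>; a strongly convex function has a given subgradient at one
  point only, so \<open>x = x1\<close>.\<close>

lemma variationally_strongly_convexI:
  fixes ip :: "'a::euclidean_space \<Rightarrow> 'a \<Rightarrow> real"
  assumes ip: "is_inner_product ip"
    and wz: "(w, z) \<in> gph_subdiff ip \<phi>" and lsc: "\<forall>\<^sub>F x in nhds w. lsc_at \<phi> x"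
    and N: "open N" "convex N" "w \<in> N" and Z: "open Z" "convex Z" "z \<in> Z" and s: "s > 0"
    and growth: "\<And>x v u. (x, v) \<in> gph_subdiff ip \<phi> \<Longrightarrow> x \<in> N \<Longrightarrow> v \<in> Z \<Longrightarrow> u \<in> N \<Longrightarrow>
      \<phi> x + ereal (ip v (u - x) + s / 2 * (ip_norm ip (u - x))\<^sup>2) \<le> \<phi> u"
    and onto: "\<And>v. v \<in> Z \<Longrightarrow> \<exists>x\<in>N. (x, v) \<in> gph_subdiff ip \<phi>"
  shows "variationally_strongly_convex ip \<phi> w z"
proof -
  interpret bb: bounded_bilinear ip by (rule inner_product_bounded_bilinear[OF ip])
  define A where "A = (N \<times> Z) \<inter> gph_subdiff ip \<phi>"
  define q where "q p u = real_of_ereal (\<phi> (fst p)) + (ip (snd p) (u - fst p)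
      + s / 2 * ip (u - fst p) (u - fst p))" for p u
  define h where "h u = (SUP p\<in>A. ereal (q p u))" for u
  have finite: "\<phi> x = ereal (real_of_ereal (\<phi> x))" if "(x, v) \<in> A" for x v
    using that by (auto simp: A_def gph_subdiff_def subdiff_def)
  have q_le: "ereal (q p u) \<le> h u" if "p \<in> A" for p u
    using that unfolding h_def by (rule SUP_upper)
  have h_le: "h u \<le> \<phi> u" if "u \<in> N" for u
    unfolding h_def
  proof (rule SUP_least)
    fix p assume "p \<in> A"
    moreover obtain x v where "p = (x, v)" by fastforce
    ultimately have p: "(x, v) \<in> A" by simp
    then have "\<phi> x + ereal (ip v (u - x) + s / 2 * (ip_norm ip (u - x))\<^sup>2) \<le> \<phi> u"
      using growth that by (auto simp: A_def)
    then show "ereal (q p u) \<le> \<phi> u"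
      unfolding q_def \<open>p = (x, v)\<close> fst_conv snd_conv plus_ereal.simps(1)[symmetric]
      by (simp add: finite[OF p, symmetric] ip_norm_sq[OF ip])
  qed
  have h_eq: "h x = \<phi> x" if "(x, v) \<in> A" for x v
  proof (rule antisym)
    show "h x \<le> \<phi> x" using that by (intro h_le) (auto simp: A_def)
    have "\<phi> x = ereal (q (x, v) x)"
      using finite[OF that] by (simp add: q_def bb.zero_right)
    then show "\<phi> x \<le> h x" using q_le[OF that] by simp
  qed
  have wzA: "(w, z) \<in> A" using wz N Z by (simp add: A_def)
  have sc: "h (t *\<^sub>R x + t' *\<^sub>R y) + ereal (s / 2 * t * t' * (ip_norm ip (x - y))\<^sup>2)
      \<le> ereal t * h x + ereal t' * h y" if t: "t \<ge> 0" "t' \<ge> 0" "t + t' = 1" for x y t t'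
  proof -
    define c where "c = s / 2 * t * t' * ip (x - y) (x - y)"
    have "h (t *\<^sub>R x + t' *\<^sub>R y) \<le> (ereal t * h x + ereal t' * h y) - ereal c"
      unfolding h_def[of "t *\<^sub>R x + t' *\<^sub>R y"]
    proof (rule SUP_least)
      fix p assume p: "p \<in> A"
      have "real_of_ereal (\<phi> (fst p)) = t * real_of_ereal (\<phi> (fst p)) + t' * real_of_ereal (\<phi> (fst p))"
        using t(3) by (metis distrib_right mult_1)
      then have "q p (t *\<^sub>R x + t' *\<^sub>R y) + c = t * q p x + t' * q p y"
        using quadratic_convexity_defect[OF ip t(3), of "snd p" x y "fst p" s]
        unfolding q_def c_def by (simp add: algebra_simps)
      then have "ereal (q p (t *\<^sub>R x + t' *\<^sub>R y)) + ereal c = ereal t * ereal (q p x) + ereal t' * ereal (q p y)"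
        by simp
      also have "\<dots> \<le> ereal t * h x + ereal t' * h y"
        using q_le[OF p] t by (intro add_mono ereal_mult_left_mono) auto
      finally show "ereal (q p (t *\<^sub>R x + t' *\<^sub>R y)) \<le> (ereal t * h x + ereal t' * h y) - ereal c"
        by (simp add: ereal_le_minus)
    qed
    then show ?thesis
      by (simp add: ereal_le_minus c_def ip_norm_sq[OF ip])
  qed
  have h_proper: "proper_fun h"
    unfolding proper_fun_def
  proof (intro conjI allI exI)
    show "h u \<noteq> -\<infinity>" for u using q_le[OF wzA, of u] by auto
    show "h w \<noteq> \<infinity>" using h_eq[OF wzA] finite[OF wzA] by (cases "\<phi> w") auto
  qed
  have h_lsc: "lsc_at h x" for x
    unfolding lsc_at_def le_Liminf_iff
  proof (intro allI impI)
    fix y assume "y < h x"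
    then obtain p where p: "p \<in> A" "y < ereal (q p x)" by (auto simp: h_def less_SUP_iff)
    have "((\<lambda>u. ereal (q p u)) \<longlongrightarrow> ereal (q p x)) (nhds x)"
      unfolding q_def by (intro tendsto_intros bb.tendsto filterlim_ident)
    then have "\<forall>\<^sub>F u in nhds x. y < ereal (q p u)" using p(2) by (rule order_tendstoD)
    then show "\<forall>\<^sub>F u in nhds x. y < h u"
      by eventually_elim (use q_le[OF p(1)] in \<open>meson less_le_trans\<close>)
  qed
  have h_convex: "ereal_convex_on UNIV h"
    unfolding ereal_convex_on_def
  proof (intro conjI ballI allI impI)
    fix x y :: 'a and t t' :: real assume t: "0 \<le> t" "0 \<le> t'" "t + t' = 1"
    have "h (t *\<^sub>R x + t' *\<^sub>R y) + ereal 0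
        \<le> h (t *\<^sub>R x + t' *\<^sub>R y) + ereal (s / 2 * t * t' * (ip_norm ip (x - y))\<^sup>2)"
      using s t by (intro add_left_mono) auto
    then show "h (t *\<^sub>R x + t' *\<^sub>R y) \<le> ereal t * h x + ereal t' * h y"
      using sc[OF t, of x y] unfolding zero_ereal_def[symmetric] add_0_right by (rule order_trans)
  qed simp
  have A_sub: "v \<in> subdiff ip h x" if "(x, v) \<in> A" for x v
  proof -
    have "h x + ereal (ip v (u - x)) \<le> h u" for u
    proof -
      have "h x + ereal (ip v (u - x)) = ereal (real_of_ereal (\<phi> x) + ip v (u - x))"
        using h_eq[OF that] finite[OF that] by (cases "\<phi> x") auto
      also have "\<dots> \<le> ereal (q (x, v) u)"
        using s by (simp add: q_def inner_product_nonneg[OF ip])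
      also have "\<dots> \<le> h u" by (rule q_le[OF that])
      finally show ?thesis .
    qed
    moreover have "\<bar>h x\<bar> \<noteq> \<infinity>" using h_eq[OF that] finite[OF that]
      by (cases "\<phi> x") auto
    ultimately have "v \<in> regular_subdiff ip h x" by (intro regular_subdiffI[OF ip])
    then show ?thesis using regular_subdiff_subset_subdiff by blast
  qed
  have growth_h: "h x + ereal (ip v (u - x) + s / 2 * (ip_norm ip (u - x))\<^sup>2) \<le> h u"
    if "v \<in> subdiff ip h x" for x v u
    by (rule subgradient_growth[OF ip that open_UNIV])
      (use h_proper sc in \<open>auto simp: proper_fun_def\<close>)
  have sub_A: "(x, v) \<in> A" if x: "x \<in> N" and v: "v \<in> Z" and xv: "v \<in> subdiff ip h x" for x v
  proof -
    obtain x1 where x1: "x1 \<in> N" "(x1, v) \<in> gph_subdiff ip \<phi>" using onto[OF v] by blast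
    then have A1: "(x1, v) \<in> A" using v by (simp add: A_def)
    obtain a where a: "h x = ereal a" using xv by (auto simp: subdiff_def)
    obtain a1 where a1: "h x1 = ereal a1" using A_sub[OF A1] by (auto simp: subdiff_def)
    have "a + (ip v (x1 - x) + s / 2 * (ip_norm ip (x1 - x))\<^sup>2) \<le> a1"
      using growth_h[OF xv, of x1] by (simp add: a a1)
    moreover have "a1 + (ip v (x - x1) + s / 2 * (ip_norm ip (x - x1))\<^sup>2) \<le> a"
      using growth_h[OF A_sub[OF A1], of x] by (simp add: a a1)
    moreover have "ip v (x1 - x) = - ip v (x - x1)"
      by (metis bb.minus_right minus_diff_eq)
    ultimately have "s / 2 * (ip_norm ip (x1 - x))\<^sup>2 + s / 2 * (ip_norm ip (x - x1))\<^sup>2 \<le> 0" by simp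
    then have "s / 2 * (ip_norm ip (x - x1))\<^sup>2 \<le> 0"
      using s zero_le_power2[of "ip_norm ip (x1 - x)"] by (smt (verit) divide_nonneg_nonneg mult_nonneg_nonneg)
    then have "ip (x - x1) (x - x1) \<le> 0"
      using s by (simp add: ip_norm_sq[OF ip] mult_le_0_iff)
    then have "x = x1" using inner_product_pos[OF ip, of "x - x1"] by (cases "x = x1") auto
    then show ?thesis using A1 by simp
  qed
  have "(N \<times> Z) \<inter> gph_subdiff ip h = (N \<times> Z) \<inter> gph_subdiff ip \<phi>"
    using A_sub sub_A by (auto simp: A_def gph_subdiff_def)
  moreover have "strongly_convex_on ip N h"
    unfolding strongly_convex_on_def using N(2) s sc by blast
  moreover have "\<forall>(x, v) \<in> (N \<times> Z) \<inter> gph_subdiff ip \<phi>. h x = \<phi> x"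
    using h_eq by (auto simp: A_def)
  ultimately show ?thesis
    unfolding variationally_strongly_convex_def
    using wz lsc N Z h_proper h_lsc h_convex h_le by blast
qed

section \<open>Moreau envelopes\<close>

locale moreau =
  fixes \<theta> :: "'y::euclidean_space \<Rightarrow> ereal" and \<rho> :: real
  assumes theta_proper: "proper_fun \<theta>" and theta_lsc: "\<And>z. lsc_at \<theta> z"
    and theta_convex: "ereal_convex_on UNIV \<theta>"
    and theta_minorant: "\<exists>a y. \<forall>c. ereal (a + y \<bullet> c) \<le> \<theta> c"
    and rho_pos: "0 < \<rho>"
begin

definition regularized :: "'y \<Rightarrow> 'y \<Rightarrow> ereal" where
  "regularized a c = \<theta> c + ereal (\<rho> / 2 * (norm (c - a))\<^sup>2)"

lemma theta_not_MInf: "\<theta> c \<noteq> -\<infinity>"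
  using theta_proper by (simp add: proper_fun_def)

lemma regularized_strongly_convex:
  assumes "0 \<le> t" "t \<le> 1"
  shows "regularized a ((1 - t) *\<^sub>R x + t *\<^sub>R y) + ereal (\<rho> / 2 * (1 - t) * t * (norm (x - y))\<^sup>2)
    \<le> ereal (1 - t) * regularized a x + ereal t * regularized a y"
proof -
  define z where "z = (1 - t) *\<^sub>R x + t *\<^sub>R y"
  have th: "\<theta> z \<le> ereal (1 - t) * \<theta> x + ereal t * \<theta> y"
    unfolding z_def using theta_convex assms by (simp add: ereal_convex_on_def)
  have "\<rho> / 2 * (norm (z - a))\<^sup>2 + \<rho> / 2 * (1 - t) * t * (norm (x - y))\<^sup>2
      = (1 - t) * (\<rho> / 2 * (norm (x - a))\<^sup>2) + t * (\<rho> / 2 * (norm (y - a))\<^sup>2)"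
    using quadratic_convexity_defect[OF is_inner_product_inner, of "1 - t" t 0 x y a \<rho>]
    by (simp add: z_def power2_norm_eq_inner)
  then have "regularized a z + ereal (\<rho> / 2 * (1 - t) * t * (norm (x - y))\<^sup>2)
      = \<theta> z + ereal ((1 - t) * (\<rho> / 2 * (norm (x - a))\<^sup>2) + t * (\<rho> / 2 * (norm (y - a))\<^sup>2))"
    by (simp add: regularized_def add.assoc)
  also have "\<dots> \<le> (ereal (1 - t) * \<theta> x + ereal t * \<theta> y)
      + ereal ((1 - t) * (\<rho> / 2 * (norm (x - a))\<^sup>2) + t * (\<rho> / 2 * (norm (y - a))\<^sup>2))"
    by (rule add_right_mono[OF th])
  also have "\<dots> = ereal (1 - t) * regularized a x + ereal t * regularized a y"
    using theta_not_MInf[of x] theta_not_MInf[of y] assms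
    by (cases "\<theta> x"; cases "\<theta> y"; cases "t = 0"; cases "t = 1")
      (auto simp: regularized_def ereal_distrib algebra_simps)
  finally show ?thesis by (simp add: z_def)
qed

text \<open>Minimizing sequences of a strongly convex function are Cauchy, so lower semicontinuity
  suffices for existence of the proximal point. The affine minorant bounds the infimum.\<close>

lemma regularized_minimizer_exists: "\<exists>p. \<bar>\<theta> p\<bar> \<noteq> \<infinity> \<and> (\<forall>c. regularized a p \<le> regularized a c)"
proof -
  obtain a0 y0 where minorant: "\<And>c. ereal (a0 + y0 \<bullet> c) \<le> \<theta> c" using theta_minorant by blast
  define k where "k = a0 + y0 \<bullet> a - (norm y0)\<^sup>2 / (2 * \<rho>)"
  have below: "ereal k \<le> regularized a c" for c
  proof -
    have "0 \<le> \<rho> / 2 * (norm (c - a + (1 / \<rho>) *\<^sub>R y0))\<^sup>2" using rho_pos by simp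
    also have "\<dots> = \<rho> / 2 * (norm (c - a))\<^sup>2 + y0 \<bullet> (c - a) + (norm y0)\<^sup>2 / (2 * \<rho>)"
      using rho_pos unfolding power2_norm_eq_inner
      by (simp add: inner_simps inner_commute field_simps)
    finally have "k \<le> a0 + y0 \<bullet> c + \<rho> / 2 * (norm (c - a))\<^sup>2"
      by (simp add: k_def inner_diff_right)
    then have "ereal k \<le> ereal (a0 + y0 \<bullet> c) + ereal (\<rho> / 2 * (norm (c - a))\<^sup>2)" by simp
    also have "\<dots> \<le> regularized a c"
      unfolding regularized_def by (rule add_right_mono[OF minorant])
    finally show ?thesis .
  qed
  define I where "I = (INF c. regularized a c)"
  obtain c1 where "\<theta> c1 \<noteq> \<infinity>" using theta_proper by (auto simp: proper_fun_def)
  then have "regularized a c1 \<noteq> \<infinity>" by (simp add: regularized_def)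
  moreover have "I \<le> regularized a c1" unfolding I_def by (rule INF_lower) simp
  moreover have "ereal k \<le> I" unfolding I_def by (rule INF_greatest) (rule below)
  ultimately obtain i where i: "I = ereal i" by (cases I) auto
  have lower: "ereal i \<le> regularized a c" for c
    unfolding i[symmetric] I_def by (rule INF_lower) simp
  have "\<exists>c. regularized a c < ereal (i + 1 / real (Suc n))" for n
  proof -
    have "I < ereal (i + 1 / real (Suc n))" by (simp add: i)
    then show ?thesis unfolding I_def INF_less_iff by blast
  qed
  then obtain c where c: "\<And>n. regularized a (c n) < ereal (i + 1 / real (Suc n))" by metis
  have dist: "(norm (c m - c n))\<^sup>2 \<le> 8 / \<rho> * (1 / real (Suc N))" if "N \<le> m" "N \<le> n" for m n N
  proof -
    have le: "regularized a (c j) \<le> ereal (i + 1 / real (Suc N))" if "N \<le> j" for j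
    proof -
      have "i + 1 / real (Suc j) \<le> i + 1 / real (Suc N)"
        using that by (simp add: frac_le)
      then show ?thesis using c[of j] by (metis ereal_less_eq(3) less_imp_le order_trans)
    qed
    have "ereal i + ereal (\<rho> / 2 * (1 - 1/2) * (1/2) * (norm (c m - c n))\<^sup>2)
        \<le> regularized a ((1 - 1/2) *\<^sub>R c m + (1/2) *\<^sub>R c n) + ereal (\<rho> / 2 * (1 - 1/2) * (1/2) * (norm (c m - c n))\<^sup>2)"
      by (intro add_right_mono lower)
    also have "\<dots> \<le> ereal (1 - 1/2) * regularized a (c m) + ereal (1/2) * regularized a (c n)"
      by (rule regularized_strongly_convex) auto
    also have "\<dots> \<le> ereal (1 - 1/2) * ereal (i + 1 / real (Suc N)) + ereal (1/2) * ereal (i + 1 / real (Suc N))"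
      using that by (intro add_mono ereal_mult_left_mono le) auto
    finally have "i + \<rho> / 8 * (norm (c m - c n))\<^sup>2 \<le> i + 1 / real (Suc N)" by simp
    then have "\<rho> / 8 * (norm (c m - c n))\<^sup>2 \<le> 1 / real (Suc N)" by (rule add_le_imp_le_left)
    then have "8 / \<rho> * (\<rho> / 8 * (norm (c m - c n))\<^sup>2) \<le> 8 / \<rho> * (1 / real (Suc N))"
      using rho_pos by (intro mult_left_mono) auto
    then show ?thesis using rho_pos by simp
  qed
  have "Cauchy c"
  proof (rule metric_CauchyI)
    fix e :: real assume "0 < e"
    then have "0 < e\<^sup>2 * \<rho> / 8" using rho_pos by simp
    then obtain N where N: "1 / real (Suc N) < e\<^sup>2 * \<rho> / 8" using nat_approx_posE by blast
    have "dist (c m) (c n) < e" if "N \<le> m" "N \<le> n" for m n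
    proof -
      have "8 / \<rho> * (1 / real (Suc N)) < 8 / \<rho> * (e\<^sup>2 * \<rho> / 8)"
        using N rho_pos by (intro mult_strict_left_mono) auto
      also have "\<dots> = e\<^sup>2" using rho_pos by simp
      finally have "(norm (c m - c n))\<^sup>2 < e\<^sup>2"
        by (rule le_less_trans[OF dist[OF that]])
      then show ?thesis
        unfolding dist_norm by (rule power_less_imp_less_base) (use \<open>0 < e\<close> in simp)
    qed
    then show "\<exists>M. \<forall>m\<ge>M. \<forall>n\<ge>M. dist (c m) (c n) < e" by blast
  qed
  then obtain p where p: "c \<longlonglongrightarrow> p" using Cauchy_convergent convergentD by blast
  have "\<theta> (c n) \<le> ereal (i + 1 / real (Suc n) - \<rho> / 2 * (norm (c n - a))\<^sup>2)" for n
    using c[of n] unfolding regularized_def by (cases "\<theta> (c n)") auto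
  moreover have "(\<lambda>n. i + 1 / real (Suc n) - \<rho> / 2 * (norm (c n - a))\<^sup>2) \<longlonglongrightarrow> i + 0 - \<rho> / 2 * (norm (p - a))\<^sup>2"
    by (intro tendsto_intros p LIMSEQ_Suc lim_1_over_n)
  ultimately have th: "\<theta> p \<le> ereal (i + 0 - \<rho> / 2 * (norm (p - a))\<^sup>2)"
    by (rule lsc_at_sequentially[OF theta_lsc p])
  then have "regularized a p \<le> ereal i"
    unfolding regularized_def by (cases "\<theta> p") auto
  moreover have "\<bar>\<theta> p\<bar> \<noteq> \<infinity>" using th theta_not_MInf[of p] by (cases "\<theta> p") auto
  ultimately show ?thesis using order_trans[OF _ lower] by (intro exI[of _ p]) auto
qed

definition prox :: "'y \<Rightarrow> 'y" where
  "prox a = (SOME p. \<bar>\<theta> p\<bar> \<noteq> \<infinity> \<and> (\<forall>c. regularized a p \<le> regularized a c))"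

definition envelope :: "'y \<Rightarrow> real" where
  "envelope a = real_of_ereal (regularized a (prox a))"

lemma theta_prox_finite: "\<bar>\<theta> (prox a)\<bar> \<noteq> \<infinity>"
  and prox_minimizes: "regularized a (prox a) \<le> regularized a c"
  using someI_ex[OF regularized_minimizer_exists[of a]] by (auto simp: prox_def)

lemma regularized_prox: "regularized a (prox a) = ereal (envelope a)"
  using theta_prox_finite[of a] by (cases "\<theta> (prox a)") (auto simp: envelope_def regularized_def)

lemma theta_prox: "\<theta> (prox a) = ereal (envelope a - \<rho> / 2 * (norm (prox a - a))\<^sup>2)"
  using regularized_prox[of a] by (cases "\<theta> (prox a)") (auto simp: regularized_def)

text \<open>A minimizer has zero as a subgradient, and the regularized function is strongly convex with modulus \<open>\<rho>\<close>.\<close>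

lemma prox_growth: "ereal (envelope a + \<rho> / 2 * (norm (c - prox a))\<^sup>2) \<le> regularized a c"
proof -
  have "0 \<in> regular_subdiff (\<bullet>) (regularized a) (prox a)"
  proof (rule regular_subdiffI[OF is_inner_product_inner])
    show "\<bar>regularized a (prox a)\<bar> \<noteq> \<infinity>" by (simp add: regularized_prox)
    show "regularized a (prox a) + ereal (0 \<bullet> (w - prox a)) \<le> regularized a w" for w
      using prox_minimizes[of a w] by (simp add: zero_ereal_def[symmetric])
  qed
  then have "regularized a (prox a) + ereal (0 \<bullet> (c - prox a) + \<rho> / 2 * (ip_norm (\<bullet>) (c - prox a))\<^sup>2) \<le> regularized a c"
  proof (rule regular_subgradient_growth[OF is_inner_product_inner])
    show "regularized a c \<noteq> -\<infinity>"
      using theta_not_MInf[of c] by (cases "\<theta> c") (auto simp: regularized_def)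
    show "regularized a ((1 - t) *\<^sub>R prox a + t *\<^sub>R c) + ereal (\<rho> / 2 * (1 - t) * t * (ip_norm (\<bullet>) (prox a - c))\<^sup>2)
        \<le> ereal (1 - t) * regularized a (prox a) + ereal t * regularized a c" if "0 < t" "t < 1" for t
      unfolding ip_norm_inner by (rule regularized_strongly_convex) (use that in auto)
  qed
  then show ?thesis by (simp add: regularized_prox ip_norm_inner)
qed

text \<open>Each of two proximal points is tested against the growth inequality of the other; adding the results gives
  \<open>|p - p'|\<^sup>2 \<le> (p - p') \<bullet> (a - a')\<close>.\<close>

lemma prox_nonexpansive: "norm (prox a - prox a') \<le> norm (a - a')"
proof -
  have ineq: "envelope x + \<rho> / 2 * (norm (prox x' - prox x))\<^sup>2
      \<le> envelope x' - \<rho> / 2 * (norm (prox x' - x'))\<^sup>2 + \<rho> / 2 * (norm (prox x' - x))\<^sup>2" for x x'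
    using prox_growth[of x "prox x'"] by (simp add: regularized_def theta_prox)
  have "(norm (prox a - prox a'))\<^sup>2 \<le> (prox a - prox a') \<bullet> (a - a')"
  proof -
    have "\<rho> / 2 * (2 * (norm (prox a - prox a'))\<^sup>2) \<le> \<rho> / 2 * (2 * ((prox a - prox a') \<bullet> (a - a')))"
      using ineq[of a a'] ineq[of a' a]
      unfolding norm_diff_sq[of "prox _" "prox _"] norm_diff_sq[of "prox _" a] norm_diff_sq[of "prox _" a']
      by (simp add: inner_diff_left inner_diff_right inner_commute algebra_simps)
    then show ?thesis using rho_pos by simp
  qed
  also have "\<dots> \<le> norm (prox a - prox a') * norm (a - a')" by (rule norm_cauchy_schwarz)
  finally show ?thesis
    by (metis mult_le_cancel_left_pos norm_ge_zero order_le_less power2_eq_square)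
qed

text \<open>The optimality condition of the proximal problem at \<open>c\<close> reads \<open>y = \<rho> (a - c) \<in> \<partial>\<theta> c\<close> with
  \<open>a = c + y/\<rho>\<close>.\<close>

lemma prox_subgradient:
  assumes "\<bar>\<theta> c\<bar> \<noteq> \<infinity>" and sub: "\<And>w. \<theta> c + ereal (y \<bullet> (w - c)) \<le> \<theta> w"
  shows "prox (c + (1 / \<rho>) *\<^sub>R y) = c"
proof -
  define a where "a = c + (1 / \<rho>) *\<^sub>R y"
  define p where "p = prox a"
  have "\<rho> / 2 * (norm (p - a))\<^sup>2 = \<rho> / 2 * (norm (c - a))\<^sup>2 - y \<bullet> (p - c) + \<rho> / 2 * (norm (p - c))\<^sup>2"
    using rho_pos unfolding power2_norm_eq_inner a_def
    by (simp add: inner_simps inner_commute field_simps)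
  moreover obtain t where t: "\<theta> c = ereal t" using assms(1) by auto
  moreover obtain t' where t': "\<theta> p = ereal t'" using theta_prox by (metis p_def)
  moreover have "t + y \<bullet> (p - c) \<le> t'" using sub[of p] by (simp add: t t')
  ultimately have "t + \<rho> / 2 * (norm (c - a))\<^sup>2 + \<rho> / 2 * (norm (p - c))\<^sup>2 \<le> t' + \<rho> / 2 * (norm (p - a))\<^sup>2"
    by linarith
  moreover have "envelope a = t' + \<rho> / 2 * (norm (p - a))\<^sup>2"
    using theta_prox[of a] t' by (simp add: p_def)
  moreover have "envelope a \<le> t + \<rho> / 2 * (norm (c - a))\<^sup>2"
    using prox_minimizes[of a c] by (simp add: regularized_prox) (simp add: regularized_def t)
  ultimately have "\<rho> / 2 * (norm (p - c))\<^sup>2 \<le> 0" by linarith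
  then have "(norm (p - c))\<^sup>2 \<le> 0" using rho_pos by (simp add: mult_le_0_iff)
  then show ?thesis by (simp add: p_def a_def)
qed

text \<open>The proximal point of \<open>a\<close> is a competitor in the problem at \<open>a'\<close>.\<close>

lemma envelope_upper: "envelope a' \<le> envelope a + \<rho> * ((a - prox a) \<bullet> (a' - a)) + \<rho> / 2 * (norm (a' - a))\<^sup>2"
proof -
  have "ereal (envelope a') \<le> regularized a' (prox a)"
    using prox_minimizes[of a' "prox a"] by (simp add: regularized_prox)
  then have "envelope a' \<le> envelope a - \<rho> / 2 * (norm (prox a - a))\<^sup>2 + \<rho> / 2 * (norm (prox a - a'))\<^sup>2"
    by (simp add: regularized_def theta_prox)
  also have "\<dots> = envelope a + \<rho> * ((a - prox a) \<bullet> (a' - a)) + \<rho> / 2 * (norm (a' - a))\<^sup>2"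
    unfolding power2_norm_eq_inner by (simp add: inner_simps inner_commute field_simps)
  finally show ?thesis .
qed

text \<open>The upper estimate, used from \<open>a\<close> to \<open>a'\<close> and back, encloses the increment of the envelope between two
  quadratics, up to the change of the proximal point, which is controlled by nonexpansiveness.\<close>

lemma envelope_has_derivative: "(envelope has_derivative (\<lambda>h. \<rho> * ((a - prox a) \<bullet> h))) (at a)"
proof -
  have bound: "\<bar>envelope a' - envelope a - \<rho> * ((a - prox a) \<bullet> (a' - a))\<bar> \<le> 3 * \<rho> * (norm (a' - a))\<^sup>2" for a'
  proof -
    have up: "envelope a' - envelope a - \<rho> * ((a - prox a) \<bullet> (a' - a)) \<le> \<rho> / 2 * (norm (a' - a))\<^sup>2"
      using envelope_upper[of a' a] by simp
    have "\<rho> * ((a' - prox a') \<bullet> (a - a')) = - (\<rho> * ((a' - prox a') \<bullet> (a' - a)))"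
      by (simp add: inner_diff_right algebra_simps)
    then have "envelope a \<le> envelope a' - \<rho> * ((a' - prox a') \<bullet> (a' - a)) + \<rho> / 2 * (norm (a' - a))\<^sup>2"
      using envelope_upper[of a a'] by (simp add: norm_minus_commute)
    moreover have "\<rho> * ((a' - prox a') \<bullet> (a' - a)) - \<rho> * ((a - prox a) \<bullet> (a' - a))
        = \<rho> * (norm (a' - a))\<^sup>2 - \<rho> * ((prox a' - prox a) \<bullet> (a' - a))"
      unfolding power2_norm_eq_inner by (simp add: inner_simps algebra_simps)
    moreover have "(prox a' - prox a) \<bullet> (a' - a) \<le> (norm (a' - a))\<^sup>2"
    proof -
      have "(prox a' - prox a) \<bullet> (a' - a) \<le> norm (prox a' - prox a) * norm (a' - a)"
        by (rule norm_cauchy_schwarz)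
      also have "\<dots> \<le> norm (a' - a) * norm (a' - a)"
        by (intro mult_right_mono prox_nonexpansive) simp
      finally show ?thesis by (simp add: power2_eq_square)
    qed
    then have "\<rho> * ((prox a' - prox a) \<bullet> (a' - a)) \<le> \<rho> * (norm (a' - a))\<^sup>2"
      using rho_pos by simp
    moreover have "0 \<le> \<rho> * (norm (a' - a))\<^sup>2" using rho_pos by simp
    ultimately show ?thesis using up by linarith
  qed
  show ?thesis
    unfolding has_derivative_within_alt
  proof (intro conjI allI impI)
    show "bounded_linear (\<lambda>h. \<rho> * ((a - prox a) \<bullet> h))"
      by (intro bounded_linear_intros)
    fix e :: real assume "0 < e"
    have "norm (envelope x - envelope a - \<rho> * ((a - prox a) \<bullet> (x - a))) \<le> e * norm (x - a)"
      if "norm (x - a) < e / (3 * \<rho>)" for x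
    proof -
      have "3 * \<rho> * (norm (x - a))\<^sup>2 = (3 * \<rho> * norm (x - a)) * norm (x - a)"
        by (simp add: power2_eq_square)
      also have "\<dots> \<le> e * norm (x - a)"
        using that rho_pos by (intro mult_right_mono) (auto simp: field_simps)
      finally show ?thesis using bound[of x] by simp
    qed
    then show "\<exists>d>0. \<forall>y\<in>UNIV. norm (y - a) < d \<longrightarrow>
        norm (envelope y - envelope a - \<rho> * ((a - prox a) \<bullet> (y - a))) \<le> e * norm (y - a)"
      using \<open>0 < e\<close> rho_pos by (intro exI[of _ "e / (3 * \<rho>)"]) auto
  qed
qed

lemma continuous_on_prox: "continuous_on UNIV prox"
proof -
  have "1-lipschitz_on UNIV prox"
    by (rule lipschitz_onI) (auto simp: dist_norm prox_nonexpansive)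
  then show ?thesis by (rule lipschitz_on_continuous_on)
qed

end

section \<open>Continuously differentiable maps\<close>

text \<open>One-sided difference quotients suffice for all first-order comparisons below, and they are available even when
  only a segment to one side of \<open>x\<close> lies in the set at hand.\<close>

lemma directional_derivative_limit:
  fixes f :: "'a::real_normed_vector \<Rightarrow> real"
  assumes "(f has_derivative D) (at x)"
  shows "((\<lambda>t. (f (x + t *\<^sub>R u) - f x) / t) \<longlongrightarrow> D u) (at_right 0)"
proof -
  have "((\<lambda>t. x + t *\<^sub>R u) has_derivative (\<lambda>t. t *\<^sub>R u)) (at 0)"
    by (auto intro!: derivative_eq_intros)
  then have "((\<lambda>t. f (x + t *\<^sub>R u)) has_derivative (\<lambda>t. D (t *\<^sub>R u))) (at 0)"
    by (rule has_derivative_compose) (use assms in simp)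
  moreover have "D (t *\<^sub>R u) = t * D u" for t
    using has_derivative_linear[OF assms] by (simp add: linear_scale)
  ultimately have "((\<lambda>t. f (x + t *\<^sub>R u)) has_real_derivative D u) (at 0)"
    by (simp add: has_field_derivative_def mult_commute_abs)
  then have "((\<lambda>t. (f (x + t *\<^sub>R u) - f x) / t) \<longlongrightarrow> D u) (at 0)"
    by (simp add: DERIV_def)
  then show ?thesis by (rule filterlim_mono) (simp_all add: at_le)
qed

lemma C1_locally_lipschitz:
  fixes f :: "'a::euclidean_space \<Rightarrow> 'b::real_normed_vector"
  assumes S: "open S" "a \<in> S" and der: "\<And>x. x \<in> S \<Longrightarrow> (f has_derivative Df x) (at x)"
    and cont: "\<And>u. continuous_on S (\<lambda>x. Df x u)"
  obtains r K where "r > 0" "K \<ge> 0" "cball a r \<subseteq> S"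
    "\<And>x u. x \<in> cball a r \<Longrightarrow> norm (Df x u) \<le> K * norm u"
    "\<And>x y. x \<in> cball a r \<Longrightarrow> y \<in> cball a r \<Longrightarrow> norm (f x - f y) \<le> K * norm (x - y)"
proof -
  obtain r where r: "r > 0" "cball a r \<subseteq> S" using S open_contains_cball by blast
  have "\<exists>k\<ge>0. \<forall>x\<in>cball a r. norm (Df x b) \<le> k" for b
  proof -
    have "continuous_on (cball a r) (\<lambda>x. Df x b)"
      by (rule continuous_on_subset[OF cont r(2)])
    then have "bounded ((\<lambda>x. Df x b) ` cball a r)"
      by (intro compact_imp_bounded compact_continuous_image) auto
    then obtain k where k: "\<forall>x\<in>cball a r. norm (Df x b) \<le> k" by (auto simp: bounded_iff)
    then show ?thesis by (intro exI[of _ "max 0 k"]) auto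
  qed
  then obtain k where k: "\<And>b. k b \<ge> 0" "\<And>b x. x \<in> cball a r \<Longrightarrow> norm (Df x b) \<le> k b" by metis
  define K where "K = (\<Sum>b\<in>Basis. k b)"
  have "K \<ge> 0" by (simp add: K_def sum_nonneg k)
  have bound: "norm (Df x u) \<le> K * norm u" if x: "x \<in> cball a r" for x u
  proof -
    have lin: "linear (Df x)" using der r x by (blast intro: has_derivative_linear)
    have "Df x u = Df x (\<Sum>b\<in>Basis. (u \<bullet> b) *\<^sub>R b)" by (simp add: euclidean_representation)
    also have "\<dots> = (\<Sum>b\<in>Basis. (u \<bullet> b) *\<^sub>R Df x b)"
      by (simp add: linear_sum[OF lin] linear_scale[OF lin])
    finally have "norm (Df x u) \<le> (\<Sum>b\<in>Basis. norm ((u \<bullet> b) *\<^sub>R Df x b))"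
      by (metis norm_sum)
    also have "\<dots> \<le> (\<Sum>b\<in>Basis. k b * norm u)"
    proof (rule sum_mono)
      fix b :: 'a assume "b \<in> Basis"
      have "norm ((u \<bullet> b) *\<^sub>R Df x b) = \<bar>u \<bullet> b\<bar> * norm (Df x b)" by simp
      also have "\<dots> \<le> norm u * k b"
        using Basis_le_norm[OF \<open>b \<in> Basis\<close>] k x by (intro mult_mono) auto
      finally show "norm ((u \<bullet> b) *\<^sub>R Df x b) \<le> k b * norm u" by (simp add: mult.commute)
    qed
    finally show ?thesis by (simp add: K_def sum_distrib_right)
  qed
  show ?thesis
  proof (rule that[OF r(1) \<open>K \<ge> 0\<close> r(2) bound])
    fix x y assume xy: "x \<in> cball a r" "y \<in> cball a r"
    show "norm (f x - f y) \<le> K * norm (x - y)"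
    proof (rule differentiable_bound[OF convex_cball _ _ xy])
      show "(f has_derivative Df z) (at z within cball a r)" if "z \<in> cball a r" for z
        using der r that by (blast intro: has_derivative_at_withinI)
      show "onorm (Df z) \<le> K" if "z \<in> cball a r" for z
        using bound[OF that] by (rule onorm_le)
    qed
  qed
qed

lemma Ck_on_1_derivative:
  assumes "Ck_on 1 S f"
  shows "x \<in> S \<Longrightarrow> (f has_derivative frechet_derivative f (at x)) (at x)"
    and "continuous_on S (\<lambda>x. frechet_derivative f (at x) v)"
proof -
  have *: "Ck_on (Suc 0) S f" using assms by simp
  show "x \<in> S \<Longrightarrow> (f has_derivative frechet_derivative f (at x)) (at x)"
    using * by (simp add: frechet_derivative_works[symmetric])
  show "continuous_on S (\<lambda>x. frechet_derivative f (at x) v)" using * by simp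
qed

lemma smooth_on_derivative:
  assumes "smooth_on S f" "x \<in> S"
  shows "(f has_derivative frechet_derivative f (at x)) (at x)"
  using assms Ck_on_1_derivative(1) by (auto simp only: smooth_on_def)

lemma smooth_on_continuous_derivative:
  assumes "smooth_on S f"
  shows "continuous_on S (\<lambda>x. frechet_derivative f (at x) v)"
  using assms Ck_on_1_derivative(2) by (auto simp only: smooth_on_def)

lemma smooth_on_continuous: "smooth_on S f \<Longrightarrow> continuous_on S f"
  unfolding smooth_on_def Ck_on.simps(1)[symmetric] by blast

text \<open>Continuity of the derivative of the composition is seen after expanding its argument in the standard basis, since
  the hypotheses give continuity in the base point for fixed directions only.\<close>

lemma C1_pullback:
  fixes H :: "'e::euclidean_space \<Rightarrow> 'e" and f :: "'e \<Rightarrow> 'b::real_normed_vector"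
  assumes f: "Ck_on 1 V f" and H: "smooth_on S H" "H ` S \<subseteq> V"
  defines "D \<equiv> \<lambda>\<xi> u. frechet_derivative f (at (H \<xi>)) (frechet_derivative H (at \<xi>) u)"
  shows "\<xi> \<in> S \<Longrightarrow> ((f \<circ> H) has_derivative D \<xi>) (at \<xi>)"
    and "continuous_on S (\<lambda>\<xi>. D \<xi> u)"
proof -
  have der_f: "(f has_derivative frechet_derivative f (at (H \<xi>))) (at (H \<xi>))" if "\<xi> \<in> S" for \<xi>
    using Ck_on_1_derivative(1)[OF f] H(2) that by blast
  show "((f \<circ> H) has_derivative D \<xi>) (at \<xi>)" if "\<xi> \<in> S"
    using diff_chain_at[OF smooth_on_derivative[OF H(1) that] der_f[OF that]]
    by (simp add: D_def o_def)
  have "D \<xi> u = (\<Sum>i\<in>Basis. (frechet_derivative H (at \<xi>) u \<bullet> i) *\<^sub>R frechet_derivative f (at (H \<xi>)) i)"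
    if "\<xi> \<in> S" for \<xi>
  proof -
    have lin: "linear (frechet_derivative f (at (H \<xi>)))" using der_f[OF that] by (rule has_derivative_linear)
    have "D \<xi> u = frechet_derivative f (at (H \<xi>)) (\<Sum>i\<in>Basis. (frechet_derivative H (at \<xi>) u \<bullet> i) *\<^sub>R i)"
      by (simp add: D_def euclidean_representation)
    then show ?thesis by (simp add: linear_sum[OF lin] linear_scale[OF lin])
  qed
  moreover have "continuous_on S (\<lambda>\<xi>. \<Sum>i\<in>Basis. (frechet_derivative H (at \<xi>) u \<bullet> i) *\<^sub>R frechet_derivative f (at (H \<xi>)) i)"
    by (intro continuous_intros smooth_on_continuous_derivative[OF H(1)]
        continuous_on_compose2[OF Ck_on_1_derivative(2)[OF f] smooth_on_continuous[OF H(1)] H(2)])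
  ultimately show "continuous_on S (\<lambda>\<xi>. D \<xi> u)" by (simp cong: continuous_on_cong)
qed

section \<open>The composite problem in local coordinates\<close>

text \<open>\<open>F\<close> and \<open>G\<close> stand for the objective and the constraint map in retraction coordinates. \<open>B\<close> is the
  domain outside of which the perturbed objective is infinite; derivatives are needed on a smaller open
  set \<open>S\<close> only. The inner product \<open>ip\<close> is the Riemannian one of the tangent space.\<close>

locale local_composite =
  fixes ip :: "'e::euclidean_space \<Rightarrow> 'e \<Rightarrow> real" and B S :: "'e set"
    and F :: "'e \<Rightarrow> real" and G :: "'e \<Rightarrow> 'y::euclidean_space"
    and DF :: "'e \<Rightarrow> 'e \<Rightarrow> real" and DG :: "'e \<Rightarrow> 'e \<Rightarrow> 'y"
    and \<theta> :: "'y \<Rightarrow> ereal" and \<rho> :: real and ybar :: 'y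
  assumes ip: "is_inner_product ip" and S: "open S" "0 \<in> S" "S \<subseteq> B"
    and F_deriv: "\<And>\<xi>. \<xi> \<in> S \<Longrightarrow> (F has_derivative DF \<xi>) (at \<xi>)"
    and G_deriv: "\<And>\<xi>. \<xi> \<in> S \<Longrightarrow> (G has_derivative DG \<xi>) (at \<xi>)"
    and F_C1: "\<And>u. continuous_on S (\<lambda>\<xi>. DF \<xi> u)" and G_C1: "\<And>u. continuous_on S (\<lambda>\<xi>. DG \<xi> u)"
    and proper: "proper_fun \<theta>" and lsc: "\<And>z. lsc_at \<theta> z" and conv: "ereal_convex_on UNIV \<theta>"
    and rho: "0 < \<rho>"
    and multiplier: "ybar \<in> subdiff (\<bullet>) \<theta> (G 0)"
    and stationary: "\<And>u. DF 0 u + ybar \<bullet> DG 0 u = 0"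
begin

lemma ipp: "is_inner_product (prod_ip ip :: 'e \<times> 'y \<Rightarrow> _)"
  by (rule is_inner_product_prod_ip[OF ip])

lemma multiplier_inequality: "\<theta> (G 0) + ereal (ybar \<bullet> (c - G 0)) \<le> \<theta> c"
  by (rule convex_subgradient[OF is_inner_product_inner proper conv multiplier])

lemma theta_G0_finite: "\<bar>\<theta> (G 0)\<bar> \<noteq> \<infinity>"
  using multiplier by (simp add: subdiff_def)

sublocale moreau \<theta> \<rho>
proof
  obtain t where t: "\<theta> (G 0) = ereal t" using theta_G0_finite by auto
  have "ereal ((t - ybar \<bullet> G 0) + ybar \<bullet> c) \<le> \<theta> c" for c
    using multiplier_inequality[of c] by (simp add: t inner_diff_right algebra_simps)
  then show "\<exists>a y. \<forall>c. ereal (a + y \<bullet> c) \<le> \<theta> c" by blast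
qed (use proper lsc conv rho in auto)

interpretation ip: bounded_bilinear ip
  by (rule inner_product_bounded_bilinear[OF ip])

definition \<phi> :: "'e \<times> 'y \<Rightarrow> ereal" where
  "\<phi> p = (if fst p \<in> B then ereal (F (fst p)) + \<theta> (G (fst p) + snd p) + ereal (\<rho> / 2 * (norm (snd p))\<^sup>2)
    else \<infinity>)"

text \<open>\<open>\<beta> \<xi> y\<close> is the minimizer of \<open>\<phi> (\<xi>, b) - y \<bullet> b\<close> over \<open>b\<close>, and \<open>l \<xi> y\<close> the minimal value; the closed
  forms come from completing the square in \<open>c = G \<xi> + b\<close>.\<close>

definition \<beta> :: "'e \<Rightarrow> 'y \<Rightarrow> 'y" where
  "\<beta> \<xi> y = prox (G \<xi> + (1 / \<rho>) *\<^sub>R y) - G \<xi>"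

definition l :: "'e \<Rightarrow> 'y \<Rightarrow> real" where
  "l \<xi> y = F \<xi> + envelope (G \<xi> + (1 / \<rho>) *\<^sub>R y) - (norm y)\<^sup>2 / (2 * \<rho>)"

lemma phi_regularized:
  assumes "\<xi> \<in> B"
  shows "\<phi> (\<xi>, b) = regularized (G \<xi> + (1 / \<rho>) *\<^sub>R y) (G \<xi> + b)
    + ereal (F \<xi> + y \<bullet> b - (norm y)\<^sup>2 / (2 * \<rho>))"
proof -
  have "\<rho> / 2 * (norm (G \<xi> + b - (G \<xi> + (1 / \<rho>) *\<^sub>R y)))\<^sup>2
      = \<rho> / 2 * (norm b)\<^sup>2 - y \<bullet> b + (norm y)\<^sup>2 / (2 * \<rho>)"
    using rho unfolding power2_norm_eq_inner
    by (simp add: inner_simps inner_commute field_simps)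
  then have "regularized (G \<xi> + (1 / \<rho>) *\<^sub>R y) (G \<xi> + b)
      = \<theta> (G \<xi> + b) + ereal (\<rho> / 2 * (norm b)\<^sup>2 - y \<bullet> b + (norm y)\<^sup>2 / (2 * \<rho>))"
    by (simp only: regularized_def)
  then show ?thesis
    using assms by (cases "\<theta> (G \<xi> + b)") (auto simp: \<phi>_def)
qed

text \<open>Strong convexity in \<open>b\<close> with modulus \<open>\<rho>\<close>, from the quadratic penalty.\<close>

lemma phi_growth:
  assumes "\<xi> \<in> B"
  shows "ereal (l \<xi> y + y \<bullet> b + \<rho> / 2 * (norm (b - \<beta> \<xi> y))\<^sup>2) \<le> \<phi> (\<xi>, b)"
proof -
  define a where "a = G \<xi> + (1 / \<rho>) *\<^sub>R y"
  have "ereal (envelope a + \<rho> / 2 * (norm (G \<xi> + b - prox a))\<^sup>2) + ereal (F \<xi> + y \<bullet> b - (norm y)\<^sup>2 / (2 * \<rho>))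
      \<le> \<phi> (\<xi>, b)"
    unfolding phi_regularized[OF assms, of b y] a_def by (intro add_right_mono prox_growth)
  moreover have "G \<xi> + b - prox a = b - \<beta> \<xi> y" by (simp add: \<beta>_def a_def algebra_simps)
  ultimately have "ereal (envelope a + \<rho> / 2 * (norm (b - \<beta> \<xi> y))\<^sup>2) + ereal (F \<xi> + y \<bullet> b - (norm y)\<^sup>2 / (2 * \<rho>))
      \<le> \<phi> (\<xi>, b)" by metis
  then show ?thesis by (simp add: l_def a_def[symmetric] algebra_simps)
qed

lemma phi_at_beta:
  assumes "\<xi> \<in> B"
  shows "\<phi> (\<xi>, \<beta> \<xi> y) = ereal (l \<xi> y + y \<bullet> \<beta> \<xi> y)"
  unfolding phi_regularized[OF assms, of _ y]
  by (simp add: \<beta>_def regularized_prox l_def)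

lemma phi_ge_l: "\<xi> \<in> B \<Longrightarrow> ereal (l \<xi> y + y \<bullet> b) \<le> \<phi> (\<xi>, b)"
  using phi_growth[of \<xi> y b] rho
  by (smt (verit) ereal_less_eq(3) half_gt_zero mult_nonneg_nonneg order_trans zero_le_power2)

lemma augmented_lagrangian_eq:
  assumes "\<xi> \<in> B"
  shows "(INF b. \<phi> (\<xi>, b) - ereal (y \<bullet> b)) = ereal (l \<xi> y)"
proof (rule antisym)
  have "(INF b. \<phi> (\<xi>, b) - ereal (y \<bullet> b)) \<le> \<phi> (\<xi>, \<beta> \<xi> y) - ereal (y \<bullet> \<beta> \<xi> y)"
    by (rule INF_lower) simp
  then show "(INF b. \<phi> (\<xi>, b) - ereal (y \<bullet> b)) \<le> ereal (l \<xi> y)"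
    by (simp add: phi_at_beta[OF assms])
  show "ereal (l \<xi> y) \<le> (INF b. \<phi> (\<xi>, b) - ereal (y \<bullet> b))"
    by (rule INF_greatest) (use phi_ge_l[OF assms] in \<open>simp add: ereal_le_minus\<close>)
qed

text \<open>An infimum of affine functions of \<open>y\<close>, attained at \<open>\<beta>\<close>.\<close>

lemma l_concave: "ereal_concave_on Y (\<lambda>y. ereal (l \<xi> y))" if "\<xi> \<in> B" "convex Y"
proof -
  have "u * l \<xi> y + v * l \<xi> y' \<le> l \<xi> (u *\<^sub>R y + v *\<^sub>R y')" if uv: "0 \<le> u" "0 \<le> v" "u + v = 1" for u v y y'
  proof -
    define y'' where "y'' = u *\<^sub>R y + v *\<^sub>R y'"
    define b where "b = \<beta> \<xi> y''"
    have le: "l \<xi> z + z \<bullet> b \<le> l \<xi> y'' + y'' \<bullet> b" for z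
      using phi_ge_l[OF \<open>\<xi> \<in> B\<close>, of z b] phi_at_beta[OF \<open>\<xi> \<in> B\<close>, of y''] by (simp add: b_def)
    have "u * (l \<xi> y + y \<bullet> b) + v * (l \<xi> y' + y' \<bullet> b) \<le> u * (l \<xi> y'' + y'' \<bullet> b) + v * (l \<xi> y'' + y'' \<bullet> b)"
      by (intro add_mono mult_left_mono[OF le uv(1)] mult_left_mono[OF le uv(2)])
    also have "\<dots> = l \<xi> y'' + y'' \<bullet> b" using uv(3) by (metis distrib_right mult_1)
    finally show ?thesis by (simp add: y''_def inner_add_left algebra_simps)
  qed
  then show ?thesis
    using \<open>convex Y\<close> by (simp add: ereal_concave_on_def ereal_convex_on_def algebra_simps)
qed

subsection \<open>The partial gradient of the augmented Lagrangian\<close>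

definition Dl :: "'e \<Rightarrow> 'y \<Rightarrow> 'e \<Rightarrow> real" where
  "Dl \<xi> y u = DF \<xi> u + (y - \<rho> *\<^sub>R \<beta> \<xi> y) \<bullet> DG \<xi> u"

text \<open>\<open>riesz\<close> gives the basis that is dual to the standard one with respect to \<open>ip\<close>. Writing the
  gradient \<open>gr\<close> in it makes continuity of the gradient visible from continuity of the partial derivatives.\<close>

definition riesz :: "'e \<Rightarrow> 'e" where
  "riesz i = (SOME v. \<forall>u. ip v u = u \<bullet> i)"

definition gr :: "'e \<Rightarrow> 'y \<Rightarrow> 'e" where
  "gr \<xi> y = (\<Sum>i\<in>Basis. Dl \<xi> y i *\<^sub>R riesz i)"

lemma riesz: "ip (riesz i) u = u \<bullet> i"
proof -
  have "linear (\<lambda>u. u \<bullet> i)" by (auto intro!: linearI simp: inner_add_left)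
  from someI_ex[OF inner_product_representation[OF ip this]] show ?thesis
    by (simp add: riesz_def)
qed

lemma l_has_derivative:
  assumes "\<xi> \<in> S"
  shows "((\<lambda>\<xi>. l \<xi> y) has_derivative Dl \<xi> y) (at \<xi>)"
proof -
  define a where "a = G \<xi> + (1 / \<rho>) *\<^sub>R y"
  have "((\<lambda>\<xi>. G \<xi> + (1 / \<rho>) *\<^sub>R y) has_derivative DG \<xi>) (at \<xi>)"
    using G_deriv[OF assms] by (auto intro!: derivative_eq_intros)
  then have "((\<lambda>\<xi>. envelope (G \<xi> + (1 / \<rho>) *\<^sub>R y)) has_derivative
      (\<lambda>u. \<rho> * ((a - prox a) \<bullet> DG \<xi> u))) (at \<xi>)"
    unfolding a_def by (rule has_derivative_compose[OF _ envelope_has_derivative])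
  then have "((\<lambda>\<xi>. l \<xi> y) has_derivative (\<lambda>u. DF \<xi> u + \<rho> * ((a - prox a) \<bullet> DG \<xi> u) - 0)) (at \<xi>)"
    unfolding l_def by (intro derivative_intros F_deriv assms)
  moreover have "DF \<xi> u + \<rho> * ((a - prox a) \<bullet> DG \<xi> u) - 0 = Dl \<xi> y u" for u
    using rho by (simp add: Dl_def a_def \<beta>_def inner_simps field_simps)
  ultimately show ?thesis by simp
qed

lemma gr_represents: "ip (gr \<xi> y) u = Dl \<xi> y u" if "\<xi> \<in> S"
proof -
  have lin: "linear (Dl \<xi> y)" using l_has_derivative[OF that] by (rule has_derivative_linear)
  have "ip (gr \<xi> y) u = (\<Sum>i\<in>Basis. Dl \<xi> y i * (u \<bullet> i))"
    by (simp add: gr_def ip.sum_left ip.scaleR_left riesz)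
  also have "\<dots> = Dl \<xi> y (\<Sum>i\<in>Basis. (u \<bullet> i) *\<^sub>R i)"
    by (simp add: linear_sum[OF lin] linear_scale[OF lin] mult.commute)
  finally show ?thesis by (simp add: euclidean_representation)
qed

lemma l_has_gradient:
  "\<xi> \<in> S \<Longrightarrow> ((\<lambda>\<xi>. l \<xi> y) has_derivative ip (gr \<xi> y)) (at \<xi>)"
  using l_has_derivative[of \<xi> y] gr_represents[of \<xi> y] by (metis (no_types) ext)

lemma continuous_on_G: "continuous_on S G"
  using G_deriv by (meson S(1) continuous_on_eq_continuous_at has_derivative_continuous)

lemma continuous_on_F: "continuous_on S F"
  using F_deriv by (meson S(1) continuous_on_eq_continuous_at has_derivative_continuous)

lemma continuous_on_beta: "continuous_on (S \<times> UNIV) (\<lambda>p. \<beta> (fst p) (snd p))"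
  unfolding \<beta>_def
  by (intro continuous_intros continuous_on_compose2[OF continuous_on_prox]
      continuous_on_compose2[OF continuous_on_G]) auto

lemma continuous_on_gr: "continuous_on (S \<times> UNIV) (\<lambda>p. gr (fst p) (snd p))"
  unfolding gr_def Dl_def
  by (intro continuous_intros continuous_on_beta
      continuous_on_compose2[OF F_C1] continuous_on_compose2[OF G_C1]) auto

lemma beta_Lipschitz_y: "norm (\<rho> *\<^sub>R (\<beta> \<xi> y - \<beta> \<xi> y')) \<le> norm (y - y')"
proof -
  have "G \<xi> + (1 / \<rho>) *\<^sub>R y - (G \<xi> + (1 / \<rho>) *\<^sub>R y') = (1 / \<rho>) *\<^sub>R (y - y')"
    by (simp add: scaleR_diff_right)
  then have "norm (\<beta> \<xi> y - \<beta> \<xi> y') \<le> (1 / \<rho>) * norm (y - y')"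
    using prox_nonexpansive[of "G \<xi> + (1 / \<rho>) *\<^sub>R y" "G \<xi> + (1 / \<rho>) *\<^sub>R y'"] rho
    by (simp add: \<beta>_def)
  then have "\<rho> * norm (\<beta> \<xi> y - \<beta> \<xi> y') \<le> \<rho> * ((1 / \<rho>) * norm (y - y'))"
    using rho by (intro mult_left_mono) auto
  then show ?thesis unfolding norm_scaleR using rho by simp
qed

lemma beta_Lipschitz_xi: "norm (\<beta> \<xi> y - \<beta> \<xi>' y) \<le> 2 * norm (G \<xi> - G \<xi>')"
proof -
  have "norm (\<beta> \<xi> y - \<beta> \<xi>' y) \<le> norm (prox (G \<xi> + (1 / \<rho>) *\<^sub>R y) - prox (G \<xi>' + (1 / \<rho>) *\<^sub>R y)) + norm (G \<xi> - G \<xi>')"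
    unfolding \<beta>_def by (metis (no_types, lifting) add_diff_eq diff_add_eq diff_diff_eq2 norm_triangle_ineq4)
  also have "norm (prox (G \<xi> + (1 / \<rho>) *\<^sub>R y) - prox (G \<xi>' + (1 / \<rho>) *\<^sub>R y)) \<le> norm (G \<xi> - G \<xi>')"
    using prox_nonexpansive[of "G \<xi> + (1 / \<rho>) *\<^sub>R y" "G \<xi>' + (1 / \<rho>) *\<^sub>R y"] by simp
  finally show ?thesis by simp
qed

text \<open>Both the inner minimizer and the partial gradient depend on their arguments in a Lipschitz
  way near the reference point: the former in \<open>\<xi>\<close>, the latter in \<open>y\<close>.\<close>

lemma local_Lipschitz_bounds:
  assumes "\<xi>0 \<in> S"
  obtains r K where "r > 0" "K \<ge> 0" "cball \<xi>0 r \<subseteq> S"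
    "\<And>\<xi> \<xi>' y. \<xi> \<in> cball \<xi>0 r \<Longrightarrow> \<xi>' \<in> cball \<xi>0 r \<Longrightarrow> norm (\<beta> \<xi> y - \<beta> \<xi>' y) \<le> K * norm (\<xi> - \<xi>')"
    "\<And>\<xi> y y'. \<xi> \<in> cball \<xi>0 r \<Longrightarrow> norm (gr \<xi> y - gr \<xi> y') \<le> K * norm (y - y')"
proof -
  obtain r K where r: "r > 0" "K \<ge> 0" "cball \<xi>0 r \<subseteq> S"
    and DG: "\<And>\<xi> u. \<xi> \<in> cball \<xi>0 r \<Longrightarrow> norm (DG \<xi> u) \<le> K * norm u"
    and G: "\<And>\<xi> \<xi>'. \<xi> \<in> cball \<xi>0 r \<Longrightarrow> \<xi>' \<in> cball \<xi>0 r \<Longrightarrow> norm (G \<xi> - G \<xi>') \<le> K * norm (\<xi> - \<xi>')"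
    using C1_locally_lipschitz[OF S(1) assms G_deriv G_C1] by metis
  define R where "R = (\<Sum>i\<in>Basis. norm (riesz i))"
  have "R \<ge> 0" by (simp add: R_def sum_nonneg)
  define K' where "K' = max (2 * K) (2 * K * R)"
  show ?thesis
  proof (rule that[OF r(1) _ r(3), of K'])
    show "0 \<le> K'" using r(2) by (simp add: K'_def)
    fix \<xi> assume xi: "\<xi> \<in> cball \<xi>0 r"
    show "norm (\<beta> \<xi> y - \<beta> \<xi>' y) \<le> K' * norm (\<xi> - \<xi>')" if "\<xi>' \<in> cball \<xi>0 r" for \<xi>' y
    proof -
      have "norm (\<beta> \<xi> y - \<beta> \<xi>' y) \<le> 2 * (K * norm (\<xi> - \<xi>'))"
        using beta_Lipschitz_xi[of \<xi> y \<xi>'] G[OF xi that] by linarith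
      also have "\<dots> \<le> K' * norm (\<xi> - \<xi>')"
        unfolding mult.assoc[symmetric] by (intro mult_right_mono) (auto simp: K'_def)
      finally show ?thesis .
    qed
    show "norm (gr \<xi> y - gr \<xi> y') \<le> K' * norm (y - y')" for y y'
    proof -
      define \<delta> where "\<delta> = (y - y') - \<rho> *\<^sub>R (\<beta> \<xi> y - \<beta> \<xi> y')"
      have "norm \<delta> \<le> 2 * norm (y - y')"
        unfolding \<delta>_def using norm_triangle_ineq4[of "y - y'" "\<rho> *\<^sub>R (\<beta> \<xi> y - \<beta> \<xi> y')"] beta_Lipschitz_y[of \<xi> y y']
        by linarith
      have "Dl \<xi> y i - Dl \<xi> y' i = \<delta> \<bullet> DG \<xi> i" for i
        by (simp add: Dl_def \<delta>_def inner_simps scaleR_diff_right)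
      then have "gr \<xi> y - gr \<xi> y' = (\<Sum>i\<in>Basis. (\<delta> \<bullet> DG \<xi> i) *\<^sub>R riesz i)"
        by (simp add: gr_def sum_subtractf[symmetric] scaleR_diff_left[symmetric])
      also have "norm \<dots> \<le> (\<Sum>i\<in>Basis. 2 * K * norm (y - y') * norm (riesz i))"
      proof (rule sum_norm_le)
        fix i :: 'e assume "i \<in> Basis"
        have "\<bar>\<delta> \<bullet> DG \<xi> i\<bar> \<le> norm \<delta> * norm (DG \<xi> i)" by (rule Cauchy_Schwarz_ineq2)
        also have "\<dots> \<le> (2 * norm (y - y')) * K"
          using \<open>norm \<delta> \<le> _\<close> DG[OF xi, of i] \<open>i \<in> Basis\<close> by (intro mult_mono) auto
        finally have "\<bar>\<delta> \<bullet> DG \<xi> i\<bar> \<le> 2 * K * norm (y - y')" by (simp add: mult_ac)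
        then show "norm ((\<delta> \<bullet> DG \<xi> i) *\<^sub>R riesz i) \<le> 2 * K * norm (y - y') * norm (riesz i)"
          by (simp add: mult_right_mono)
      qed
      also have "\<dots> = 2 * K * R * norm (y - y')"
        by (simp add: R_def sum_distrib_left sum_distrib_right mult_ac)
      also have "\<dots> \<le> K' * norm (y - y')"
        by (intro mult_right_mono) (auto simp: K'_def)
      finally show ?thesis .
    qed
  qed
qed

lemma beta_reference: "\<beta> 0 ybar = 0"
  unfolding \<beta>_def by (simp add: prox_subgradient[OF theta_G0_finite multiplier_inequality])

lemma gr_reference: "gr 0 ybar = 0"
  by (simp add: gr_def Dl_def beta_reference stationary)

subsection \<open>Subgradients of the perturbed objective\<close>

lemma phi_lsc:
  assumes "\<xi> \<in> S"
  shows "lsc_at \<phi> (\<xi>, b)"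
  unfolding lsc_at_def le_Liminf_iff
proof (intro allI impI)
  fix a assume a: "a < \<phi> (\<xi>, b)"
  have SN: "open (S \<times> (UNIV :: 'y set))" "(\<xi>, b) \<in> S \<times> UNIV" using S assms by (auto intro: open_Times)
  define H where "H p = F (fst p) + \<rho> / 2 * (norm (snd p))\<^sup>2" for p :: "'e \<times> 'y"
  define k where "k p = G (fst p) + snd p" for p :: "'e \<times> 'y"
  have phi: "\<phi> p = ereal (H p) + \<theta> (k p)" if "p \<in> S \<times> UNIV" for p
    using that S(3) theta_not_MInf[of "k p"] by (cases "\<theta> (k p)") (auto simp: \<phi>_def H_def k_def)
  have "continuous_on (S \<times> UNIV) H" unfolding H_def
    by (intro continuous_intros continuous_on_compose2[OF continuous_on_F]) auto
  then have H: "(H \<longlongrightarrow> H (\<xi>, b)) (nhds (\<xi>, b))"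
    using SN by (simp add: continuous_on_eq_continuous_at continuous_at tendsto_at_iff_tendsto_nhds)
  have "continuous_on (S \<times> UNIV) k" unfolding k_def
    by (intro continuous_intros continuous_on_compose2[OF continuous_on_G]) auto
  then have k: "(k \<longlongrightarrow> k (\<xi>, b)) (nhds (\<xi>, b))"
    using SN by (simp add: continuous_on_eq_continuous_at continuous_at tendsto_at_iff_tendsto_nhds)
  have nb: "\<forall>\<^sub>F p in nhds (\<xi>, b). p \<in> S \<times> UNIV" using SN by (rule eventually_nhds_in_open)
  obtain m where m: "ereal m < \<theta> (k (\<xi>, b))" "a < ereal (H (\<xi>, b) + m)"
  proof -
    have *: "a < ereal (H (\<xi>, b)) + \<theta> (k (\<xi>, b))" using a phi[OF SN(2)] by simp
    have "\<theta> (k (\<xi>, b)) \<noteq> -\<infinity>" by (rule theta_not_MInf)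
    then have "a - ereal (H (\<xi>, b)) < \<theta> (k (\<xi>, b))"
      using * by (cases a; cases "\<theta> (k (\<xi>, b))") auto
    then obtain m where m: "a - ereal (H (\<xi>, b)) < ereal m" "ereal m < \<theta> (k (\<xi>, b))"
      using ereal_dense2 by blast
    then have "a < ereal (H (\<xi>, b) + m)" by (cases a) auto
    then show ?thesis using that m by blast
  qed
  have "((\<lambda>p. ereal (H p + m)) \<longlongrightarrow> ereal (H (\<xi>, b) + m)) (nhds (\<xi>, b))" by (intro tendsto_intros H)
  then have "\<forall>\<^sub>F p in nhds (\<xi>, b). a < ereal (H p + m)" using m(2) by (rule order_tendstoD)
  moreover have "\<forall>\<^sub>F p in nhds (\<xi>, b). ereal m < \<theta> (k p)"
    by (rule eventually_compose_filterlim[OF lsc_at_eventually[OF theta_lsc m(1)] k])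
  ultimately show "\<forall>\<^sub>F p in nhds (\<xi>, b). a < \<phi> p" using nb
  proof eventually_elim
    case (elim p)
    then have "ereal (H p) + ereal m \<le> \<phi> p"
      unfolding phi[OF elim(3)] by (intro add_left_mono) auto
    then show ?case using elim(1) by (simp add: less_le_trans)
  qed
qed

text \<open>The function \<open>(\<xi>, b) \<mapsto> l \<xi> y + y \<bullet> b\<close> is a differentiable minorant of \<open>\<phi>\<close> that touches it at
  \<open>(\<xi>, \<beta> \<xi> y)\<close>, so its gradient is a regular subgradient there.\<close>

lemma gr_beta_in_gph:
  assumes "\<xi> \<in> S"
  shows "((\<xi>, \<beta> \<xi> y), (gr \<xi> y, y)) \<in> gph_subdiff (prod_ip ip) \<phi>"
proof -
  have xiB: "\<xi> \<in> B" using assms S by auto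
  obtain C where C: "C > 0" "\<And>u :: 'e \<times> 'y. norm u \<le> C * ip_norm (prod_ip ip) u"
    using inner_product_norm_equivalence[OF ipp] by metis
  have "\<forall>\<^sub>F w in nhds (\<xi>, \<beta> \<xi> y). \<phi> (\<xi>, \<beta> \<xi> y) + ereal (prod_ip ip (gr \<xi> y, y) (w - (\<xi>, \<beta> \<xi> y))
      - e * ip_norm (prod_ip ip) (w - (\<xi>, \<beta> \<xi> y))) \<le> \<phi> w" if e: "e > 0" for e
  proof -
    have "\<exists>d>0. \<forall>x\<in>UNIV. norm (x - \<xi>) < d \<longrightarrow> norm (l x y - l \<xi> y - ip (gr \<xi> y) (x - \<xi>)) \<le> (e / C) * norm (x - \<xi>)"
      using l_has_gradient[OF assms, of y, unfolded has_derivative_within_alt, THEN conjunct2,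
          rule_format, of "e / C"] e C(1) by simp
    then obtain d where d: "d > 0" "\<And>x. norm (x - \<xi>) < d \<Longrightarrow>
        \<bar>l x y - l \<xi> y - ip (gr \<xi> y) (x - \<xi>)\<bar> \<le> (e / C) * norm (x - \<xi>)" by auto
    have "\<forall>\<^sub>F w in nhds (\<xi>, \<beta> \<xi> y). w \<in> ball \<xi> d \<times> UNIV"
      by (rule eventually_nhds_in_open) (auto intro: open_Times simp: d)
    then show ?thesis
    proof eventually_elim
      case (elim w)
      obtain x b where w: "w = (x, b)" by fastforce
      show ?case
      proof (cases "x \<in> B")
        case True
        have "norm (x - \<xi>) < d" using elim by (simp add: w dist_norm norm_minus_commute)
        have "norm (x - \<xi>) \<le> norm (w - (\<xi>, \<beta> \<xi> y))"
          using norm_fst_le[of "x - \<xi>" "b - \<beta> \<xi> y"] by (simp add: w)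
        also have "\<dots> \<le> C * ip_norm (prod_ip ip) (w - (\<xi>, \<beta> \<xi> y))" by (rule C)
        finally have "(e / C) * norm (x - \<xi>) \<le> (e / C) * (C * ip_norm (prod_ip ip) (w - (\<xi>, \<beta> \<xi> y)))"
          using e C(1) by (intro mult_left_mono) auto
        then have "l \<xi> y + y \<bullet> \<beta> \<xi> y + (ip (gr \<xi> y) (x - \<xi>) + y \<bullet> (b - \<beta> \<xi> y)
            - e * ip_norm (prod_ip ip) (w - (\<xi>, \<beta> \<xi> y))) \<le> l x y + y \<bullet> b"
          using d(2)[OF \<open>norm (x - \<xi>) < d\<close>] C(1) by (simp add: inner_diff_right)
        then have "\<phi> (\<xi>, \<beta> \<xi> y) + ereal (prod_ip ip (gr \<xi> y, y) (w - (\<xi>, \<beta> \<xi> y))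
            - e * ip_norm (prod_ip ip) (w - (\<xi>, \<beta> \<xi> y))) \<le> ereal (l x y + y \<bullet> b)"
          by (simp add: phi_at_beta[OF xiB] prod_ip_def w)
        also have "\<dots> \<le> \<phi> w" unfolding w by (rule phi_ge_l[OF True])
        finally show ?thesis .
      qed (simp add: \<phi>_def w)
    qed
  qed
  then have "(gr \<xi> y, y) \<in> regular_subdiff (prod_ip ip) \<phi> (\<xi>, \<beta> \<xi> y)"
    by (simp add: regular_subdiff_def phi_at_beta[OF xiB])
  then show ?thesis
    using regular_subdiff_subset_subdiff by (auto simp: gph_subdiff_def)
qed

text \<open>For fixed \<open>\<xi>\<close> the function \<open>b \<mapsto> \<phi> (\<xi>, b)\<close> is strongly convex with \<open>y\<close> as a regular subgradient at
  \<open>b\<close>. So \<open>b\<close> minimizes \<open>\<phi> (\<xi>, b) - y \<bullet> b\<close>, like \<open>\<beta> \<xi> y\<close>.\<close>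

lemma regular_subgradient_beta:
  assumes "\<xi> \<in> S" and vy: "(v, y) \<in> regular_subdiff (prod_ip ip) \<phi> (\<xi>, b)"
  shows "b = \<beta> \<xi> y"
proof -
  have xiB: "\<xi> \<in> B" using assms S by auto
  define a where "a = G \<xi> + (1 / \<rho>) *\<^sub>R y"
  define k where "k = F \<xi> - (norm y)\<^sup>2 / (2 * \<rho>)"
  have phi: "\<phi> (\<xi>, b') = regularized a (G \<xi> + b') + ereal (k + y \<bullet> b')" for b'
    unfolding phi_regularized[OF xiB, of b' y] by (simp add: a_def k_def algebra_simps)
  obtain p where p: "\<phi> (\<xi>, b) = ereal p" using vy by (auto simp: regular_subdiff_def)
  then obtain q where q: "regularized a (G \<xi> + b) = ereal q"
    unfolding phi by (cases "regularized a (G \<xi> + b)") auto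
  obtain q' where q': "regularized a (G \<xi> + \<beta> \<xi> y) = ereal q'"
    by (simp add: \<beta>_def a_def regularized_prox)
  have lim: "((\<lambda>b'. (\<xi>, b')) \<longlongrightarrow> (\<xi>, b)) (nhds b)"
    by (intro tendsto_intros filterlim_ident)
  have norm: "ip_norm (prod_ip ip) ((\<xi>, b') - (\<xi>, b)) = norm (b' - b)" for b'
    by (simp add: ip_norm_def prod_ip_def ip.zero_right norm_eq_sqrt_inner)
  have "y \<in> regular_subdiff (\<bullet>) (\<lambda>b'. \<phi> (\<xi>, b')) b"
    unfolding regular_subdiff_def
  proof (intro CollectI conjI allI impI)
    show "\<bar>\<phi> (\<xi>, b)\<bar> \<noteq> \<infinity>" by (simp add: p)
    fix e :: real assume "0 < e"
    then have "\<forall>\<^sub>F w in nhds (\<xi>, b). \<phi> (\<xi>, b) + ereal (prod_ip ip (v, y) (w - (\<xi>, b))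
        - e * ip_norm (prod_ip ip) (w - (\<xi>, b))) \<le> \<phi> w"
      using vy by (simp add: regular_subdiff_def)
    from eventually_compose_filterlim[OF this lim]
    show "\<forall>\<^sub>F w in nhds b. \<phi> (\<xi>, b) + ereal (y \<bullet> (w - b) - e * ip_norm (\<bullet>) (w - b)) \<le> \<phi> (\<xi>, w)"
      unfolding norm by (simp add: prod_ip_def ip.zero_right ip_norm_inner)
  qed
  then have "\<phi> (\<xi>, b) + ereal (y \<bullet> (\<beta> \<xi> y - b) + \<rho> / 2 * (ip_norm (\<bullet>) (\<beta> \<xi> y - b))\<^sup>2) \<le> \<phi> (\<xi>, \<beta> \<xi> y)"
  proof (rule regular_subgradient_growth[OF is_inner_product_inner])
    show "\<phi> (\<xi>, \<beta> \<xi> y) \<noteq> -\<infinity>" by (simp add: phi_at_beta[OF xiB])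
    fix t :: real assume t: "0 < t" "t < 1"
    define z where "z = (1 - t) *\<^sub>R b + t *\<^sub>R \<beta> \<xi> y"
    have z: "(1 - t) *\<^sub>R (G \<xi> + b) + t *\<^sub>R (G \<xi> + \<beta> \<xi> y) = G \<xi> + z" by (simp add: z_def algebra_simps)
    have "regularized a (G \<xi> + z) + ereal (\<rho> / 2 * (1 - t) * t * (norm (b - \<beta> \<xi> y))\<^sup>2) \<le> ereal ((1 - t) * q + t * q')"
      using regularized_strongly_convex[of t a "G \<xi> + b" "G \<xi> + \<beta> \<xi> y"] t unfolding z by (simp add: q q')
    then have "\<phi> (\<xi>, z) + ereal (\<rho> / 2 * (1 - t) * t * (norm (b - \<beta> \<xi> y))\<^sup>2)
        \<le> ereal ((1 - t) * q + t * q' + (k + y \<bullet> z))"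
      unfolding phi by (cases "regularized a (G \<xi> + z)") auto
    also have "\<dots> = ereal (1 - t) * \<phi> (\<xi>, b) + ereal t * \<phi> (\<xi>, \<beta> \<xi> y)"
      unfolding phi q q' by (simp add: z_def inner_simps algebra_simps)
    finally show "\<phi> (\<xi>, z) + ereal (\<rho> / 2 * (1 - t) * t * (ip_norm (\<bullet>) (b - \<beta> \<xi> y))\<^sup>2)
        \<le> ereal (1 - t) * \<phi> (\<xi>, b) + ereal t * \<phi> (\<xi>, \<beta> \<xi> y)" by (simp add: ip_norm_inner)
  qed
  then have "p + y \<bullet> (\<beta> \<xi> y - b) + \<rho> / 2 * (norm (\<beta> \<xi> y - b))\<^sup>2 \<le> l \<xi> y + y \<bullet> \<beta> \<xi> y"
    by (simp add: p phi_at_beta[OF xiB] ip_norm_inner)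
  moreover have "l \<xi> y + y \<bullet> b + \<rho> / 2 * (norm (b - \<beta> \<xi> y))\<^sup>2 \<le> p"
    using phi_growth[OF xiB, of y b] by (simp add: p)
  ultimately have "\<rho> * (norm (b - \<beta> \<xi> y))\<^sup>2 \<le> 0" by (simp add: inner_diff_right norm_minus_commute)
  then have "(norm (b - \<beta> \<xi> y))\<^sup>2 \<le> 0" using rho by (simp add: mult_le_0_iff)
  then show ?thesis by simp
qed

text \<open>Testing a regular subgradient along the curve \<open>\<xi>' \<mapsto> (\<xi>', \<beta> \<xi>' y)\<close>, on which \<open>\<phi> - y \<bullet> b\<close> equals
  \<open>l\<close>, makes \<open>v\<close> a regular subgradient of the differentiable function \<open>l\<close>. Lipschitz continuity of
  \<open>\<beta>\<close> keeps the error term proportional to the step.\<close>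

lemma regular_subgradient_gr:
  assumes xi: "\<xi> \<in> S" and vy: "(v, y) \<in> regular_subdiff (prod_ip ip) \<phi> (\<xi>, b)"
  shows "v = gr \<xi> y"
proof -
  have xiB: "\<xi> \<in> B" using xi S by auto
  have b: "b = \<beta> \<xi> y" by (rule regular_subgradient_beta[OF xi vy])
  obtain C where C: "C > 0" "\<And>u :: 'e \<times> 'y. ip_norm (prod_ip ip) u \<le> C * norm u"
    using inner_product_norm_equivalence[OF ipp] by metis
  obtain r K where r: "r > 0" "K \<ge> 0" "cball \<xi> r \<subseteq> S"
    and K: "\<And>\<xi>' \<xi>'' y. \<xi>' \<in> cball \<xi> r \<Longrightarrow> \<xi>'' \<in> cball \<xi> r \<Longrightarrow> norm (\<beta> \<xi>' y - \<beta> \<xi>'' y) \<le> K * norm (\<xi>' - \<xi>'')"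
    using local_Lipschitz_bounds[OF xi] by metis
  have le: "ip v u \<le> Dl \<xi> y u" for u
  proof -
    define x where "x t = \<xi> + t *\<^sub>R u" for t :: real
    have x: "(x \<longlongrightarrow> \<xi>) (at_right 0)" unfolding x_def by (auto intro!: tendsto_eq_intros)
    have xS: "\<forall>\<^sub>F t in at_right 0. x t \<in> cball \<xi> r"
    proof -
      have "\<forall>\<^sub>F t in at_right 0. x t \<in> ball \<xi> r"
        by (rule topological_tendstoD[OF x]) (use r in auto)
      then show ?thesis by eventually_elim auto
    qed
    have "((\<lambda>t. \<beta> (x t) y) \<longlongrightarrow> \<beta> \<xi> y) (at_right 0)"
    proof (rule Lim_null_comparison[THEN LIM_zero_cancel])
      show "\<forall>\<^sub>F t in at_right 0. norm (\<beta> (x t) y - \<beta> \<xi> y) \<le> K * norm (x t - \<xi>)"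
        using xS by eventually_elim (rule K, use r in auto)
      show "((\<lambda>t. K * norm (x t - \<xi>)) \<longlongrightarrow> 0) (at_right 0)"
        using x by (auto intro!: tendsto_eq_intros)
    qed
    then have lim: "((\<lambda>t. (x t, \<beta> (x t) y)) \<longlongrightarrow> (\<xi>, b)) (at_right 0)"
      unfolding b by (intro tendsto_intros x)
    define M where "M = C * (norm u + K * norm u)"
    have "ip v u - e * M \<le> Dl \<xi> y u" if "e > 0" for e
    proof -
      have ev: "\<forall>\<^sub>F w in nhds (\<xi>, b). \<phi> (\<xi>, b) + ereal (prod_ip ip (v, y) (w - (\<xi>, b)) - e * ip_norm (prod_ip ip) (w - (\<xi>, b))) \<le> \<phi> w"
        using vy that by (simp add: regular_subdiff_def)
      have "\<forall>\<^sub>F t in at_right 0. ip v u - e * M \<le> (l (\<xi> + t *\<^sub>R u) y - l \<xi> y) / t"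
        using eventually_compose_filterlim[OF ev lim] xS eventually_at_right_unit
      proof eventually_elim
        case (elim t)
        then have t: "0 < t" by auto
        have xB: "x t \<in> B" using elim(2) r(3) S(3) by blast
        have nx: "norm (x t - \<xi>) = t * norm u" using t by (simp add: x_def)
        have "norm (\<beta> (x t) y - b) \<le> K * (t * norm u)"
          using K[OF elim(2), of \<xi> y] r(1) unfolding b nx by simp
        then have "norm ((x t, \<beta> (x t) y) - (\<xi>, b)) \<le> t * norm u + K * (t * norm u)"
          using norm_Pair_le[of "x t - \<xi>" "\<beta> (x t) y - b"] by (simp add: nx)
        then have "ip_norm (prod_ip ip) ((x t, \<beta> (x t) y) - (\<xi>, b)) \<le> C * (t * norm u + K * (t * norm u))"
          using C by (meson less_imp_le mult_left_mono order_trans)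
        also have "\<dots> = t * M" by (simp add: M_def algebra_simps)
        finally have n: "e * ip_norm (prod_ip ip) ((x t, \<beta> (x t) y) - (\<xi>, b)) \<le> e * (t * M)"
          using that by (intro mult_left_mono) auto
        have "l \<xi> y + y \<bullet> b + (ip v (x t - \<xi>) + y \<bullet> (\<beta> (x t) y - b)
            - e * ip_norm (prod_ip ip) ((x t, \<beta> (x t) y) - (\<xi>, b))) \<le> l (x t) y + y \<bullet> \<beta> (x t) y"
          using elim(1) unfolding b by (simp add: phi_at_beta[OF xiB] phi_at_beta[OF xB] prod_ip_def)
        moreover have "ip v (x t - \<xi>) = t * ip v u" by (simp add: x_def ip.scaleR_right)
        ultimately have "t * ip v u - e * (t * M) \<le> l (x t) y - l \<xi> y"
          using n by (simp add: inner_diff_right)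
        then show ?case using t by (simp add: field_simps x_def)
      qed
      then show ?thesis
        using tendsto_lowerbound[OF directional_derivative_limit[OF l_has_derivative[OF xi]]]
          trivial_limit_at_right_real by blast
    qed
    then have ev: "\<forall>\<^sub>F e in at_right 0. ip v u - e * M \<le> Dl \<xi> y u"
      using eventually_at_right_unit by (auto elim!: eventually_mono)
    have "((\<lambda>e. ip v u - e * M) \<longlongrightarrow> ip v u) (at_right 0)" by (auto intro!: tendsto_eq_intros)
    from tendsto_upperbound[OF this ev] show ?thesis by simp
  qed
  have lin: "linear (Dl \<xi> y)" using l_has_derivative[OF xi] by (rule has_derivative_linear)
  have "ip v u = ip (gr \<xi> y) u" for u
    using le[of u] le[of "- u"] by (simp add: ip.minus_right linear_neg[OF lin] gr_represents[OF xi])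
  then show ?thesis by (rule inner_product_ext[OF ip])
qed

text \<open>The two identities for regular subgradients pass to limits because \<open>\<beta>\<close> and \<open>gr\<close> are continuous.\<close>

lemma gph_cases:
  assumes xi: "\<xi> \<in> S" and vy: "((\<xi>, b), (v, y)) \<in> gph_subdiff (prod_ip ip) \<phi>"
  shows "b = \<beta> \<xi> y" "v = gr \<xi> y"
proof -
  obtain xs vs where xs: "xs \<longlonglongrightarrow> (\<xi>, b)" and vs: "vs \<longlonglongrightarrow> (v, y)"
    and reg: "\<And>k. vs k \<in> regular_subdiff (prod_ip ip) \<phi> (xs k)"
    using vy by (auto simp: gph_subdiff_def subdiff_def)
  have xs1: "(\<lambda>k. fst (xs k)) \<longlonglongrightarrow> \<xi>" "(\<lambda>k. snd (xs k)) \<longlonglongrightarrow> b"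
    using tendsto_fst[OF xs] tendsto_snd[OF xs] by auto
  have vs1: "(\<lambda>k. fst (vs k)) \<longlonglongrightarrow> v" "(\<lambda>k. snd (vs k)) \<longlonglongrightarrow> y"
    using tendsto_fst[OF vs] tendsto_snd[OF vs] by auto
  have inS: "\<forall>\<^sub>F k in sequentially. fst (xs k) \<in> S"
    by (rule topological_tendstoD[OF xs1(1) S(1) xi])
  have SU: "open (S \<times> (UNIV :: 'y set))" "(\<xi>, y) \<in> S \<times> UNIV" using S xi by (auto intro: open_Times)
  have pair: "(\<lambda>k. (fst (xs k), snd (vs k))) \<longlonglongrightarrow> (\<xi>, y)" by (intro tendsto_intros xs1 vs1)
  have lim: "(\<lambda>k. H (fst (xs k), snd (vs k))) \<longlonglongrightarrow> H (\<xi>, y)"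
    if "continuous_on (S \<times> UNIV) H" for H :: "_ \<Rightarrow> 'z::topological_space"
    by (rule isCont_tendsto_compose[OF _ pair])
      (use that SU in \<open>auto simp: continuous_on_eq_continuous_at\<close>)
  have "\<forall>\<^sub>F k in sequentially. \<beta> (fst (xs k)) (snd (vs k)) = snd (xs k)"
    using inS
  proof eventually_elim
    case (elim k)
    show ?case
      using regular_subgradient_beta[OF elim, of "fst (vs k)" "snd (vs k)" "snd (xs k)"] reg[of k] by simp
  qed
  from Lim_transform_eventually[OF lim[OF continuous_on_beta, unfolded fst_conv snd_conv] this]
  have "(\<lambda>k. snd (xs k)) \<longlonglongrightarrow> \<beta> \<xi> y" by simp
  then show "b = \<beta> \<xi> y" using xs1(2) LIMSEQ_unique by blast
  have "\<forall>\<^sub>F k in sequentially. gr (fst (xs k)) (snd (vs k)) = fst (vs k)"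
    using inS
  proof eventually_elim
    case (elim k)
    show ?case
      using regular_subgradient_gr[OF elim, of "fst (vs k)" "snd (vs k)" "snd (xs k)"] reg[of k] by simp
  qed
  from Lim_transform_eventually[OF lim[OF continuous_on_gr, unfolded fst_conv snd_conv] this]
  have "(\<lambda>k. fst (vs k)) \<longlonglongrightarrow> gr \<xi> y" by simp
  then show "v = gr \<xi> y" using vs1(1) LIMSEQ_unique by blast
qed


section \<open>Uniform quadratic growth gives tilt stability\<close>

definition tilted_argmin :: "'e set \<Rightarrow> 'e \<Rightarrow> 'y \<Rightarrow> 'e set" where
  "tilted_argmin W v y = {\<xi> \<in> W. \<forall>\<xi>'\<in>W. l \<xi> y - ip v \<xi> \<le> l \<xi>' y - ip v \<xi>'}"

text \<open>One-sided directional derivatives into the convex set.\<close>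

lemma first_order_optimality:
  assumes W: "convex W" "\<xi> \<in> W" "\<xi> \<in> S" and \<xi>': "\<xi>' \<in> W"
    and min: "\<And>z. z \<in> W \<Longrightarrow> l \<xi> y - ip v \<xi> \<le> l z y - ip v z"
  shows "0 \<le> ip (gr \<xi> y - v) (\<xi>' - \<xi>)"
proof -
  define u where "u = \<xi>' - \<xi>"
  have "\<forall>\<^sub>F t in at_right 0. ip v u \<le> (l (\<xi> + t *\<^sub>R u) y - l \<xi> y) / t"
    using eventually_at_right_unit
  proof eventually_elim
    case (elim t)
    have "\<xi> + t *\<^sub>R u = (1 - t) *\<^sub>R \<xi> + t *\<^sub>R \<xi>'" by (simp add: u_def algebra_simps)
    then have "\<xi> + t *\<^sub>R u \<in> W" using W(1,2) \<xi>' elim by (simp add: convexD)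
    from min[OF this] have "t * ip v u \<le> l (\<xi> + t *\<^sub>R u) y - l \<xi> y"
      by (simp add: ip.add_right ip.scaleR_right)
    then show ?case using elim by (simp add: field_simps)
  qed
  then have "ip v u \<le> ip (gr \<xi> y) u"
    using tendsto_lowerbound[OF directional_derivative_limit[OF l_has_gradient[OF W(3)]]]
      trivial_limit_at_right_real by blast
  then show ?thesis by (simp add: u_def ip.diff_left)
qed

lemma convex_gradient_inequality:
  assumes conv: "ereal_convex_on W (\<lambda>\<xi>. ereal (l \<xi> y))" and \<xi>: "\<xi> \<in> W" "\<xi> \<in> S" and \<xi>': "\<xi>' \<in> W"
  shows "l \<xi> y + ip (gr \<xi> y) (\<xi>' - \<xi>) \<le> l \<xi>' y"
proof -
  define u where "u = \<xi>' - \<xi>"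
  have "\<forall>\<^sub>F t in at_right 0. (l (\<xi> + t *\<^sub>R u) y - l \<xi> y) / t \<le> l \<xi>' y - l \<xi> y"
    using eventually_at_right_unit
  proof eventually_elim
    case (elim t)
    have eq: "\<xi> + t *\<^sub>R u = (1 - t) *\<^sub>R \<xi> + t *\<^sub>R \<xi>'" by (simp add: u_def algebra_simps)
    have "\<forall>u\<ge>0. \<forall>v\<ge>0. u + v = 1 \<longrightarrow> ereal (l (u *\<^sub>R \<xi> + v *\<^sub>R \<xi>') y) \<le> ereal u * ereal (l \<xi> y) + ereal v * ereal (l \<xi>' y)"
      using conv \<xi>(1) \<xi>' unfolding ereal_convex_on_def by blast
    from this[rule_format, of "1 - t" t]
    have "l (\<xi> + t *\<^sub>R u) y \<le> (1 - t) * l \<xi> y + t * l \<xi>' y"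
      unfolding eq using elim by simp
    then show ?case using elim by (simp add: field_simps)
  qed
  then have "ip (gr \<xi> y) u \<le> l \<xi>' y - l \<xi> y"
    using tendsto_upperbound[OF directional_derivative_limit[OF l_has_gradient[OF \<xi>(2)]]]
      trivial_limit_at_right_real by blast
  then show ?thesis by (simp add: u_def)
qed

text \<open>Every pair \<open>(\<xi>, y)\<close> near the reference point lifts to a subgradient pair of \<open>\<phi>\<close>, so growth
  of \<open>\<phi>\<close> along lifted points is growth of \<open>l\<close>.\<close>

lemma augmented_lagrangian_growth:
  assumes vsc: "variationally_strongly_convex (prod_ip ip) \<phi> (0, 0) (0, ybar)" and "r0 > 0"
  obtains r \<delta> s where "0 < r" "r \<le> r0" "0 < \<delta>" "0 < s" "cball 0 r \<subseteq> S"
    "\<And>\<xi> \<xi>' y. \<xi> \<in> cball 0 r \<Longrightarrow> \<xi>' \<in> cball 0 r \<Longrightarrow> y \<in> cball ybar \<delta> \<Longrightarrow>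
      l \<xi> y + ip (gr \<xi> y) (\<xi>' - \<xi>) + s / 2 * ip (\<xi>' - \<xi>) (\<xi>' - \<xi>) \<le> l \<xi>' y"
proof -
  obtain N Z s where N: "open N" "(0, 0) \<in> N" and Z: "open Z" "(0, ybar) \<in> Z" and "s > 0"
    and growth: "\<And>x v u. (x, v) \<in> gph_subdiff (prod_ip ip) \<phi> \<Longrightarrow> x \<in> N \<Longrightarrow> v \<in> Z \<Longrightarrow> u \<in> N \<Longrightarrow>
      \<phi> x + ereal (prod_ip ip v (u - x) + s / 2 * (ip_norm (prod_ip ip) (u - x))\<^sup>2) \<le> \<phi> u"
    using variationally_strongly_convex_growth[OF ipp vsc] by metis
  define lift where "lift p = ((fst p, \<beta> (fst p) (snd p)), (gr (fst p) (snd p), snd p))" for p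
  have SU: "open (S \<times> (UNIV :: 'y set))" by (intro open_Times S open_UNIV)
  have "continuous_on (S \<times> UNIV) lift"
    unfolding lift_def by (intro continuous_intros continuous_on_beta continuous_on_gr)
  then have "open ((S \<times> UNIV) \<inter> lift -` (N \<times> Z))"
    by (rule continuous_open_preimage[OF _ SU open_Times[OF N(1) Z(1)]])
  moreover have "(0, ybar) \<in> (S \<times> UNIV) \<inter> lift -` (N \<times> Z)"
    using S N Z by (simp add: lift_def beta_reference gr_reference)
  ultimately obtain A D where A: "open A" "0 \<in> A" and D: "open D" "ybar \<in> D"
    and AD: "A \<times> D \<subseteq> (S \<times> UNIV) \<inter> lift -` (N \<times> Z)"
    by (auto elim!: open_prod_elim)
  obtain r1 where r1: "0 < r1" "cball 0 r1 \<subseteq> A" using A open_contains_cball by blast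
  obtain \<delta> where \<delta>: "0 < \<delta>" "cball ybar \<delta> \<subseteq> D" using D open_contains_cball by blast
  define r where "r = min r0 r1"
  have r: "0 < r" "r \<le> r0" "cball 0 r \<subseteq> A" using r1 \<open>r0 > 0\<close> by (auto simp: r_def)
  have "cball 0 r \<subseteq> S" using r(3) AD D(2) by blast
  show ?thesis
  proof (rule that[OF r(1,2) \<delta>(1) \<open>s > 0\<close> \<open>cball 0 r \<subseteq> S\<close>])
    fix \<xi> \<xi>' :: 'e and y assume xi: "\<xi> \<in> cball 0 r" "\<xi>' \<in> cball 0 r" and y: "y \<in> cball ybar \<delta>"
    have inB: "\<xi> \<in> B" "\<xi>' \<in> B" and inS: "\<xi> \<in> S" using xi \<open>cball 0 r \<subseteq> S\<close> S by blast+
    have "(\<xi>, y) \<in> A \<times> D" "(\<xi>', y) \<in> A \<times> D" using r(3) \<delta>(2) xi y by blast+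
    then have "(\<xi>, y) \<in> lift -` (N \<times> Z)" "(\<xi>', y) \<in> lift -` (N \<times> Z)" using AD by blast+
    then have "(\<xi>, \<beta> \<xi> y) \<in> N" "(gr \<xi> y, y) \<in> Z" "(\<xi>', \<beta> \<xi>' y) \<in> N" by (auto simp: lift_def)
    from growth[OF gr_beta_in_gph[OF inS] this]
    have "l \<xi> y + y \<bullet> \<beta> \<xi> y + (ip (gr \<xi> y) (\<xi>' - \<xi>) + y \<bullet> (\<beta> \<xi>' y - \<beta> \<xi> y)
        + s / 2 * (ip (\<xi>' - \<xi>) (\<xi>' - \<xi>) + (\<beta> \<xi>' y - \<beta> \<xi> y) \<bullet> (\<beta> \<xi>' y - \<beta> \<xi> y))) \<le> l \<xi>' y + y \<bullet> \<beta> \<xi>' y"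
      by (simp add: phi_at_beta inB ip_norm_sq[OF ipp]) (simp add: prod_ip_def)
    moreover have "0 \<le> s / 2 * ((\<beta> \<xi>' y - \<beta> \<xi> y) \<bullet> (\<beta> \<xi>' y - \<beta> \<xi> y))" using \<open>s > 0\<close> by simp
    ultimately show "l \<xi> y + ip (gr \<xi> y) (\<xi>' - \<xi>) + s / 2 * ip (\<xi>' - \<xi>) (\<xi>' - \<xi>) \<le> l \<xi>' y"
      by (simp add: inner_diff_right algebra_simps)
  qed
qed

text \<open>Growth makes \<open>l\<close> convex in \<open>\<xi>\<close>, as it has an affine support at every point, and its gradient strongly
  monotone. Two tilted minimizers are compared through their first-order conditions. The bound \<open>r0\<close> leaves
  room to shrink the ball to where other coordinate estimates hold.\<close>

lemma tilt_stability_if_variationally_strongly_convex: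
  assumes vsc: "variationally_strongly_convex (prod_ip ip) \<phi> (0, 0) (0, ybar)" and "r0 > 0"
  shows "\<exists>r \<delta> m L. 0 < r \<and> r \<le> r0 \<and> 0 < \<delta> \<and> 0 \<le> L \<and> cball 0 r \<subseteq> S \<and>
    (\<forall>y\<in>cball ybar \<delta>. ereal_convex_on (cball 0 r) (\<lambda>\<xi>. ereal (l \<xi> y))) \<and>
    (\<forall>v. \<forall>y\<in>cball ybar \<delta>. tilted_argmin (cball 0 r) v y = {m v y}) \<and>
    (\<forall>v v'. \<forall>y\<in>cball ybar \<delta>. \<forall>y'\<in>cball ybar \<delta>.
      norm (m v y - m v' y') \<le> L * norm ((v, y) - (v', y')))"
proof -
  obtain rK K where rK: "rK > 0" "K \<ge> 0" "cball 0 rK \<subseteq> S"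
    and K: "\<And>\<xi> y y'. \<xi> \<in> cball 0 rK \<Longrightarrow> norm (gr \<xi> y - gr \<xi> y') \<le> K * norm (y - y')"
    using local_Lipschitz_bounds[OF S(2)] by metis
  have "min r0 rK > 0" using rK \<open>r0 > 0\<close> by simp
  from augmented_lagrangian_growth[OF vsc this]
  obtain r \<delta> s where r: "0 < r" "r \<le> r0" "r \<le> rK" and pos: "0 < \<delta>" "0 < s" and rS: "cball 0 r \<subseteq> S"
    and growth: "\<And>\<xi> \<xi>' y. \<xi> \<in> cball 0 r \<Longrightarrow> \<xi>' \<in> cball 0 r \<Longrightarrow> y \<in> cball ybar \<delta> \<Longrightarrow>
      l \<xi> y + ip (gr \<xi> y) (\<xi>' - \<xi>) + s / 2 * ip (\<xi>' - \<xi>) (\<xi>' - \<xi>) \<le> l \<xi>' y"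
    by (metis min.bounded_iff)
  obtain C where C: "C > 0" "\<And>u. norm u \<le> C * ip_norm ip u" "\<And>u v. \<bar>ip u v\<bar> \<le> C * norm u * norm v"
    using inner_product_norm_equivalence[OF ip] by metis
  define W where "W = cball (0::'e) r"
  have W: "convex W" "compact W" "W \<noteq> {}" using r by (auto simp: W_def)
  have lin: "l \<xi> y + ip (gr \<xi> y) (\<xi>' - \<xi>) \<le> l \<xi>' y"
    if "\<xi> \<in> W" "\<xi>' \<in> W" "y \<in> cball ybar \<delta>" for \<xi> \<xi>' y
    using growth[of \<xi> \<xi>' y] that inner_product_nonneg[OF ip, of "\<xi>' - \<xi>"] pos
    by (smt (verit) W_def half_gt_zero mult_nonneg_nonneg)
  have convex: "ereal_convex_on W (\<lambda>\<xi>. ereal (l \<xi> y))" if y: "y \<in> cball ybar \<delta>" for y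
    unfolding ereal_convex_on_def
  proof (intro conjI ballI allI impI W(1))
    fix x x' and u v :: real assume x: "x \<in> W" "x' \<in> W" and uv: "0 \<le> u" "0 \<le> v" "u + v = 1"
    define z where "z = u *\<^sub>R x + v *\<^sub>R x'"
    have z: "z \<in> W" using W(1) x uv by (simp add: z_def convexD)
    have "u * (l z y + ip (gr z y) (x - z)) + v * (l z y + ip (gr z y) (x' - z)) \<le> u * l x y + v * l x' y"
      using lin[OF z x(1) y] lin[OF z x(2) y] uv by (intro add_mono mult_left_mono) auto
    moreover have "u * ip (gr z y) (x - z) + v * ip (gr z y) (x' - z) = 0"
    proof -
      have "u *\<^sub>R (x - z) + v *\<^sub>R (x' - z) = z - (u + v) *\<^sub>R z" by (simp add: z_def algebra_simps)
      then have "u *\<^sub>R (x - z) + v *\<^sub>R (x' - z) = 0" using uv by simp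
      then show ?thesis by (metis ip.add_right ip.scaleR_right ip.zero_right real_scaleR_def)
    qed
    moreover have "u * l z y + v * l z y = l z y" using uv(3) by (metis distrib_right mult_1)
    ultimately show "ereal (l z y) \<le> ereal u * ereal (l x y) + ereal v * ereal (l x' y)"
      by (simp add: algebra_simps)
  qed
  have "\<exists>\<xi>\<in>W. \<forall>\<xi>'\<in>W. l \<xi> y - ip v \<xi> \<le> l \<xi>' y - ip v \<xi>'" for v y
  proof (rule continuous_attains_inf[OF W(2,3)])
    have "continuous_on S (\<lambda>\<xi>. l \<xi> y)"
      using l_has_gradient by (meson S(1) continuous_on_eq_continuous_at has_derivative_continuous)
    then have "continuous_on W (\<lambda>\<xi>. l \<xi> y)" using rS unfolding W_def by (rule continuous_on_subset)
    then show "continuous_on W (\<lambda>\<xi>. l \<xi> y - ip v \<xi>)" by (intro continuous_intros ip.continuous_on)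
  qed
  then have ex: "\<exists>\<xi>. \<xi> \<in> W \<and> (\<forall>\<xi>'\<in>W. l \<xi> y - ip v \<xi> \<le> l \<xi>' y - ip v \<xi>')" for v y by blast
  define m where "m v y = (SOME \<xi>. \<xi> \<in> W \<and> (\<forall>\<xi>'\<in>W. l \<xi> y - ip v \<xi> \<le> l \<xi>' y - ip v \<xi>'))" for v y
  have "m v y \<in> W \<and> (\<forall>\<xi>'\<in>W. l (m v y) y - ip v (m v y) \<le> l \<xi>' y - ip v \<xi>')" for v y
    unfolding m_def by (rule someI_ex[OF ex])
  then have m: "\<And>v y. m v y \<in> W" "\<And>v y \<xi>. \<xi> \<in> W \<Longrightarrow> l (m v y) y - ip v (m v y) \<le> l \<xi> y - ip v \<xi>"
    by blast+
  define L where "L = C\<^sup>2 / s * (C * (K + 1))"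
  \<comment> \<open>Strong monotonicity of the gradient against the two first-order conditions.\<close>
  have stable: "norm (\<xi>1 - \<xi>2) \<le> L * norm ((v1, y1) - (v2, y2))"
    if \<xi>: "\<xi>1 \<in> W" "\<xi>2 \<in> W" and y: "y1 \<in> cball ybar \<delta>" "y2 \<in> cball ybar \<delta>"
      and min1: "\<And>\<xi>. \<xi> \<in> W \<Longrightarrow> l \<xi>1 y1 - ip v1 \<xi>1 \<le> l \<xi> y1 - ip v1 \<xi>"
      and min2: "\<And>\<xi>. \<xi> \<in> W \<Longrightarrow> l \<xi>2 y2 - ip v2 \<xi>2 \<le> l \<xi> y2 - ip v2 \<xi>"
    for \<xi>1 \<xi>2 v1 v2 y1 y2
  proof -
    define d where "d = \<xi>2 - \<xi>1"
    have inS: "\<xi>1 \<in> S" "\<xi>2 \<in> S" using \<xi> rS by (auto simp: W_def)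
    have opt1: "0 \<le> ip (gr \<xi>1 y1 - v1) d"
      unfolding d_def by (rule first_order_optimality[OF W(1) \<xi>(1) inS(1) \<xi>(2) min1])
    have "0 \<le> ip (gr \<xi>2 y2 - v2) (\<xi>1 - \<xi>2)"
      by (rule first_order_optimality[OF W(1) \<xi>(2) inS(2) \<xi>(1) min2])
    then have opt2: "ip (gr \<xi>2 y2 - v2) d \<le> 0"
      by (metis d_def ip.minus_right minus_diff_eq neg_0_le_iff_le)
    have "l \<xi>1 y1 + ip (gr \<xi>1 y1) d + s / 2 * ip d d \<le> l \<xi>2 y1"
      using growth[of \<xi>1 \<xi>2 y1] \<xi> y by (simp add: d_def W_def)
    moreover have "l \<xi>2 y1 + ip (gr \<xi>2 y1) (- d) + s / 2 * ip (- d) (- d) \<le> l \<xi>1 y1"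
      using growth[of \<xi>2 \<xi>1 y1] \<xi> y by (simp add: d_def W_def)
    ultimately have "s * ip d d \<le> ip (gr \<xi>2 y1) d - ip (gr \<xi>1 y1) d"
      by (simp add: ip.minus_left ip.minus_right)
    also have "\<dots> \<le> ip (gr \<xi>2 y1 - gr \<xi>2 y2 + (v2 - v1)) d"
      using opt1 opt2 by (simp add: ip.diff_left ip.add_left)
    also have "\<dots> \<le> C * norm (gr \<xi>2 y1 - gr \<xi>2 y2 + (v2 - v1)) * norm d"
      using C(3) by (meson abs_le_D1)
    also have "\<dots> \<le> C * ((K + 1) * norm ((v1, y1) - (v2, y2))) * norm d"
    proof (intro mult_right_mono mult_left_mono)
      have "norm (gr \<xi>2 y1 - gr \<xi>2 y2 + (v2 - v1)) \<le> norm (gr \<xi>2 y1 - gr \<xi>2 y2) + norm (v2 - v1)"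
        by (rule norm_triangle_ineq)
      also have "norm (gr \<xi>2 y1 - gr \<xi>2 y2) \<le> K * norm (y1 - y2)"
        using K \<xi>(2) r(3) by (simp add: W_def)
      also have "K * norm (y1 - y2) \<le> K * norm ((v1, y1) - (v2, y2))"
        using norm_snd_le[of "y1 - y2" "v1 - v2"] rK(2) by (simp add: mult_left_mono)
      also have "norm (v2 - v1) \<le> norm ((v1, y1) - (v2, y2))"
        using norm_fst_le[of "v1 - v2" "y1 - y2"] by (simp add: norm_minus_commute)
      finally show "norm (gr \<xi>2 y1 - gr \<xi>2 y2 + (v2 - v1)) \<le> (K + 1) * norm ((v1, y1) - (v2, y2))"
        by (simp add: algebra_simps)
    qed (use C(1) in auto)
    finally have main: "s * ip d d \<le> C * (K + 1) * norm ((v1, y1) - (v2, y2)) * norm d"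
      by (simp add: mult.assoc)
    have "(norm d)\<^sup>2 \<le> (C * ip_norm ip d)\<^sup>2" using C(2) by (simp add: power_mono)
    also have "\<dots> = C\<^sup>2 / s * (s * ip d d)" using pos by (simp add: power_mult_distrib ip_norm_sq[OF ip])
    also have "\<dots> \<le> C\<^sup>2 / s * (C * (K + 1) * norm ((v1, y1) - (v2, y2)) * norm d)"
      using main pos by (intro mult_left_mono) auto
    finally have "norm d * norm d \<le> L * norm ((v1, y1) - (v2, y2)) * norm d"
      by (simp add: L_def power2_eq_square mult_ac)
    then have "norm d \<le> L * norm ((v1, y1) - (v2, y2)) \<or> norm d = 0"
      by (metis mult_le_cancel_right_pos norm_ge_zero order_le_less)
    moreover have "0 \<le> L * norm ((v1, y1) - (v2, y2))" using pos C(1) rK(2) by (simp add: L_def)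
    ultimately show ?thesis unfolding d_def by (metis norm_minus_commute)
  qed
  show ?thesis
  proof (rule exI[of _ r], rule exI[of _ \<delta>], rule exI[of _ m], rule exI[of _ L], intro conjI allI ballI)
    show "0 < r" "r \<le> r0" "0 < \<delta>" "cball 0 r \<subseteq> S" by fact+
    show "ereal_convex_on (cball 0 r) (\<lambda>\<xi>. ereal (l \<xi> y))" if "y \<in> cball ybar \<delta>" for y
      using convex[OF that] by (simp add: W_def)
    show "0 \<le> L" using pos C(1) rK(2) by (simp add: L_def)
    show "norm (m v y - m v' y') \<le> L * norm ((v, y) - (v', y'))"
      if "y \<in> cball ybar \<delta>" "y' \<in> cball ybar \<delta>" for v y v' y'
      by (rule stable[OF m(1) m(1) that m(2) m(2)])
    show "tilted_argmin (cball 0 r) v y = {m v y}" if "y \<in> cball ybar \<delta>" for v y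
    proof -
      have "\<xi> = m v y" if "\<xi> \<in> tilted_argmin W v y" for \<xi>
      proof -
        have "norm (\<xi> - m v y) \<le> L * norm ((v, y) - (v, y))"
          by (rule stable[OF _ m(1) \<open>y \<in> cball ybar \<delta>\<close> \<open>y \<in> cball ybar \<delta>\<close> _ m(2)])
            (use that in \<open>auto simp: tilted_argmin_def\<close>)
        then show ?thesis by simp
      qed
      then show ?thesis using m by (auto simp: tilted_argmin_def W_def)
    qed
  qed
qed

section \<open>Tilt stability gives uniform quadratic growth\<close>

text \<open>The partial gradient of \<open>l\<close> vanishes at the KKT pair.\<close>

lemma reference_minimizes:
  assumes "ereal_convex_on W (\<lambda>\<xi>. ereal (l \<xi> ybar))" "0 \<in> W" "\<xi> \<in> W"
  shows "l 0 ybar \<le> l \<xi> ybar"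
  using convex_gradient_inequality[OF assms(1,2) S(2) assms(3)]
  by (simp add: gr_reference ip.zero_left)

text \<open>A minimizer in the interior may be moved against \<open>gr \<xi> y - v\<close>, so this vector vanishes.\<close>

lemma interior_minimizer_gradient:
  assumes W: "convex W" "\<xi> \<in> interior W" "\<xi> \<in> S"
    and min: "\<And>z. z \<in> W \<Longrightarrow> l \<xi> y - ip v \<xi> \<le> l z y - ip v z"
  shows "gr \<xi> y = v"
proof -
  define g where "g = gr \<xi> y - v"
  obtain e where e: "e > 0" "ball \<xi> e \<subseteq> W" using W(2) by (auto simp: mem_interior)
  define n where "n = norm g + 1"
  have n: "n > 0" "norm g \<le> n" by (auto simp: n_def add_nonneg_pos)
  define t where "t = e / (2 * n)"
  have t: "t > 0" using e n by (simp add: t_def)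
  have "t * norm g < e"
  proof -
    have "t * norm g \<le> t * n" using t n by (intro mult_left_mono) auto
    also have "\<dots> = e / 2" using n by (simp add: t_def)
    finally show ?thesis using e by simp
  qed
  then have "\<xi> - t *\<^sub>R g \<in> W" using e(2) t by (auto simp: dist_norm intro!: subsetD[OF e(2)])
  moreover have "\<xi> \<in> W" using W(2) interior_subset by blast
  ultimately have "0 \<le> ip g (\<xi> - t *\<^sub>R g - \<xi>)"
    unfolding g_def using first_order_optimality[OF W(1) _ W(3) _ min] by blast
  then have "t * ip g g \<le> 0" by (simp add: ip.minus_right ip.scaleR_right)
  then have "ip g g \<le> 0" using t by (simp add: mult_le_0_iff)
  then have "g = 0" using inner_product_pos[OF ip, of g] by (cases "g = 0") auto
  then show ?thesis by (simp add: g_def)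
qed

text \<open>Growth of \<open>l\<close> comes from tilting, growth in \<open>b\<close> from the penalty, and they are combined through the Lipschitz
  dependence of \<open>\<beta>\<close> on \<open>\<xi>\<close>. Surjectivity of the subgradient mapping is provided by the tilted minimizers,
  which stay in the interior for small tilts.\<close>

lemma variationally_strongly_convex_if_tilt_stable:
  assumes W: "0 \<in> interior W" and Y: "ybar \<in> interior Y" and V: "0 \<in> interior V"
    and conv: "\<And>y. y \<in> Y \<Longrightarrow> ereal_convex_on W (\<lambda>\<xi>. ereal (l \<xi> y))"
    and argmin: "\<And>v y. v \<in> V \<Longrightarrow> y \<in> Y \<Longrightarrow> tilted_argmin W v y = {m v y}"
    and L: "L \<ge> 0" and \<delta>0: "\<delta>0 > 0"
    and lip: "\<And>v y v' y'. v \<in> ball 0 \<delta>0 \<Longrightarrow> v' \<in> ball 0 \<delta>0 \<Longrightarrow> y \<in> ball ybar \<delta>0 \<Longrightarrow> y' \<in> ball ybar \<delta>0 \<Longrightarrow>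
      norm (m v y - m v' y') \<le> L * norm ((v, y) - (v', y'))"
  shows "variationally_strongly_convex (prod_ip ip) \<phi> (0, 0) (0, ybar)"
proof -
  have m: "m v y \<in> W" and min: "\<xi> \<in> W \<Longrightarrow> l (m v y) y - ip v (m v y) \<le> l \<xi> y - ip v \<xi>"
    if "v \<in> V" "y \<in> Y" for v y \<xi>
  proof -
    have "m v y \<in> tilted_argmin W v y" using argmin[OF that] by simp
    then show "m v y \<in> W" "\<xi> \<in> W \<Longrightarrow> l (m v y) y - ip v (m v y) \<le> l \<xi> y - ip v \<xi>"
      by (auto simp: tilted_argmin_def)
  qed
  have uniq: "\<xi> = m v y" if "v \<in> V" "y \<in> Y" "\<xi> \<in> W"
    "\<And>\<xi>'. \<xi>' \<in> W \<Longrightarrow> l \<xi> y - ip v \<xi> \<le> l \<xi>' y - ip v \<xi>'" for v y \<xi>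
  proof -
    have "\<xi> \<in> tilted_argmin W v y" using that(3,4) by (simp add: tilted_argmin_def)
    then show ?thesis using argmin[OF that(1,2)] by simp
  qed
  obtain C where C: "C > 0" "\<And>u. norm u \<le> C * ip_norm ip u" "\<And>u v. \<bar>ip u v\<bar> \<le> C * norm u * norm v"
    using inner_product_norm_equivalence[OF ip] by metis
  have norm_sq: "(norm d)\<^sup>2 \<le> C\<^sup>2 * ip d d" for d
  proof -
    have "(norm d)\<^sup>2 \<le> (C * ip_norm ip d)\<^sup>2" using C(2) by (simp add: power_mono)
    then show ?thesis by (simp add: power_mult_distrib ip_norm_sq[OF ip])
  qed
  obtain rK K where rK: "rK > 0" "K \<ge> 0" "cball 0 rK \<subseteq> S"
    and K: "\<And>\<xi> \<xi>' y. \<xi> \<in> cball 0 rK \<Longrightarrow> \<xi>' \<in> cball 0 rK \<Longrightarrow> norm (\<beta> \<xi> y - \<beta> \<xi>' y) \<le> K * norm (\<xi> - \<xi>')"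
    using local_Lipschitz_bounds[OF S(2)] by metis
  have convW: "convex W" using conv Y interior_subset by (auto simp: ereal_convex_on_def)
  obtain rW where rW: "rW > 0" "ball 0 rW \<subseteq> W" using W by (auto simp: mem_interior)
  define r where "r = min rK rW"
  have r: "r > 0" "ball 0 r \<subseteq> cball 0 rK" "ball 0 r \<subseteq> W" using rK rW by (auto simp: r_def)
  have rS: "ball 0 r \<subseteq> S" using r rK(3) by blast
  have rI: "ball 0 r \<subseteq> interior W" by (rule interior_maximal[OF r(3) open_ball])
  obtain \<delta>Y where \<delta>Y: "\<delta>Y > 0" "ball ybar \<delta>Y \<subseteq> Y" using Y by (auto simp: mem_interior)
  obtain \<delta>V where \<delta>V: "\<delta>V > 0" "ball 0 \<delta>V \<subseteq> V" using V by (auto simp: mem_interior)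
  \<comment> \<open>A positive bound for the Lipschitz constant, so that it may be divided by.\<close>
  define M where "M = L + 1"
  have M: "M > 0" "L \<le> M" using L by (auto simp: M_def)
  define \<delta> where "\<delta> = min (min \<delta>0 (min \<delta>Y \<delta>V)) (r / (2 * M))"
  have \<delta>: "\<delta> > 0" "ball 0 \<delta> \<subseteq> V" "ball ybar \<delta> \<subseteq> Y" "\<delta> \<le> \<delta>0" "\<delta> \<le> r / (2 * M)"
    using \<delta>0 \<delta>Y \<delta>V r M by (auto simp: \<delta>_def)
  have YybarY: "ybar \<in> Y" and V0: "0 \<in> V" and W0: "0 \<in> W"
    using \<delta>(1,2,3) W interior_subset by (auto simp: subset_iff)
  have m0: "m 0 ybar = 0"
    by (rule uniq[OF V0 YybarY W0, symmetric])
      (simp add: ip.zero_left reference_minimizes[OF conv[OF YybarY] W0])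
  have m_small: "m v y \<in> ball 0 r" if "v \<in> ball 0 \<delta>" "y \<in> ball ybar \<delta>" for v y
  proof -
    have "norm (m v y - m 0 ybar) \<le> L * norm ((v, y) - (0, ybar))"
      by (rule lip) (use that \<delta>(1,4) in auto)
    also have "\<dots> \<le> L * (norm v + norm (y - ybar))"
      using norm_Pair_le[of v "y - ybar"] L by (simp add: mult_left_mono)
    also have "\<dots> \<le> L * (\<delta> + \<delta>)"
      using that L by (intro mult_left_mono add_mono) (auto simp: dist_norm norm_minus_commute)
    also have "\<dots> < M * (2 * \<delta>)" using \<delta>(1) by (simp add: M_def algebra_simps)
    also have "\<dots> \<le> M * (2 * (r / (2 * M)))" using \<delta>(5) M by (intro mult_left_mono) auto
    also have "\<dots> = r" using M by simp
    finally show ?thesis by (simp add: m0)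
  qed
  have gr_m: "gr (m v y) y = v" if "v \<in> ball 0 \<delta>" "y \<in> ball ybar \<delta>" for v y
    by (rule interior_minimizer_gradient[OF convW])
      (use m_small[OF that] rI rS min \<delta>(2,3) that in blast)+
  have m_gr: "\<xi> = m (gr \<xi> y) y" if \<xi>: "\<xi> \<in> ball 0 r" "gr \<xi> y \<in> V" and y: "y \<in> Y" for \<xi> y
  proof (rule uniq[OF \<xi>(2) y])
    show "\<xi> \<in> W" using \<xi>(1) r(3) by blast
    fix \<xi>' assume "\<xi>' \<in> W"
    from convex_gradient_inequality[OF conv[OF y] \<open>\<xi> \<in> W\<close> _ this] \<xi>(1) rS
    show "l \<xi> y - ip (gr \<xi> y) \<xi> \<le> l \<xi>' y - ip (gr \<xi> y) \<xi>'"
      by (auto simp: ip.diff_right subset_iff)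
  qed
  \<comment> \<open>The first bound keeps the changed tilt \<open>v1 + t d\<close> within \<open>\<delta>\<close> of zero, as \<open>|d| \<le> 2 r\<close>; the second makes the displacement of the minimizer cost at most half of the gain \<open>t |d|\<^sup>2\<close>.\<close>
  define t where "t = min (\<delta> / (4 * r)) (1 / (2 * C ^ 3 * M))"
  have t: "t > 0" "t * (2 * r) \<le> \<delta> / 2" "t * (C ^ 3 * L) \<le> 1 / 2"
  proof -
    show "t > 0" using \<delta>(1) r(1) C(1) M by (simp add: t_def)
    have "t * (2 * r) \<le> (\<delta> / (4 * r)) * (2 * r)" using r by (intro mult_right_mono) (auto simp: t_def)
    then show "t * (2 * r) \<le> \<delta> / 2" using r by simp
    have "t * (C ^ 3 * L) \<le> t * (C ^ 3 * M)" using \<open>t > 0\<close> C(1) M by (intro mult_left_mono) auto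
    also have "\<dots> \<le> (1 / (2 * C ^ 3 * M)) * (C ^ 3 * M)"
      using C(1) M by (intro mult_right_mono) (auto simp: t_def)
    also have "\<dots> = 1 / 2" using C(1) M by simp
    finally show "t * (C ^ 3 * L) \<le> 1 / 2" .
  qed
  \<comment> \<open>Tilting by a small multiple of the displacement moves the minimizer proportionally; comparing
    the two tilted problems at the tilted minimizer yields the quadratic term.\<close>
  have l_growth: "l \<xi>1 y + ip (gr \<xi>1 y) (\<xi>2 - \<xi>1) + t / 2 * ip (\<xi>2 - \<xi>1) (\<xi>2 - \<xi>1) \<le> l \<xi>2 y"
    if \<xi>: "\<xi>1 \<in> ball 0 r" "\<xi>2 \<in> ball 0 r" and v1: "gr \<xi>1 y \<in> ball 0 (\<delta> / 2)" and y: "y \<in> ball ybar (\<delta> / 2)"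
    for \<xi>1 \<xi>2 y
  proof -
    define d where "d = \<xi>2 - \<xi>1"
    define v1 where "v1 = gr \<xi>1 y"
    define v where "v = v1 + t *\<^sub>R d"
    define \<xi> where "\<xi> = m v y"
    have "norm d \<le> 2 * r" using norm_triangle_ineq4[of \<xi>2 \<xi>1] \<xi> by (simp add: d_def)
    then have "t * norm d \<le> \<delta> / 2" using t by (meson less_imp_le mult_left_mono order_trans)
    then have v: "v \<in> ball 0 \<delta>"
      using norm_triangle_ineq[of v1 "t *\<^sub>R d"] that(3) t(1) by (simp add: v_def v1_def)
    have v1': "v1 \<in> ball 0 \<delta>" and y': "y \<in> ball ybar \<delta>" using that(3) y \<delta>(1) by (auto simp: v1_def)
    have inV: "v \<in> V" "v1 \<in> V" "y \<in> Y" using v v1' y' \<delta> by blast+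
    have m1: "\<xi>1 = m v1 y" using m_gr[OF \<xi>(1) _ inV(3)] inV(2) by (simp add: v1_def)
    have inW: "\<xi> \<in> W" "\<xi>2 \<in> W" using m[OF inV(1,3)] \<xi>(2) r(3) by (auto simp: \<xi>_def)
    have 1: "l \<xi> y - ip v \<xi> \<le> l \<xi>2 y - ip v \<xi>2"
      unfolding \<xi>_def by (rule min[OF inV(1,3) inW(2)])
    have 2: "l \<xi>1 y - ip v1 \<xi>1 \<le> l \<xi> y - ip v1 \<xi>"
      unfolding m1 by (rule min[OF inV(2,3) inW(1)])
    have vd: "ip v z = ip v1 z + t * ip d z" for z by (simp add: v_def ip.add_left ip.scaleR_left)
    have sum: "l \<xi>1 y + ip v1 d + t * ip d d - t * ip d (\<xi> - \<xi>1) \<le> l \<xi>2 y"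
      using 1 2 by (simp add: vd d_def ip.diff_right ip.diff_left algebra_simps)
    have "norm (\<xi> - \<xi>1) \<le> L * norm ((v, y) - (v1, y))"
      unfolding \<xi>_def m1 by (rule lip) (use v v1' y' \<delta>(4) in auto)
    then have move: "norm (\<xi> - \<xi>1) \<le> L * (t * norm d)" using t(1) by (simp add: v_def)
    have "ip d (\<xi> - \<xi>1) \<le> C * norm d * norm (\<xi> - \<xi>1)" using C(3) abs_le_D1 by blast
    also have "\<dots> \<le> C * norm d * (L * (t * norm d))" using move C(1) by (intro mult_left_mono) auto
    also have "\<dots> = C * L * t * (norm d)\<^sup>2" by (simp add: power2_eq_square)
    also have "\<dots> \<le> C * L * t * (C\<^sup>2 * ip d d)" using norm_sq C(1) L t(1) by (intro mult_left_mono) auto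
    also have "\<dots> = (t * (C ^ 3 * L)) * ip d d" by (simp add: power2_eq_square power3_eq_cube mult_ac)
    also have "\<dots> \<le> 1 / 2 * ip d d" using t(3) inner_product_nonneg[OF ip] by (intro mult_right_mono) auto
    finally have "t * ip d (\<xi> - \<xi>1) \<le> t * (1 / 2 * ip d d)" using t(1) by (intro mult_left_mono) auto
    then have "l \<xi>1 y + ip v1 d + t / 2 * ip d d \<le> l \<xi>2 y" using sum by simp
    then show ?thesis by (simp add: d_def v1_def)
  qed
  \<comment> \<open>A displacement of \<open>\<xi>\<close> contributes its own square and, as it also displaces \<open>\<beta>\<close>, a part of \<open>|b2 - b1|\<^sup>2\<close>.\<close>
  define Q where "Q = 1 + 2 * K\<^sup>2 * C\<^sup>2"
  have "Q > 0" by (simp add: Q_def add_pos_nonneg)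
  define s where "s = min (\<rho> / 2) (t / Q)"
  have s: "s > 0" "s \<le> \<rho> / 2" "s * Q \<le> t"
  proof -
    show "s > 0" using t(1) rho \<open>Q > 0\<close> by (simp add: s_def)
    show "s \<le> \<rho> / 2" unfolding s_def by (rule min.cobounded1)
    have "s * Q \<le> t / Q * Q" using \<open>Q > 0\<close> by (intro mult_right_mono) (auto simp: s_def)
    then show "s * Q \<le> t" using \<open>Q > 0\<close> by simp
  qed
  define N where "N = ball (0::'e) r \<times> (UNIV :: 'y set)"
  define Z where "Z = ball (0::'e) (\<delta> / 2) \<times> ball ybar (\<delta> / 2)"
  have ref: "((0, 0), (0, ybar)) \<in> gph_subdiff (prod_ip ip) \<phi>"
    using gr_beta_in_gph[OF S(2), of ybar] by (simp add: beta_reference gr_reference)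
  show ?thesis
  proof (rule variationally_strongly_convexI[OF ipp ref, of N Z s])
    show "\<forall>\<^sub>F x in nhds (0, 0). lsc_at \<phi> x"
    proof -
      have "\<forall>\<^sub>F x in nhds (0::'e, 0::'y). x \<in> S \<times> UNIV"
        by (rule eventually_nhds_in_open) (use S in \<open>auto intro: open_Times\<close>)
      then show ?thesis by eventually_elim (use phi_lsc in auto)
    qed
    show "open N" "open Z" by (auto simp: N_def Z_def intro: open_Times)
    show "convex N" "convex Z" by (auto simp: N_def Z_def intro: convex_Times)
    show "(0, 0) \<in> N" "(0, ybar) \<in> Z" using r \<delta>(1) by (auto simp: N_def Z_def)
    show "s > 0" by fact
    show "\<exists>x\<in>N. (x, p) \<in> gph_subdiff (prod_ip ip) \<phi>" if "p \<in> Z" for p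
    proof -
      obtain v y where p: "p = (v, y)" by fastforce
      then have vy: "v \<in> ball 0 \<delta>" "y \<in> ball ybar \<delta>" using that \<delta>(1) by (auto simp: Z_def)
      have "m v y \<in> S" using m_small[OF vy] rS by blast
      from gr_beta_in_gph[OF this, of y] show ?thesis
        unfolding gr_m[OF vy] p using m_small[OF vy] by (auto simp: N_def)
    qed
    fix x p u assume xp: "(x, p) \<in> gph_subdiff (prod_ip ip) \<phi>" "x \<in> N" "p \<in> Z" and u: "u \<in> N"
    obtain \<xi>1 b1 where x: "x = (\<xi>1, b1)" by fastforce
    obtain v1 y where p: "p = (v1, y)" by fastforce
    obtain \<xi>2 b2 where u2: "u = (\<xi>2, b2)" by fastforce
    have \<xi>: "\<xi>1 \<in> ball 0 r" "\<xi>2 \<in> ball 0 r" using xp u by (auto simp: N_def x u2)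
    have inS: "\<xi>1 \<in> S" "\<xi>2 \<in> S" using \<xi> rS by blast+
    then have inB: "\<xi>1 \<in> B" "\<xi>2 \<in> B" using S by blast+
    have b1: "b1 = \<beta> \<xi>1 y" and v1: "v1 = gr \<xi>1 y" using gph_cases[OF inS(1)] xp(1) unfolding x p by auto
    have y: "y \<in> ball ybar (\<delta> / 2)" and "gr \<xi>1 y \<in> ball 0 (\<delta> / 2)" using xp(3) v1 by (auto simp: Z_def p)
    define d where "d = \<xi>2 - \<xi>1"
    define e where "e = b2 - \<beta> \<xi>2 y"
    define c where "c = \<beta> \<xi>2 y - b1"
    have lg: "l \<xi>1 y + ip v1 d + t / 2 * ip d d \<le> l \<xi>2 y"
      unfolding v1 d_def by (rule l_growth) fact+
    have "norm c \<le> K * norm d"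
      unfolding c_def d_def b1 by (rule K) (use \<xi> r(2) in blast)+
    then have "(norm c)\<^sup>2 \<le> (K * norm d)\<^sup>2" by (simp add: power_mono)
    also have "\<dots> \<le> K\<^sup>2 * (C\<^sup>2 * ip d d)"
      unfolding power_mult_distrib using norm_sq by (intro mult_left_mono) auto
    finally have c: "(norm c)\<^sup>2 \<le> K\<^sup>2 * (C\<^sup>2 * ip d d)" .
    have "(norm (b2 - b1))\<^sup>2 \<le> 2 * (norm e)\<^sup>2 + 2 * (norm c)\<^sup>2"
    proof -
      have "b2 - b1 = e + c" by (simp add: e_def c_def)
      moreover have "0 \<le> (norm (e - c))\<^sup>2" by simp
      ultimately show ?thesis
        unfolding power2_norm_eq_inner by (simp add: inner_simps inner_commute)
    qed
    with c have "ip d d + (norm (b2 - b1))\<^sup>2 \<le> Q * ip d d + 2 * (norm e)\<^sup>2"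
      by (simp add: Q_def algebra_simps)
    then have "s / 2 * (ip d d + (norm (b2 - b1))\<^sup>2) \<le> s / 2 * (Q * ip d d + 2 * (norm e)\<^sup>2)"
      using s(1) by (intro mult_left_mono) auto
    also have "\<dots> = (s * Q) / 2 * ip d d + s * (norm e)\<^sup>2" by (simp add: algebra_simps)
    also have "\<dots> \<le> t / 2 * ip d d + \<rho> / 2 * (norm e)\<^sup>2"
      using s(2,3) inner_product_nonneg[OF ip] by (intro add_mono mult_right_mono) auto
    finally have quad: "s / 2 * (ip d d + (norm (b2 - b1))\<^sup>2) \<le> t / 2 * ip d d + \<rho> / 2 * (norm e)\<^sup>2" .
    have "\<phi> x + ereal (prod_ip ip p (u - x) + s / 2 * (ip_norm (prod_ip ip) (u - x))\<^sup>2)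
        = ereal (l \<xi>1 y + y \<bullet> b1 + (ip v1 d + y \<bullet> (b2 - b1) + s / 2 * (ip d d + (norm (b2 - b1))\<^sup>2)))"
      using phi_at_beta[OF inB(1), of y]
      by (simp add: x p u2 b1[symmetric] ip_norm_sq[OF ipp]) (simp add: prod_ip_def d_def power2_norm_eq_inner)
    also have "\<dots> \<le> ereal (l \<xi>2 y + y \<bullet> b2 + \<rho> / 2 * (norm e)\<^sup>2)"
      using lg quad by (simp add: inner_diff_right)
    also have "\<dots> \<le> \<phi> u"
      unfolding u2 e_def by (rule phi_growth[OF inB(2)])
    finally show "\<phi> x + ereal (prod_ip ip p (u - x) + s / 2 * (ip_norm (prod_ip ip) (u - x))\<^sup>2) \<le> \<phi> u" .
  qed
qed

end

section \<open>Riemannian geometry near a point\<close>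

subsection \<open>Charts\<close>

locale smooth_manifold_chart =
  fixes M :: "('m, 'e::euclidean_space) riem" and c :: "('m, 'e) chart"
  assumes manifold: "smooth_manifold M" and c: "c \<in> atlas M"
begin

lemma chart_homeomorphic:
  "openin (mtop M) (fst c)" "open (snd c ` fst c)"
  "homeomorphic_map (subtopology (mtop M) (fst c)) (top_of_set (snd c ` fst c)) (snd c)"
  using manifold c by (auto simp: smooth_manifold_def is_chart_def)

lemma chart_topspace: "fst c \<subseteq> topspace (mtop M)"
  "topspace (subtopology (mtop M) (fst c)) = fst c"
  using chart_homeomorphic(1) openin_subset by auto

lemma chart_inj: "inj_on (snd c) (fst c)"
  using homeomorphic_imp_injective_map[OF chart_homeomorphic(3)] chart_topspace(2) by simp

lemma chart_inv_left: "p \<in> fst c \<Longrightarrow> chart_inv c (snd c p) = p"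
  unfolding chart_inv_def by (rule inv_into_f_f[OF chart_inj])

lemma chart_inv_right: "z \<in> snd c ` fst c \<Longrightarrow> snd c (chart_inv c z) = z"
  and chart_inv_in: "z \<in> snd c ` fst c \<Longrightarrow> chart_inv c z \<in> fst c"
  unfolding chart_inv_def by (simp_all add: f_inv_into_f inv_into_into)

lemma open_chart_image:
  assumes "openin (mtop M) U" "U \<subseteq> fst c"
  shows "open (snd c ` U)"
proof -
  have "openin (subtopology (mtop M) (fst c)) U"
    using assms by (simp add: openin_subset_topspace_eq openin_open_subtopology chart_homeomorphic(1))
  then have "openin (top_of_set (snd c ` fst c)) (snd c ` U)"
    using homeomorphic_imp_open_map[OF chart_homeomorphic(3)] by (simp add: open_map_def)
  then show ?thesis using chart_homeomorphic(2) openin_open_eq by blast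
qed

lemma openin_chart_vimage:
  assumes "open V"
  shows "openin (mtop M) (fst c \<inter> snd c -` V)"
proof -
  have "openin (top_of_set (snd c ` fst c)) (snd c ` fst c \<inter> V)" using assms by (simp add: openin_open_Int)
  from openin_continuous_map_preimage[OF homeomorphic_imp_continuous_map[OF chart_homeomorphic(3)] this]
  have "openin (subtopology (mtop M) (fst c)) {x \<in> fst c. snd c x \<in> snd c ` fst c \<inter> V}"
    unfolding chart_topspace(2) .
  moreover have "{x \<in> fst c. snd c x \<in> snd c ` fst c \<inter> V} = fst c \<inter> snd c -` V" by auto
  ultimately show ?thesis
    by (simp add: openin_open_subtopology[OF chart_homeomorphic(1)])
qed

lemma closedin_chart_inv_compact:
  assumes "compact V" "V \<subseteq> snd c ` fst c"
  shows "closedin (mtop M) (fst c \<inter> snd c -` V)"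
proof -
  have img: "snd c ` (fst c \<inter> snd c -` V) = V" using assms(2) by auto
  have "compactin (top_of_set (snd c ` fst c)) V"
    using assms by (simp add: compactin_subtopology compactin_euclidean_iff)
  then have "compactin (subtopology (mtop M) (fst c)) (fst c \<inter> snd c -` V)"
    using homeomorphic_map_compactness[OF chart_homeomorphic(3), of "fst c \<inter> snd c -` V"]
    unfolding img chart_topspace(2) by simp
  then have "compactin (mtop M) (fst c \<inter> snd c -` V)" by (simp add: compactin_subtopology)
  then show ?thesis
    using manifold by (simp add: compactin_imp_closedin smooth_manifold_def)
qed

lemma chart_transition_derivative:
  assumes "d \<in> atlas M" "p \<in> fst c" "p \<in> fst d"
  shows "((snd d \<circ> chart_inv c) has_derivative frechet_derivative (snd d \<circ> chart_inv c) (at (snd c p))) (at (snd c p))"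
proof (rule smooth_on_derivative)
  show "smooth_on (snd c ` (fst c \<inter> fst d)) (snd d \<circ> chart_inv c)"
    using manifold c assms(1) by (simp add: smooth_manifold_def)
qed (use assms in auto)

lemma chart_at_atlas: "p \<in> topspace (mtop M) \<Longrightarrow> chart_at M p \<in> atlas M \<and> p \<in> fst (chart_at M p)"
  using manifold by (simp add: smooth_manifold_def)

lemma tangent_of_linear:
  assumes "p \<in> fst c"
  shows "linear (tangent_of M c p)"
proof -
  have "p \<in> topspace (mtop M)" using assms chart_topspace by auto
  from chart_transition_derivative[OF _ assms] chart_at_atlas[OF this]
  show ?thesis unfolding tangent_of_def by (blast intro: has_derivative_linear)
qed

lemma open_path_in_chart:
  assumes "pathin (mtop M) \<gamma>"
  shows "open ({0<..<1} \<inter> \<gamma> -` fst c)"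
proof -
  have "openin (top_of_set {0..1}) {t \<in> {0..1}. \<gamma> t \<in> fst c}"
    using openin_continuous_map_preimage[OF assms[unfolded pathin_def] chart_homeomorphic(1)] by simp
  then obtain T where T: "open T" "{t \<in> {0..1}. \<gamma> t \<in> fst c} = {0..1} \<inter> T" by (auto simp: openin_open)
  have "{0<..<1} \<inter> \<gamma> -` fst c = {0<..<1} \<inter> {t \<in> {0..1}. \<gamma> t \<in> fst c}" by auto
  also have "\<dots> = {0<..<1} \<inter> T" unfolding T(2) by auto
  finally show ?thesis using T(1) by (simp add: open_Int)
qed

text \<open>The velocity, taken in the preferred chart at the current point, is read off from any fixed
  chart through the change of charts.\<close>

lemma velocity_in_chart:
  assumes \<gamma>: "pathin (mtop M) \<gamma>" and t: "0 < t" "t < 1" "\<gamma> t \<in> fst c"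
    and w: "((snd c \<circ> \<gamma>) has_vector_derivative w) (at t)"
  shows "velocity M \<gamma> t = tangent_of M c (\<gamma> t) w"
proof -
  define d where "d = chart_at M (\<gamma> t)"
  have d: "d \<in> atlas M" "\<gamma> t \<in> fst d" using chart_at_atlas t(3) chart_topspace by (auto simp: d_def)
  have "((snd d \<circ> chart_inv c) has_derivative tangent_of M c (\<gamma> t)) (at ((snd c \<circ> \<gamma>) t))"
    using chart_transition_derivative[OF d(1) t(3) d(2)] by (simp add: tangent_of_def[abs_def] d_def)
  then have "((snd d \<circ> chart_inv c) has_derivative tangent_of M c (\<gamma> t)) (at ((snd c \<circ> \<gamma>) t) within (snd c \<circ> \<gamma>) ` UNIV)"
    by (rule has_derivative_at_withinI)
  from vector_derivative_diff_chain_within[OF w this]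
  have "((snd d \<circ> chart_inv c \<circ> (snd c \<circ> \<gamma>)) has_vector_derivative tangent_of M c (\<gamma> t) w) (at t)" by (simp add: o_def)
  then have "((snd d \<circ> \<gamma>) has_vector_derivative tangent_of M c (\<gamma> t) w) (at t)"
    by (rule has_vector_derivative_transform_within_open[OF _ open_path_in_chart[OF \<gamma>]])
      (use t in \<open>auto simp: chart_inv_left\<close>)
  then show ?thesis unfolding velocity_def d_def by (rule vector_derivative_at)
qed

end

subsection \<open>The metric in the preferred chart\<close>

locale riemannian_point =
  fixes M :: "('m, 'e::euclidean_space) riem" and x :: 'm
  assumes riem: "riemannian_manifold M" and x: "x \<in> topspace (mtop M)"
begin

abbreviation "c \<equiv> chart_at M x"
abbreviation "z0 \<equiv> snd c x"

lemma xc: "x \<in> fst c" and c_atlas: "c \<in> atlas M" and smooth: "smooth_manifold M"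
  using riem x by (auto simp: riemannian_manifold_def smooth_manifold_def)

sublocale smooth_manifold_chart M c
  using smooth c_atlas by unfold_locales

lemma ip_x: "is_inner_product (metric M x)"
  using riem x by (simp add: riemannian_manifold_def)

text \<open>In its own preferred chart the change of coordinates is trivial.\<close>

lemma tangent_of_identity: "tangent_of M c x u = u"
proof -
  have "((snd c \<circ> chart_inv c) has_derivative (\<lambda>u. u)) (at z0)"
  proof (rule has_derivative_transform_within_open[OF has_derivative_ident chart_homeomorphic(2)])
    show "z0 \<in> snd c ` fst c" using xc by simp
    show "\<And>z. z \<in> snd c ` fst c \<Longrightarrow> z = (snd c \<circ> chart_inv c) z" by (simp add: chart_inv_right)
  qed
  then show ?thesis unfolding tangent_of_def by (simp add: frechet_derivative_at[symmetric])
qed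

text \<open>The Riemannian norm of a tangent vector given by its coordinates in the preferred chart at \<open>x\<close>.\<close>

definition speed :: "'e \<Rightarrow> 'e \<Rightarrow> real" where
  "speed z u = ip_norm (metric M (chart_inv c z)) (tangent_of M c (chart_inv c z) u)"

text \<open>The coefficients of the metric are continuous in the chart, so near \<open>x\<close> the Riemannian norm
  is a small perturbation of the norm at \<open>x\<close>, and comparable with the norm of the model space.\<close>

lemma speed_bounds:
  obtains r k K where "r > 0" "k > 0" "K > 0" "cball z0 r \<subseteq> snd c ` fst c"
    "\<And>z u. z \<in> cball z0 r \<Longrightarrow> k * norm u \<le> speed z u"
    "\<And>z u. z \<in> cball z0 r \<Longrightarrow> speed z u \<le> K * norm u"
proof -
  define U where "U = snd c ` fst c"
  have U: "open U" "z0 \<in> U" using chart_homeomorphic(2) xc by (auto simp: U_def)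
  define G where "G z u v = metric M (chart_inv c z) (tangent_of M c (chart_inv c z) u) (tangent_of M c (chart_inv c z) v)" for z u v
  have contG: "continuous_on U (\<lambda>z. G z u v)" for u v
  proof -
    have "smooth_on U (\<lambda>z. let x = chart_inv c z in metric M x (tangent_of M c x u) (tangent_of M c x v))"
      using riem c_atlas by (simp add: riemannian_manifold_def U_def)
    from smooth_on_continuous[OF this] show ?thesis by (simp add: G_def Let_def)
  qed
  have speed: "speed z u = sqrt (G z u u)" for z u by (simp add: speed_def ip_norm_def G_def)
  have bil: "bilinear (G z)" if "z \<in> U" for z
  proof -
    have p: "chart_inv c z \<in> fst c" using that chart_inv_in by (simp add: U_def)
    then have ipp: "is_inner_product (metric M (chart_inv c z))"
      using riem chart_topspace(1) by (auto simp: riemannian_manifold_def)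
    note lin = tangent_of_linear[OF p] and bl = inner_product_bilinear[OF ipp]
    show ?thesis
      unfolding bilinear_def G_def
      by (auto intro!: linearI simp: linear_add[OF lin] linear_scale[OF lin] bilinear_ladd[OF bl]
          bilinear_radd[OF bl] bilinear_lmul[OF bl] bilinear_rmul[OF bl])
  qed
  have z0: "chart_inv c z0 = x" by (rule chart_inv_left[OF xc])
  define h where "h z = (\<Sum>(i,j)\<in>Basis \<times> Basis. \<bar>G z i j - G z0 i j\<bar>)" for z
  have G_expand: "G z u u = (\<Sum>(i,j)\<in>Basis \<times> Basis. (u \<bullet> i) * (u \<bullet> j) * G z i j)" if "z \<in> U" for z u
  proof -
    have "G z u u = G z (\<Sum>i\<in>Basis. (u \<bullet> i) *\<^sub>R i) (\<Sum>j\<in>Basis. (u \<bullet> j) *\<^sub>R j)" by (simp add: euclidean_representation)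
    also have "\<dots> = (\<Sum>(i,j)\<in>Basis \<times> Basis. G z ((u \<bullet> i) *\<^sub>R i) ((u \<bullet> j) *\<^sub>R j))"
      by (rule bilinear_sum[OF bil[OF that]])
    finally show ?thesis
      by (simp add: bilinear_lmul[OF bil[OF that]] bilinear_rmul[OF bil[OF that]] mult_ac)
  qed
  have pert: "\<bar>G z u u - G z0 u u\<bar> \<le> h z * (norm u)\<^sup>2" if "z \<in> U" for z u
  proof -
    have "G z u u - G z0 u u = (\<Sum>(i,j)\<in>Basis \<times> Basis. (u \<bullet> i) * (u \<bullet> j) * (G z i j - G z0 i j))"
      unfolding G_expand[OF that] G_expand[OF U(2)]
      by (simp add: sum_subtractf[symmetric] case_prod_beta right_diff_distrib)
    also have "\<bar>\<dots>\<bar> \<le> (\<Sum>(i,j)\<in>Basis \<times> Basis. \<bar>G z i j - G z0 i j\<bar> * (norm u)\<^sup>2)"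
    proof (rule order_trans[OF sum_abs], rule sum_mono, clarify)
      fix i j :: 'e assume ij: "i \<in> Basis" "j \<in> Basis"
      have "\<bar>(u \<bullet> i) * (u \<bullet> j)\<bar> \<le> norm u * norm u"
        unfolding abs_mult using ij by (intro mult_mono Basis_le_norm) auto
      then show "\<bar>(u \<bullet> i) * (u \<bullet> j) * (G z i j - G z0 i j)\<bar> \<le> \<bar>G z i j - G z0 i j\<bar> * (norm u)\<^sup>2"
        unfolding abs_mult[of "(u \<bullet> i) * (u \<bullet> j)"] power2_eq_square
        by (metis abs_ge_zero mult.commute mult_right_mono)
    qed
    finally show ?thesis by (simp add: h_def sum_distrib_right case_prod_beta)
  qed
  have "continuous_on U h"
    unfolding h_def case_prod_beta by (intro continuous_intros contG)
  moreover have "h z0 = 0" by (simp add: h_def case_prod_beta)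
  moreover obtain C where C: "C > 0" "\<And>u. norm u \<le> C * ip_norm (metric M x) u"
      "\<And>u. ip_norm (metric M x) u \<le> C * norm u"
    using inner_product_norm_equivalence[OF ip_x] by metis
  \<comment> \<open>Half of a lower bound for the quadratic form at \<open>x\<close> on the unit sphere.\<close>
  define e where "e = 1 / (2 * C\<^sup>2)"
  have "e > 0" using C(1) by (simp add: e_def)
  ultimately have "open (U \<inter> h -` ball 0 e)" "z0 \<in> U \<inter> h -` ball 0 e"
    using U by (auto intro!: continuous_open_preimage)
  then obtain r where r: "r > 0" "cball z0 r \<subseteq> U \<inter> h -` ball 0 e" using open_contains_cball by blast
  have G0: "G z0 u u = (ip_norm (metric M x) u)\<^sup>2" for u
    by (simp add: G_def z0 tangent_of_identity ip_norm_sq[OF ip_x])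
  have lower0: "(norm u)\<^sup>2 / C\<^sup>2 \<le> G z0 u u" for u
  proof -
    have "(norm u)\<^sup>2 \<le> (C * ip_norm (metric M x) u)\<^sup>2" using C(2) by (simp add: power_mono)
    then show ?thesis using C(1) by (simp add: G0 power_mult_distrib field_simps)
  qed
  have upper0: "G z0 u u \<le> C\<^sup>2 * (norm u)\<^sup>2" for u
  proof -
    have "(ip_norm (metric M x) u)\<^sup>2 \<le> (C * norm u)\<^sup>2"
      using C(3) ip_norm_nonneg[OF ip_x] by (intro power_mono)
    then show ?thesis by (simp add: G0 power_mult_distrib)
  qed
  have near: "\<bar>G z u u - G z0 u u\<bar> \<le> e * (norm u)\<^sup>2" if "z \<in> cball z0 r" for z u
  proof -
    have "z \<in> U" "\<bar>h z\<bar> < e" using r(2) that by (auto simp: dist_norm)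
    have "h z * (norm u)\<^sup>2 \<le> e * (norm u)\<^sup>2" using \<open>\<bar>h z\<bar> < e\<close> by (intro mult_right_mono) auto
    then show ?thesis using pert[OF \<open>z \<in> U\<close>, of u] by linarith
  qed
  show ?thesis
  proof (rule that[OF r(1), of "sqrt e" "sqrt (C\<^sup>2 + e)"])
    show "sqrt e > 0" "sqrt (C\<^sup>2 + e) > 0" using \<open>e > 0\<close> by (auto simp: add_nonneg_pos)
    show "cball z0 r \<subseteq> snd c ` fst c" using r(2) by (auto simp: U_def)
    fix z u :: 'e assume z: "z \<in> cball z0 r"
    have "(norm u)\<^sup>2 / C\<^sup>2 = e * (norm u)\<^sup>2 + e * (norm u)\<^sup>2" by (simp add: e_def field_simps)
    then have "e * (norm u)\<^sup>2 \<le> G z u u" using near[OF z, of u] lower0[of u] by linarith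
    then have "sqrt (e * (norm u)\<^sup>2) \<le> speed z u" unfolding speed by (rule real_sqrt_le_mono)
    then show "sqrt e * norm u \<le> speed z u" by (simp add: real_sqrt_mult)
    have "G z u u \<le> (C\<^sup>2 + e) * (norm u)\<^sup>2"
      using near[OF z, of u] upper0[of u] by (simp add: distrib_right)
    then have "speed z u \<le> sqrt ((C\<^sup>2 + e) * (norm u)\<^sup>2)" unfolding speed by (rule real_sqrt_le_mono)
    then show "speed z u \<le> sqrt (C\<^sup>2 + e) * norm u" by (simp add: real_sqrt_mult)
  qed
qed

lemma velocity_norm:
  assumes "pathin (mtop M) \<gamma>" "0 < t" "t < 1" "\<gamma> t \<in> fst c"
    and "((snd c \<circ> \<gamma>) has_vector_derivative w) (at t)"
  shows "ip_norm (metric M (\<gamma> t)) (velocity M \<gamma> t) = speed (snd c (\<gamma> t)) w"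
  using velocity_in_chart[OF assms] by (simp add: speed_def chart_inv_left[OF assms(4)])

subsection \<open>Lengths of curves\<close>

lemma curve_length_le:
  assumes \<gamma>: "pathin (mtop M) \<gamma>" and L: "0 \<le> L"
    and in_chart: "\<And>t. 0 < t \<Longrightarrow> t < 1 \<Longrightarrow> \<gamma> t \<in> fst c"
    and der: "\<And>t. 0 < t \<Longrightarrow> t < 1 \<Longrightarrow> ((snd c \<circ> \<gamma>) has_vector_derivative w t) (at t)"
    and le: "\<And>t. 0 < t \<Longrightarrow> t < 1 \<Longrightarrow> speed (snd c (\<gamma> t)) (w t) \<le> L"
  shows "curve_length M \<gamma> \<le> ennreal L"
proof -
  have "curve_length M \<gamma> \<le> (\<integral>\<^sup>+t\<in>{0..1::real}. ennreal L \<partial>lborel)"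
    unfolding curve_length_def
  proof (rule nn_integral_mono_AE)
    show "AE t in lborel. ennreal (ip_norm (metric M (\<gamma> t)) (velocity M \<gamma> t)) * indicator {0..1} t
        \<le> ennreal L * indicator {0..1} t"
      using AE_lborel_singleton[of 0] AE_lborel_singleton[of "1::real"]
    proof eventually_elim
      case (elim t)
      show ?case
      proof (cases "0 < t \<and> t < 1")
        case True
        then have "ip_norm (metric M (\<gamma> t)) (velocity M \<gamma> t) = speed (snd c (\<gamma> t)) (w t)"
          by (intro velocity_norm \<gamma> in_chart der) auto
        then show ?thesis using le[of t] True by (simp add: ennreal_leI)
      next
        case False
        then have "t \<notin> {0..1}" using elim by auto
        then show ?thesis by simp
      qed
    qed
  qed
  also have "\<dots> = ennreal L" by (simp add: nn_integral_cmult)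
  finally show ?thesis .
qed

text \<open>The derivative is continuous off a finite set but may be unbounded near its points, so the right side can be
  infinite. If it is finite, then the derivative is Lebesgue integrable and the gauge integral of the
  fundamental theorem is a Lebesgue integral.\<close>

lemma norm_displacement_le_nn_integral:
  fixes \<sigma> :: "real \<Rightarrow> 'v::euclidean_space"
  assumes "0 \<le> T" "continuous_on {0..T} \<sigma>" "finite A"
    and der: "\<And>t. t \<in> {0..T} - A \<Longrightarrow> (\<sigma> has_vector_derivative D t) (at t)"
    and cont: "continuous_on ({0..T} - A) D"
  shows "ennreal (norm (\<sigma> T - \<sigma> 0)) \<le> (\<integral>\<^sup>+t. ennreal (norm (indicator ({0..T} - A) t *\<^sub>R D t)) \<partial>lborel)"
proof -
  define E where "E t = indicator ({0..T} - A) t *\<^sub>R D t" for t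
  have "{0..T} - A \<in> sets borel" using \<open>finite A\<close> by (intro sets.Diff) (auto intro: borel_closed finite_imp_closed)
  then have meas: "E \<in> borel_measurable lborel"
    unfolding E_def using borel_measurable_continuous_on_indicator[OF _ cont] by simp
  have "(D has_integral (\<sigma> T - \<sigma> 0)) {0..T}"
    by (rule fundamental_theorem_of_calculus_interior_strong[OF \<open>finite A\<close> assms(1) _ assms(2)]) (auto intro: der)
  then have "(E has_integral (\<sigma> T - \<sigma> 0)) {0..T}"
    by (rule has_integral_spike_finite[OF \<open>finite A\<close>, rotated]) (auto simp: E_def)
  then have E: "(E has_integral (\<sigma> T - \<sigma> 0)) UNIV"
    unfolding has_integral_restrict_UNIV[symmetric, of E]
    by (rule has_integral_eq[rotated]) (auto simp: E_def)
  show ?thesis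
  proof (cases "(\<integral>\<^sup>+t. ennreal (norm (E t)) \<partial>lborel) = \<infinity>")
    case False
    then have int: "integrable lborel E"
      by (intro integrableI_bounded meas) (simp add: top.not_eq_extremum)
    have "integral\<^sup>L lborel E = \<sigma> T - \<sigma> 0"
      using has_integral_unique[OF has_integral_integral_lborel[OF int] E] .
    then show ?thesis using integral_norm_bound_ennreal[OF int] by (simp add: E_def)
  qed (simp add: E_def)
qed

lemma curve_length_ge:
  assumes \<gamma>: "pathin (mtop M) \<gamma>" "piecewise_C1_curve M \<gamma>" and T: "0 \<le> T" "T \<le> 1"
    and in_chart: "\<gamma> ` {0..T} \<subseteq> fst c" and k: "0 \<le> k"
    and le: "\<And>t u. t \<in> {0..T} \<Longrightarrow> k * norm u \<le> speed (snd c (\<gamma> t)) u"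
  shows "ennreal (k * norm (snd c (\<gamma> T) - snd c (\<gamma> 0))) \<le> curve_length M \<gamma>"
proof -
  have "(snd c \<circ> \<gamma>) piecewise_C1_differentiable_on {0..T}"
    using \<gamma>(2) c_atlas T in_chart unfolding piecewise_C1_curve_def by blast
  then obtain A D where A: "finite A" "continuous_on {0..T} (snd c \<circ> \<gamma>)"
    and D: "\<And>t. t \<in> {0..T} - A \<Longrightarrow> ((snd c \<circ> \<gamma>) has_vector_derivative D t) (at t)"
      "continuous_on ({0..T} - A) D"
    unfolding piecewise_C1_differentiable_on_def C1_differentiable_on_def by blast
  define E where "E t = indicator ({0..T} - A) t *\<^sub>R D t" for t
  have "ennreal (norm (snd c (\<gamma> T) - snd c (\<gamma> 0))) \<le> (\<integral>\<^sup>+t. ennreal (norm (E t)) \<partial>lborel)"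
    using norm_displacement_le_nn_integral[OF T(1) A(2,1) D] by (simp add: E_def)
  then have "ennreal k * ennreal (norm (snd c (\<gamma> T) - snd c (\<gamma> 0))) \<le> ennreal k * (\<integral>\<^sup>+t. ennreal (norm (E t)) \<partial>lborel)"
    by (rule mult_left_mono) simp
  also have "\<dots> = (\<integral>\<^sup>+t. ennreal k * ennreal (norm (E t)) \<partial>lborel)"
  proof (rule nn_integral_cmult[symmetric])
    have "{0..T} - A \<in> sets borel" using A(1) by (intro sets.Diff) (auto intro: borel_closed finite_imp_closed)
    then have "E \<in> borel_measurable lborel"
      unfolding E_def using borel_measurable_continuous_on_indicator[OF _ D(2)] by simp
    then show "(\<lambda>t. ennreal (norm (E t))) \<in> borel_measurable lborel" by measurable
  qed
  also have "\<dots> \<le> curve_length M \<gamma>"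
    unfolding curve_length_def
  proof (rule nn_integral_mono_AE)
    show "AE t in lborel. ennreal k * ennreal (norm (E t))
        \<le> ennreal (ip_norm (metric M (\<gamma> t)) (velocity M \<gamma> t)) * indicator {0..1} t"
      using AE_lborel_singleton[of 0] AE_lborel_singleton[of "1::real"]
    proof eventually_elim
      case (elim t)
      show ?case
      proof (cases "t \<in> {0..T} - A")
        case True
        then have t: "0 < t" "t < 1" "\<gamma> t \<in> fst c" using elim T in_chart by auto
        have "ip_norm (metric M (\<gamma> t)) (velocity M \<gamma> t) = speed (snd c (\<gamma> t)) (D t)"
          by (rule velocity_norm[OF \<gamma>(1) t D(1)[OF True]])
        moreover have "k * norm (D t) \<le> speed (snd c (\<gamma> t)) (D t)" using le True by blast
        ultimately show ?thesis
          using t k True by (simp add: E_def ennreal_mult[symmetric] ennreal_leI)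
      qed (simp add: E_def)
    qed
  qed
  finally show ?thesis using k by (simp add: ennreal_mult)
qed

text \<open>A curve starting in the inner half of a chart ball either stays in the ball or has to cross
  the shell around the inner half before its first exit. Compact sets of a Hausdorff space are closed,
  so at the exit time the curve is still in the chart, on the boundary sphere.\<close>

lemma curve_length_ge_local:
  assumes r: "0 < r" "cball z0 r \<subseteq> snd c ` fst c" and k: "0 \<le> k"
    and le: "\<And>z u. z \<in> cball z0 r \<Longrightarrow> k * norm u \<le> speed z u"
    and \<gamma>: "piecewise_C1_curve M \<gamma>" and start: "\<gamma> 0 \<in> fst c" "snd c (\<gamma> 0) \<in> ball z0 (r / 2)"
    and L: "L \<le> r / 2"
      "\<gamma> 1 \<in> fst c \<Longrightarrow> snd c (\<gamma> 1) \<in> ball z0 r \<Longrightarrow> L \<le> norm (snd c (\<gamma> 1) - snd c (\<gamma> 0))"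
  shows "ennreal (k * L) \<le> curve_length M \<gamma>"
proof -
  have path: "pathin (mtop M) \<gamma>" using \<gamma> by (simp add: piecewise_C1_curve_def)
  define U where "U = fst c \<inter> snd c -` ball z0 r"
  define K where "K = fst c \<inter> snd c -` cball z0 r"
  have U: "openin (mtop M) U" unfolding U_def by (rule openin_chart_vimage) simp
  have K: "closedin (mtop M) K" unfolding K_def by (rule closedin_chart_inv_compact[OF compact_cball r(2)])
  have start_U: "\<gamma> 0 \<in> U" using start r(1) by (auto simp: U_def)
  have "\<exists>T. 0 \<le> T \<and> T \<le> 1 \<and> \<gamma> ` {0..T} \<subseteq> K \<and> L \<le> norm (snd c (\<gamma> T) - snd c (\<gamma> 0))"
  proof (cases "\<gamma> ` {0..1} \<subseteq> U")
    case True
    then have "\<gamma> 1 \<in> U" by auto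
    then have "L \<le> norm (snd c (\<gamma> 1) - snd c (\<gamma> 0))" using L(2) by (simp add: U_def)
    moreover have "\<gamma> ` {0..1} \<subseteq> K" using True by (auto simp: U_def K_def)
    ultimately show ?thesis by (intro exI[of _ 1]) auto
  next
    case False
    define E where "E = {t \<in> {0..1}. \<gamma> t \<notin> U}"
    define T where "T = Inf E"
    have "E \<noteq> {}" using False by (auto simp: E_def)
    have bdd: "bdd_below E" by (rule bdd_belowI[of _ 0]) (auto simp: E_def)
    have "openin (top_of_set {0..1}) {t \<in> {0..1}. \<gamma> t \<in> U}"
      using openin_continuous_map_preimage[OF path[unfolded pathin_def] U] by simp
    then have "closedin (top_of_set {0..1}) ({0..1} - {t \<in> {0..1}. \<gamma> t \<in> U})" by (simp add: closedin_diff)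
    moreover have "{0..1} - {t \<in> {0..1}. \<gamma> t \<in> U} = E" by (auto simp: E_def)
    ultimately have "closed E" by (metis closed_atLeastAtMost closedin_closed_eq)
    then have "T \<in> E" unfolding T_def by (rule closed_contains_Inf[OF \<open>E \<noteq> {}\<close> bdd])
    then have T: "0 \<le> T" "T \<le> 1" "\<gamma> T \<notin> U" by (auto simp: E_def)
    then have "0 < T" using start_U by (cases "T = 0") auto
    have before: "\<gamma> t \<in> U" if "t \<in> {0..<T}" for t
    proof (rule ccontr)
      assume "\<gamma> t \<notin> U"
      then have "t \<in> E" using that T by (auto simp: E_def)
      then have "T \<le> t" unfolding T_def by (rule cInf_lower[OF _ bdd])
      then show False using that by simp
    qed
    have "closedin (top_of_set {0..1}) {t \<in> {0..1}. \<gamma> t \<in> K}"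
      using closedin_continuous_map_preimage[OF path[unfolded pathin_def] K] by simp
    then have "closed {t \<in> {0..1}. \<gamma> t \<in> K}" using closed_atLeastAtMost closedin_closed_eq by blast
    moreover have "{0..<T} \<subseteq> {t \<in> {0..1}. \<gamma> t \<in> K}" using before T by (force simp: U_def K_def)
    ultimately have "closure {0..<T} \<subseteq> {t \<in> {0..1}. \<gamma> t \<in> K}" by (rule closure_minimal[rotated])
    then have inK: "\<gamma> ` {0..T} \<subseteq> K" using \<open>0 < T\<close> by (auto simp: closure_atLeastLessThan)
    then have "\<gamma> T \<in> K" using T by auto
    then have "dist z0 (snd c (\<gamma> T)) = r" using T(3) by (auto simp: U_def K_def)
    then have "r / 2 \<le> norm (snd c (\<gamma> T) - snd c (\<gamma> 0))"
      using start(2) dist_triangle[of z0 "snd c (\<gamma> T)" "snd c (\<gamma> 0)"] by (simp add: dist_norm norm_minus_commute)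
    then show ?thesis using T inK L(1) by (intro exI[of _ T]) auto
  qed
  then obtain T where T: "0 \<le> T" "T \<le> 1" "\<gamma> ` {0..T} \<subseteq> K" "L \<le> norm (snd c (\<gamma> T) - snd c (\<gamma> 0))" by blast
  have "ennreal (k * L) \<le> ennreal (k * norm (snd c (\<gamma> T) - snd c (\<gamma> 0)))"
    using T(4) k by (intro ennreal_leI mult_left_mono)
  also have "\<dots> \<le> curve_length M \<gamma>"
  proof (rule curve_length_ge[OF path \<gamma> T(1,2) _ k])
    show "\<gamma> ` {0..T} \<subseteq> fst c" using T(3) by (auto simp: K_def)
    show "k * norm u \<le> speed (snd c (\<gamma> t)) u" if "t \<in> {0..T}" for t u
    proof -
      have "\<gamma> t \<in> K" using T(3) that by blast
      then show ?thesis by (intro le) (simp add: K_def)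
    qed
  qed
  finally show ?thesis .
qed

end

subsection \<open>Distances in retraction coordinates\<close>

text \<open>Continuity is a local matter, and near each point it is that of a coordinate expression.\<close>

lemma (in smooth_manifold_chart) continuous_map_smooth_into:
  assumes F: "smooth_into M S F" and "open S"
  shows "continuous_map (top_of_set S) (mtop M) F"
  unfolding continuous_map_openin_preimage_eq
proof (intro conjI allI impI)
  show "F \<in> topspace (top_of_set S) \<rightarrow> topspace (mtop M)" using F by (auto simp: smooth_into_def)
  fix U assume U: "openin (mtop M) U"
  have "open (S \<inter> F -` U)"
  proof (rule Topological_Spaces.openI)
    fix \<xi> assume \<xi>: "\<xi> \<in> S \<inter> F -` U"
    define d where "d = chart_at M (F \<xi>)"
    have "F \<xi> \<in> topspace (mtop M)" using F \<xi> by (auto simp: smooth_into_def)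
    then have d: "d \<in> atlas M" "F \<xi> \<in> fst d" using chart_at_atlas by (auto simp: d_def)
    interpret d: smooth_manifold_chart M d using manifold d(1) by unfold_locales
    have open_dom: "open (S \<inter> F -` fst d)" and sm: "smooth_on (S \<inter> F -` fst d) (snd d \<circ> F)"
      using F d(1) by (auto simp: smooth_into_def)
    have "open (snd d ` (U \<inter> fst d))"
      by (rule d.open_chart_image) (auto intro: openin_Int U d.chart_homeomorphic(1))
    then have op: "open ((S \<inter> F -` fst d) \<inter> (snd d \<circ> F) -` (snd d ` (U \<inter> fst d)))"
      by (rule continuous_open_preimage[OF smooth_on_continuous[OF sm] open_dom])
    have "(S \<inter> F -` fst d) \<inter> (snd d \<circ> F) -` (snd d ` (U \<inter> fst d)) \<subseteq> S \<inter> F -` U"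
      using d.chart_inj by (auto dest: inj_onD)
    moreover have "\<xi> \<in> (S \<inter> F -` fst d) \<inter> (snd d \<circ> F) -` (snd d ` (U \<inter> fst d))" using \<xi> d(2) by auto
    ultimately show "\<exists>T. open T \<and> \<xi> \<in> T \<and> T \<subseteq> S \<inter> F -` U" using op by blast
  qed
  then show "openin (top_of_set S) (topspace (top_of_set S) \<inter> F -` U)"
    using \<open>open S\<close> by (simp add: openin_open_eq)
qed

context riemannian_point
begin

text \<open>The image of the segment from \<open>\<xi>\<close> to \<open>\<xi>'\<close> has speed at most a constant times \<open>|\<xi> - \<xi>'|\<close>, as long as it stays in
  the part of the chart where the metric is comparable with the Euclidean norm.\<close>

lemma riem_dist_smooth_upper:
  assumes S: "open S" "0 \<in> S" and F: "smooth_into M S F" and F0: "F 0 = x"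
  obtains r C where "r > 0" "C \<ge> 0" "cball 0 r \<subseteq> S"
    "\<And>\<xi> \<xi>'. \<xi> \<in> cball 0 r \<Longrightarrow> \<xi>' \<in> cball 0 r \<Longrightarrow>
      riem_dist M (F \<xi>) (F \<xi>') \<le> ennreal (C * norm (\<xi> - \<xi>' :: 'e))"
proof -
  obtain r0 k K where r0: "r0 > 0" "K > 0" and K: "\<And>z u. z \<in> cball z0 r0 \<Longrightarrow> speed z u \<le> K * norm u"
    using speed_bounds by metis
  define H where "H = snd c \<circ> F"
  define S1 where "S1 = S \<inter> F -` fst c"
  have S1: "open S1" and sm: "smooth_on S1 H" using F c_atlas by (auto simp: smooth_into_def S1_def H_def)
  define S2 where "S2 = S1 \<inter> H -` ball z0 r0"
  have "open S2" unfolding S2_def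
    by (rule continuous_open_preimage[OF smooth_on_continuous[OF sm] S1]) simp
  have "0 \<in> S2" using S F0 xc r0 by (simp add: S2_def S1_def H_def)
  have der: "(H has_derivative frechet_derivative H (at \<xi>)) (at \<xi>)" if "\<xi> \<in> S2" for \<xi>
    by (rule smooth_on_derivative[OF sm]) (use that in \<open>simp add: S2_def\<close>)
  have cont: "continuous_on S2 (\<lambda>\<xi>. frechet_derivative H (at \<xi>) u)" for u
    by (rule continuous_on_subset[OF smooth_on_continuous_derivative[OF sm]]) (auto simp: S2_def)
  obtain r L where r: "r > 0" "L \<ge> 0" "cball 0 r \<subseteq> S2"
    and L: "\<And>\<xi> u. \<xi> \<in> cball 0 r \<Longrightarrow> norm (frechet_derivative H (at \<xi>) u) \<le> L * norm u"
    using C1_locally_lipschitz[OF \<open>open S2\<close> \<open>0 \<in> S2\<close> der cont] by metis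
  have rS: "cball 0 r \<subseteq> S" using r(3) by (auto simp: S2_def S1_def)
  show ?thesis
  proof (rule that[OF r(1) _ rS, of "K * L"])
    show "0 \<le> K * L" using r0 r by simp
    fix \<xi> \<xi>' :: 'e assume \<xi>: "\<xi> \<in> cball 0 r" "\<xi>' \<in> cball 0 r"
    define d where "d = \<xi>' - \<xi>"
    define line where "line t = \<xi> + t *\<^sub>R d" for t
    define \<gamma> where "\<gamma> = F \<circ> line"
    have line: "line t \<in> cball 0 r" if "t \<in> {0..1}" for t
    proof -
      have "line t = (1 - t) *\<^sub>R \<xi> + t *\<^sub>R \<xi>'" by (simp add: line_def d_def algebra_simps)
      moreover have "(1 - t) *\<^sub>R \<xi> + t *\<^sub>R \<xi>' \<in> cball 0 r"
        by (rule convexD[OF convex_cball \<xi>]) (use that in auto)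
      ultimately show ?thesis by simp
    qed
    have cont_line: "continuous_on A line" for A unfolding line_def by (intro continuous_intros)
    have line_der: "(line has_vector_derivative d) (at t within A)" for t A
      unfolding line_def by (auto intro!: derivative_eq_intros simp: has_vector_derivative_def)
    have comp_der: "((h \<circ> line) has_vector_derivative frechet_derivative h (at (line t)) d) (at t)"
      if "smooth_on A h" "line t \<in> A" for A t and h :: "'e \<Rightarrow> 'e"
      by (rule vector_derivative_diff_chain_within[OF line_der has_derivative_at_withinI[OF smooth_on_derivative[OF that]]])
    have path: "pathin (mtop M) \<gamma>"
      unfolding pathin_def \<gamma>_def
    proof (rule continuous_map_compose[OF _ continuous_map_smooth_into[OF F S(1)]])
      show "continuous_map (top_of_set {0..1}) (top_of_set S) line"
        using line rS cont_line by (auto simp: continuous_map_in_subtopology)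
    qed
    have C1: "piecewise_C1_curve M \<gamma>"
      unfolding piecewise_C1_curve_def
    proof (intro conjI ballI allI impI path)
      fix e a b assume e: "e \<in> atlas M" and ab: "0 \<le> a \<and> a \<le> b \<and> b \<le> 1 \<and> \<gamma> ` {a..b} \<subseteq> fst e"
      define A where "A = S \<inter> F -` fst e"
      have sme: "smooth_on A (snd e \<circ> F)" using F e by (simp add: smooth_into_def A_def)
      have inA: "line ` {a..b} \<subseteq> A" using ab line rS by (force simp: A_def \<gamma>_def)
      have "(snd e \<circ> \<gamma>) C1_differentiable_on {a..b}"
        unfolding C1_differentiable_on_def
      proof (intro exI conjI ballI)
        show "(snd e \<circ> \<gamma> has_vector_derivative frechet_derivative (snd e \<circ> F) (at (line t)) d) (at t)"
          if "t \<in> {a..b}" for t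
        proof -
          have "line t \<in> A" using inA that by blast
          from comp_der[OF sme this] show ?thesis by (simp add: \<gamma>_def o_assoc)
        qed
        show "continuous_on {a..b} (\<lambda>t. frechet_derivative (snd e \<circ> F) (at (line t)) d)"
          by (rule continuous_on_compose2[OF smooth_on_continuous_derivative[OF sme] cont_line inA])
      qed
      then show "(snd e \<circ> \<gamma>) piecewise_C1_differentiable_on {a..b}"
        by (rule C1_differentiable_imp_piecewise)
    qed
    have "riem_dist M (F \<xi>) (F \<xi>') \<le> curve_length M \<gamma>"
      unfolding riem_dist_def
      by (rule INF_lower) (use C1 in \<open>simp add: \<gamma>_def line_def d_def\<close>)
    also have "\<dots> \<le> ennreal (K * (L * norm d))"
    proof (rule curve_length_le[OF path])
      show "0 \<le> K * (L * norm d)" using r0 r by simp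
      fix t :: real assume t: "0 < t" "t < 1"
      then have lt: "line t \<in> S2" "line t \<in> cball 0 r" using line[of t] r(3) by auto
      then have in_dom: "\<gamma> t \<in> fst c" "snd c (\<gamma> t) \<in> cball z0 r0"
        by (auto simp: \<gamma>_def S2_def S1_def H_def)
      then show "\<gamma> t \<in> fst c" by simp
      show "((snd c \<circ> \<gamma>) has_vector_derivative frechet_derivative H (at (line t)) d) (at t)"
        using comp_der[OF sm, of t] lt by (simp add: S2_def \<gamma>_def H_def o_assoc)
      have "speed (snd c (\<gamma> t)) (frechet_derivative H (at (line t)) d) \<le> K * norm (frechet_derivative H (at (line t)) d)"
        by (rule K[OF in_dom(2)])
      also have "\<dots> \<le> K * (L * norm d)" using L[OF lt(2)] r0 by (intro mult_left_mono) auto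
      finally show "speed (snd c (\<gamma> t)) (frechet_derivative H (at (line t)) d) \<le> K * (L * norm d)" .
    qed
    finally show "riem_dist M (F \<xi>) (F \<xi>') \<le> ennreal (K * L * norm (\<xi> - \<xi>'))"
      by (simp add: d_def norm_minus_commute mult.assoc)
  qed
qed

text \<open>In chart coordinates this is the local length estimate; the inverse of the diffeomorphism is Lipschitz there and
  carries the estimate to \<open>\<xi>\<close>-coordinates. The bound is truncated because nothing is known about the second
  point, which may lie outside of the chart.\<close>

lemma riem_dist_diffeo_lower:
  assumes F: "diffeo_onto_image M S F" and S: "0 \<in> S" "S \<subseteq> B" and F0: "F 0 = x" and inj: "inj_on F B"
  obtains r k where "r > 0" "k > 0"
    "\<And>\<xi> \<xi>'. \<xi> \<in> ball 0 r \<Longrightarrow> \<xi>' \<in> B \<Longrightarrow>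
      ennreal (k * min (norm (\<xi> - \<xi>' :: 'e)) r) \<le> riem_dist M (F \<xi>) (F \<xi>')"
proof -
  obtain r0 k0 K where r0: "r0 > 0" "k0 > 0" "cball z0 r0 \<subseteq> snd c ` fst c"
    and k0: "\<And>z u. z \<in> cball z0 r0 \<Longrightarrow> k0 * norm u \<le> speed z u"
    using speed_bounds by metis
  have into: "smooth_into M S F" and openFS: "openin (mtop M) (F ` S)"
    and sm_inv: "smooth_on (snd c ` (fst c \<inter> F ` S)) (inv_into S F \<circ> chart_inv c)"
    using F c_atlas by (auto simp: diffeo_onto_image_def)
  define Q where "Q = snd c ` (fst c \<inter> F ` S)"
  define J where "J = inv_into S F \<circ> chart_inv c"
  have sm_J: "smooth_on Q J" using sm_inv by (simp add: Q_def J_def)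
  have "open Q" unfolding Q_def
    by (rule open_chart_image) (auto intro: openin_Int openFS chart_homeomorphic(1))
  have "z0 \<in> Q" using xc F0 S by (force simp: Q_def)
  obtain r1 L where r1: "r1 > 0" "L \<ge> 0" "cball z0 r1 \<subseteq> Q"
    and L: "\<And>z z'. z \<in> cball z0 r1 \<Longrightarrow> z' \<in> cball z0 r1 \<Longrightarrow> norm (J z - J z') \<le> L * norm (z - z')"
    using C1_locally_lipschitz[OF \<open>open Q\<close> \<open>z0 \<in> Q\<close> smooth_on_derivative[OF sm_J] smooth_on_continuous_derivative[OF sm_J]]
    by metis
  define s where "s = min r0 r1"
  have s: "s > 0" "cball z0 s \<subseteq> cball z0 r0" "cball z0 s \<subseteq> cball z0 r1" using r0 r1 by (auto simp: s_def)
  have JF: "J (snd c (F \<xi>)) = \<xi>" if "F \<xi> \<in> fst c" "snd c (F \<xi>) \<in> cball z0 s" "\<xi> \<in> B" for \<xi>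
  proof -
    have "snd c (F \<xi>) \<in> Q" using that(2) s(3) r1(3) by blast
    then obtain \<xi>' where \<xi>': "\<xi>' \<in> S" "F \<xi>' \<in> fst c" "snd c (F \<xi>) = snd c (F \<xi>')" by (auto simp: Q_def)
    then have "F \<xi> = F \<xi>'" using chart_inj that(1) by (auto dest: inj_onD)
    then have "\<xi> = \<xi>'" using inj that(3) \<xi>'(1) S(2) by (auto dest: inj_onD)
    have "inj_on F S" using F by (simp add: diffeo_onto_image_def)
    then show ?thesis using \<xi>'(1) that(1) by (simp add: J_def chart_inv_left \<open>\<xi> = \<xi>'\<close>)
  qed
  define S1 where "S1 = S \<inter> F -` fst c"
  have S1: "open S1" and sm: "smooth_on S1 (snd c \<circ> F)"
    using into c_atlas by (auto simp: smooth_into_def S1_def)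
  have "open (S1 \<inter> (snd c \<circ> F) -` ball z0 (s / 2))"
    by (rule continuous_open_preimage[OF smooth_on_continuous[OF sm] S1]) simp
  moreover have "0 \<in> S1 \<inter> (snd c \<circ> F) -` ball z0 (s / 2)" using S F0 xc s(1) by (simp add: S1_def)
  ultimately obtain r where r: "r > 0" "ball 0 r \<subseteq> S1 \<inter> (snd c \<circ> F) -` ball z0 (s / 2)"
    using openE by blast
  \<comment> \<open>One factor for both regimes: untruncated in retraction coordinates, and the length needed to cross the shell.\<close>
  define k where "k = min (k0 / (L + 1)) (k0 * (s / 2) / r)"
  show ?thesis
  proof (rule that[OF r(1), of k])
    show "k > 0" using r0 r1 r s by (simp add: k_def add_nonneg_pos)
    fix \<xi> \<xi>' :: 'e assume \<xi>: "\<xi> \<in> ball 0 r" "\<xi>' \<in> B"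
    have start: "\<xi> \<in> S" "F \<xi> \<in> fst c" "snd c (F \<xi>) \<in> ball z0 (s / 2)" using \<xi>(1) r(2) by (auto simp: S1_def)
    define l where "l = min (norm (\<xi> - \<xi>') / (L + 1)) (s / 2)"
    have "k * min (norm (\<xi> - \<xi>')) r \<le> k0 * l"
    proof -
      have "k * min (norm (\<xi> - \<xi>')) r \<le> (k0 / (L + 1)) * norm (\<xi> - \<xi>')"
        using r0 r1 r s by (intro mult_mono) (auto simp: k_def)
      moreover have "k * min (norm (\<xi> - \<xi>')) r \<le> (k0 * (s / 2) / r) * r"
        using r0 r1 r s by (intro mult_mono) (auto simp: k_def)
      ultimately show ?thesis using r(1) by (simp add: l_def min_def)
    qed
    then have "ennreal (k * min (norm (\<xi> - \<xi>')) r) \<le> ennreal (k0 * l)" by (rule ennreal_leI)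
    also have "\<dots> \<le> riem_dist M (F \<xi>) (F \<xi>')"
      unfolding riem_dist_def
    proof (rule INF_greatest)
      fix \<gamma> assume "\<gamma> \<in> {\<gamma>. piecewise_C1_curve M \<gamma> \<and> \<gamma> 0 = F \<xi> \<and> \<gamma> 1 = F \<xi>'}"
      then have \<gamma>: "piecewise_C1_curve M \<gamma>" "\<gamma> 0 = F \<xi>" "\<gamma> 1 = F \<xi>'" by auto
      show "ennreal (k0 * l) \<le> curve_length M \<gamma>"
      proof (rule curve_length_ge_local[OF s(1) _ _ _ \<gamma>(1)])
        show "cball z0 s \<subseteq> snd c ` fst c" using s(2) r0(3) by blast
        show "0 \<le> k0" using r0 by simp
        show "\<And>z u. z \<in> cball z0 s \<Longrightarrow> k0 * norm u \<le> speed z u" using k0 s(2) by blast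
        show "\<gamma> 0 \<in> fst c" "snd c (\<gamma> 0) \<in> ball z0 (s / 2)" using start by (simp_all add: \<gamma>)
        show "l \<le> s / 2" unfolding l_def by (rule min.cobounded2)
        assume fin: "\<gamma> 1 \<in> fst c" "snd c (\<gamma> 1) \<in> ball z0 s"
        have in1: "snd c (F \<xi>) \<in> cball z0 s" "snd c (F \<xi>') \<in> cball z0 s" using start s(1) fin(2) by (auto simp: \<gamma>)
        have "J (snd c (F \<xi>)) = \<xi>" using JF start in1 S(2) by blast
        moreover have "J (snd c (F \<xi>')) = \<xi>'" using JF \<xi>(2) in1(2) fin(1) by (simp add: \<gamma>)
        ultimately have "norm (\<xi> - \<xi>') \<le> L * norm (snd c (F \<xi>) - snd c (F \<xi>'))"
          using L[OF subsetD[OF s(3) in1(1)] subsetD[OF s(3) in1(2)]] by simp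
        also have "\<dots> \<le> (L + 1) * norm (snd c (\<gamma> 1) - snd c (\<gamma> 0))"
          by (simp add: \<gamma> norm_minus_commute mult_right_mono)
        finally have "norm (\<xi> - \<xi>') / (L + 1) \<le> norm (snd c (\<gamma> 1) - snd c (\<gamma> 0))"
          using r1(2) by (simp add: field_simps)
        then show "l \<le> norm (snd c (\<gamma> 1) - snd c (\<gamma> 0))" unfolding l_def by (rule min.coboundedI1)
      qed
    qed
    finally show "ennreal (k * min (norm (\<xi> - \<xi>')) r) \<le> riem_dist M (F \<xi>) (F \<xi>')" .
  qed
qed

end

section \<open>The equivalence\<close>

lemma ereal_convex_on_transform:
  assumes "ereal_convex_on S h" and eq: "\<And>x. x \<in> S \<Longrightarrow> k x = h x"
  shows "ereal_convex_on S k"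
  unfolding ereal_convex_on_def
proof (intro conjI ballI allI impI)
  show "convex S" using assms(1) by (simp add: ereal_convex_on_def)
  fix x y and u v :: real assume xy: "x \<in> S" "y \<in> S" and uv: "0 \<le> u" "0 \<le> v" "u + v = 1"
  then have "u *\<^sub>R x + v *\<^sub>R y \<in> S" using \<open>convex S\<close> by (simp add: convexD)
  then show "k (u *\<^sub>R x + v *\<^sub>R y) \<le> ereal u * k x + ereal v * k y"
    using assms(1) xy uv by (simp add: eq ereal_convex_on_def)
qed

lemma open_tangent_ball:
  fixes M :: "('m, 'e::euclidean_space) riem"
  assumes "is_inner_product (metric M x)"
  shows "open (tangent_ball M x (ereal r))"
proof -
  interpret bounded_bilinear "metric M x" by (rule inner_product_bounded_bilinear[OF assms])
  have "continuous_on UNIV (ip_norm (metric M x))"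
    unfolding ip_norm_def[abs_def] by (intro continuous_intros continuous_on)
  from open_Collect_less[OF this continuous_on_const] show ?thesis
    by (simp add: tangent_ball_def)
qed

text \<open>The gradient and the adjoint represent linear functionals with respect to the metric; testing their sum against
  \<open>u\<close> removes the metric from the condition.\<close>

lemma KKT_stationary:
  fixes M :: "('m, 'e::euclidean_space) riem" and g :: "'m \<Rightarrow> 'y::euclidean_space"
  assumes riem: "riemannian_manifold M" and f: "C1_on_manifold M f" and g: "C1_on_manifold M g"
    and KKT: "KKT_pair M f g \<theta> x y"
  shows "mderiv M f x u + y \<bullet> mderiv M g x u = 0"
proof -
  have x: "x \<in> topspace (mtop M)" using KKT by (simp add: KKT_pair_def)
  interpret riemannian_point M x using riem x by unfold_locales
  have z0: "z0 \<in> snd c ` fst c" using xc by simp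
  have lin_f: "linear (mderiv M f x)" and lin_g: "linear (mderiv M g x)"
    using f g c_atlas z0 unfolding mderiv_def C1_on_manifold_def
    by (blast intro: has_derivative_linear Ck_on_1_derivative(1))+
  have THE_repr: "metric M x (THE v. \<forall>\<xi>. metric M x v \<xi> = k \<xi>) u = k u" if k: "linear k" for k u
  proof -
    have "\<exists>!v. \<forall>\<xi>. metric M x v \<xi> = k \<xi>"
      using inner_product_representation[OF ip_x k] inner_product_ext[OF ip_x] by metis
    from theI'[OF this] show ?thesis by blast
  qed
  have "linear (\<lambda>\<xi>. y \<bullet> mderiv M g x \<xi>)"
    by (rule linearI) (simp_all add: linear_add[OF lin_g] linear_scale[OF lin_g] inner_add_right)
  from THE_repr[OF this] THE_repr[OF lin_f]
  have "metric M x (mderiv_adjoint M g x y) u = y \<bullet> mderiv M g x u" "metric M x (mgrad M f x) u = mderiv M f x u"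
    by (simp_all add: mderiv_adjoint_def mgrad_def)
  moreover have "metric M x (mgrad M f x + mderiv_adjoint M g x y) u = 0"
    using KKT inner_product_bilinear[OF ip_x] by (simp add: KKT_pair_def bilinear_lzero)
  ultimately show ?thesis
    using inner_product_bilinear[OF ip_x] by (simp add: bilinear_ladd)
qed

theorem proposition8:
  fixes M :: "('m, 'e::euclidean_space) riem"
    and f :: "'m \<Rightarrow> real"
    and g :: "'m \<Rightarrow> 'y::euclidean_space"
    and \<theta> :: "'y \<Rightarrow> ereal"
    and R :: "'m \<Rightarrow> 'e \<Rightarrow> 'm"
    and xbar :: 'm and ybar :: 'y and \<rho> :: real
  assumes "riemannian_manifold M" and "connected_space (mtop M)"
    and "C1_on_manifold M f" and "C1_on_manifold M g"
    and "proper_fun \<theta>" and "\<forall>z. lsc_at \<theta> z" and "ereal_convex_on UNIV \<theta>"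
    and "KKT_pair M f g \<theta> xbar ybar"
    and "tangent_retraction M R"
    and "0 < \<rho>"
  shows "manifold_strong_variational_sufficiency M f g \<theta> R xbar ybar \<rho> \<longleftrightarrow>
         manifold_augmented_tilt_stability M f g \<theta> R xbar ybar \<rho>"
proof -
  have x: "xbar \<in> topspace (mtop M)" using assms(8) by (simp add: KKT_pair_def)
  interpret riemannian_point M xbar using assms(1) x by unfold_locales
  define ip where "ip = metric M xbar"
  have ip: "is_inner_product ip" using ip_x by (simp add: ip_def)
  define B where "B = retraction_ball M R xbar"
  define radii where "radii = {r. 0 < r \<and> diffeo_onto_image M (tangent_ball M xbar (ereal r)) (R xbar)}"
  have B: "B = tangent_ball M xbar (Sup (ereal ` radii))"
    unfolding B_def retraction_ball_def retraction_radius_def radii_def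
    by (simp add: image_Collect)
  show ?thesis
  proof (cases "radii = {}")
    case True
    \<comment> \<open>Then the ball of the retraction is empty and both sides fail.\<close>
    then have "B = {}" by (simp add: B tangent_ball_def bot_ereal_def)
    have "\<not> manifold_strong_variational_sufficiency M f g \<theta> R xbar ybar \<rho>"
      using \<open>B = {}\<close>
      by (simp add: manifold_strong_variational_sufficiency_def variationally_strongly_convex_def
          gph_subdiff_def subdiff_def phi_R_def B_def)
    moreover have "\<not> manifold_augmented_tilt_stability M f g \<theta> R xbar ybar \<rho>"
      using \<open>B = {}\<close> unfolding manifold_augmented_tilt_stability_def B_def
      by (metis empty_iff interior_subset subset_eq)
    ultimately show ?thesis by simp
  next
    case False
    then obtain r0 where r0: "0 < r0" "diffeo_onto_image M (tangent_ball M xbar (ereal r0)) (R xbar)"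
      by (auto simp: radii_def)
    define S0 where "S0 = tangent_ball M xbar (ereal r0)"
    have S0: "open S0" "0 \<in> S0" "S0 \<subseteq> B"
    proof -
      show "open S0" unfolding S0_def by (rule open_tangent_ball[OF ip_x])
      have "ip_norm (metric M xbar) 0 = 0" using ip_norm_scale[OF ip_x, of 0 0] by simp
      then show "0 \<in> S0" using r0 by (simp add: S0_def tangent_ball_def)
      have "ereal r0 \<le> Sup (ereal ` radii)" using r0 by (intro Sup_upper) (simp add: radii_def)
      then show "S0 \<subseteq> B"
        unfolding S0_def B tangent_ball_def by (auto intro: less_le_trans simp del: less_ereal.simps)
    qed
    have diffeo: "diffeo_onto_image M S0 (R xbar)" using r0 by (simp add: S0_def)
    have into: "smooth_into M S0 (R xbar)" using diffeo by (simp add: diffeo_onto_image_def)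
    have injB: "inj_on (R xbar) B"
    proof (rule inj_onI)
      fix \<xi> \<xi>' assume \<xi>: "\<xi> \<in> B" "\<xi>' \<in> B" and eq: "R xbar \<xi> = R xbar \<xi>'"
      define n where "n = max (ip_norm (metric M xbar) \<xi>) (ip_norm (metric M xbar) \<xi>')"
      have "ereal n < Sup (ereal ` radii)" using \<xi> by (auto simp: B tangent_ball_def n_def max_def)
      then obtain r where "r \<in> radii" "n < r" by (auto simp: less_Sup_iff)
      then have "\<xi> \<in> tangent_ball M xbar (ereal r)" "\<xi>' \<in> tangent_ball M xbar (ereal r)"
        and "inj_on (R xbar) (tangent_ball M xbar (ereal r))"
        by (auto simp: n_def tangent_ball_def radii_def diffeo_onto_image_def)
      then show "\<xi> = \<xi>'" using eq by (auto dest: inj_onD)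
    qed
    have inv: "retraction_inv M R xbar (R xbar \<xi>) = \<xi>" if "\<xi> \<in> B" for \<xi>
      using that injB by (simp add: retraction_inv_def B_def[symmetric])
    have R0: "R xbar 0 = xbar" and DR0: "((snd c \<circ> R xbar) has_derivative id) (at 0)"
      using assms(9) x by (auto simp: tangent_retraction_def)
    define S where "S = S0 \<inter> R xbar -` fst c"
    define H where "H = snd c \<circ> R xbar"
    have openS: "open S" and smH: "smooth_on S H"
      using into c_atlas by (auto simp: smooth_into_def S_def H_def)
    have zero_S: "0 \<in> S" and S_sub_B: "S \<subseteq> B" using S0 R0 xc by (auto simp: S_def)
    have HS: "H ` S \<subseteq> snd c ` fst c" by (auto simp: S_def H_def)
    have H0: "H 0 = z0" by (simp add: H_def R0)
    have DH0: "frechet_derivative H (at 0) u = u" for u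
      using frechet_derivative_at[OF DR0] by (metis H_def id_apply)
    have f1: "Ck_on 1 (snd c ` fst c) (f \<circ> chart_inv c)" and g1: "Ck_on 1 (snd c ` fst c) (g \<circ> chart_inv c)"
      using assms(3,4) c_atlas unfolding C1_on_manifold_def by blast+
    define DF where "DF \<xi> u = frechet_derivative (f \<circ> chart_inv c) (at (H \<xi>)) (frechet_derivative H (at \<xi>) u)" for \<xi> u
    define DG where "DG \<xi> u = frechet_derivative (g \<circ> chart_inv c) (at (H \<xi>)) (frechet_derivative H (at \<xi>) u)" for \<xi> u
    have R_chart: "chart_inv c (H \<xi>) = R xbar \<xi>" if "\<xi> \<in> S" for \<xi>
      using that by (simp add: H_def S_def chart_inv_left)
    interpret local_composite ip B S "f \<circ> R xbar" "g \<circ> R xbar" DF DG \<theta> \<rho> ybar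
    proof
      show "is_inner_product ip" "open S" "0 \<in> S" "S \<subseteq> B" "proper_fun \<theta>" "ereal_convex_on UNIV \<theta>" "0 < \<rho>"
        by fact+
      show "lsc_at \<theta> z" for z using assms(6) by blast
      show "((f \<circ> R xbar) has_derivative DF \<xi>) (at \<xi>)" if "\<xi> \<in> S" for \<xi>
        using C1_pullback(1)[OF f1 smH HS that, folded DF_def]
        by (rule has_derivative_transform_within_open[OF _ openS that]) (simp add: R_chart)
      show "((g \<circ> R xbar) has_derivative DG \<xi>) (at \<xi>)" if "\<xi> \<in> S" for \<xi>
        using C1_pullback(1)[OF g1 smH HS that, folded DG_def]
        by (rule has_derivative_transform_within_open[OF _ openS that]) (simp add: R_chart)
      show "continuous_on S (\<lambda>\<xi>. DF \<xi> u)" for u unfolding DF_def by (rule C1_pullback(2)[OF f1 smH HS])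
      show "continuous_on S (\<lambda>\<xi>. DG \<xi> u)" for u unfolding DG_def by (rule C1_pullback(2)[OF g1 smH HS])
      show "ybar \<in> subdiff (\<bullet>) \<theta> ((g \<circ> R xbar) 0)" using assms(8) by (simp add: KKT_pair_def R0)
      show "DF 0 u + ybar \<bullet> DG 0 u = 0" for u
        using KKT_stationary[OF assms(1,3,4,8), of u] by (simp add: DF_def DG_def H0 DH0 mderiv_def)
    qed
    have phi: "(\<lambda>(\<xi>, b). phi_R M f g \<theta> R xbar \<rho> \<xi> b) = \<phi>"
      by (auto simp: fun_eq_iff \<phi>_def phi_R_def phi_def B_def[symmetric])
    have sufficiency: "manifold_strong_variational_sufficiency M f g \<theta> R xbar ybar \<rho> \<longleftrightarrow>
        variationally_strongly_convex (prod_ip ip) \<phi> (0, 0) (0, ybar)"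
      by (simp add: manifold_strong_variational_sufficiency_def phi ip_def)
    have lag_R: "aug_lagrangian_R M f g \<theta> R xbar \<rho> \<xi> y = ereal (l \<xi> y)" if "\<xi> \<in> B" for \<xi> y
    proof -
      have "phi_R M f g \<theta> R xbar \<rho> \<xi> b = \<phi> (\<xi>, b)" for b using fun_cong[OF phi, of "(\<xi>, b)"] by simp
      then show ?thesis using augmented_lagrangian_eq[OF that] by (simp add: aug_lagrangian_R_def)
    qed
    have lag: "aug_lagrangian f g \<theta> \<rho> (R xbar \<xi>) y = ereal (l \<xi> y)" if "\<xi> \<in> B" for \<xi> y
      using lag_R[OF that, of y] that by (simp add: aug_lagrangian_R_def aug_lagrangian_def phi_R_def B_def)
    have argmin: "{p. is_arg_min (\<lambda>p. aug_lagrangian f g \<theta> \<rho> p y - ereal (metric M xbar v (retraction_inv M R xbar p)))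
          (\<lambda>p. p \<in> R xbar ` W) p} = R xbar ` tilted_argmin W v y" if W: "W \<subseteq> B" for W y v
    proof -
      define h where "h p = aug_lagrangian f g \<theta> \<rho> p y - ereal (metric M xbar v (retraction_inv M R xbar p))" for p
      have h: "h (R xbar \<xi>) = ereal (l \<xi> y - ip v \<xi>)" if "\<xi> \<in> W" for \<xi>
        using that W lag[of \<xi> y] inv[of \<xi>] by (auto simp: h_def ip_def)
      have "{p. is_arg_min h (\<lambda>p. p \<in> R xbar ` W) p}
          = R xbar ` tilted_argmin W v y"
        by (auto simp: is_arg_min_def tilted_argmin_def h not_less)
      then show ?thesis by (simp add: h_def[abs_def])
    qed
    obtain C where C: "C > 0" "\<And>u :: 'e \<times> 'y. norm u \<le> C * ip_norm (prod_ip ip) u"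
      "\<And>u :: 'e \<times> 'y. ip_norm (prod_ip ip) u \<le> C * norm u"
      using inner_product_norm_equivalence[OF ipp] by metis
    show ?thesis
    proof
      assume "manifold_strong_variational_sufficiency M f g \<theta> R xbar ybar \<rho>"
      then have vsc: "variationally_strongly_convex (prod_ip ip) \<phi> (0, 0) (0, ybar)" by (simp add: sufficiency)
      obtain rU K where rU: "rU > 0" "K \<ge> 0" "cball 0 rU \<subseteq> S0"
        and K: "\<And>\<xi> \<xi>'. \<xi> \<in> cball 0 rU \<Longrightarrow> \<xi>' \<in> cball 0 rU \<Longrightarrow>
          riem_dist M (R xbar \<xi>) (R xbar \<xi>') \<le> ennreal (K * norm (\<xi> - \<xi>'))"
        by (rule riem_dist_smooth_upper[OF S0(1,2) into R0]) (rule that; blast)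
      obtain r \<delta> m L where r: "0 < r" "r \<le> rU" "0 < \<delta>" "0 \<le> L" "cball 0 r \<subseteq> S"
        and convex: "\<forall>y\<in>cball ybar \<delta>. ereal_convex_on (cball 0 r) (\<lambda>\<xi>. ereal (l \<xi> y))"
        and m: "\<forall>v. \<forall>y\<in>cball ybar \<delta>. tilted_argmin (cball 0 r) v y = {m v y}"
        and lip: "\<forall>v v'. \<forall>y\<in>cball ybar \<delta>. \<forall>y'\<in>cball ybar \<delta>.
          norm (m v y - m v' y') \<le> L * norm ((v, y) - (v', y'))"
        using tilt_stability_if_variationally_strongly_convex[OF vsc rU(1)] by blast
      define W where "W = cball (0::'e) r"
      define Y where "Y = cball ybar \<delta>"
      have WB: "W \<subseteq> B" using r(5) S_sub_B unfolding W_def by (rule subset_trans)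
      show "manifold_augmented_tilt_stability M f g \<theta> R xbar ybar \<rho>"
        unfolding manifold_augmented_tilt_stability_def
      proof (rule exI[of _ W], rule exI[of _ Y], intro conjI ballI exI[of _ UNIV]
          exI[of _ "\<lambda>v \<eta>. R xbar (m v \<eta>)"] exI[of _ "K * (L * C)"])
        show "closed W" "convex W" "0 \<in> interior W" "closed Y" "convex Y" "ybar \<in> interior Y"
          using r by (auto simp: W_def Y_def)
        show "W \<subseteq> retraction_ball M R xbar" using WB by (simp add: B_def)
        show "ereal_convex_on W (\<lambda>\<xi>. aug_lagrangian_R M f g \<theta> R xbar \<rho> \<xi> y)" if "y \<in> Y" for y
          by (rule ereal_convex_on_transform[of _ "\<lambda>\<xi>. ereal (l \<xi> y)"])
            (use convex that WB in \<open>auto simp: W_def Y_def lag_R subset_iff\<close>)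
        show "ereal_concave_on Y (\<lambda>\<eta>. aug_lagrangian_R M f g \<theta> R xbar \<rho> \<xi> \<eta>)" if "\<xi> \<in> W" for \<xi>
        proof -
          have "\<xi> \<in> B" using that WB by blast
          then show ?thesis using l_concave[of \<xi> Y] by (simp add: lag_R Y_def)
        qed
        show "0 \<in> interior UNIV" by simp
        show "0 \<le> K * (L * C)" using rU r C(1) by simp
        show "{p. is_arg_min (\<lambda>p. aug_lagrangian f g \<theta> \<rho> p \<eta> - ereal (metric M xbar v (retraction_inv M R xbar p)))
            (\<lambda>p. p \<in> R xbar ` W) p} = {R xbar (m v \<eta>)}" if "\<eta> \<in> Y" for v \<eta>
          using m that unfolding argmin[OF WB] by (simp add: W_def Y_def)
        show "riem_dist M (R xbar (m v \<eta>)) (R xbar (m v' \<eta>'))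
            \<le> ennreal (K * (L * C) * ip_norm (prod_ip (metric M xbar)) ((v, \<eta>) - (v', \<eta>')))"
          if "\<eta> \<in> Y" "\<eta>' \<in> Y" for v \<eta> v' \<eta>'
        proof -
          have "norm (m v \<eta> - m v' \<eta>') \<le> L * norm ((v, \<eta>) - (v', \<eta>'))"
            using lip that by (simp add: Y_def)
          also have "\<dots> \<le> L * (C * ip_norm (prod_ip ip) ((v, \<eta>) - (v', \<eta>')))"
            using C(2) r(4) by (intro mult_left_mono)
          finally have "K * norm (m v \<eta> - m v' \<eta>') \<le> K * (L * (C * ip_norm (prod_ip ip) ((v, \<eta>) - (v', \<eta>'))))"
            using rU(2) by (intro mult_left_mono)
          then have "ennreal (K * norm (m v \<eta> - m v' \<eta>'))
              \<le> ennreal (K * (L * C) * ip_norm (prod_ip ip) ((v, \<eta>) - (v', \<eta>')))"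
            by (intro ennreal_leI) (simp add: mult.assoc)
          moreover have "riem_dist M (R xbar (m v \<eta>)) (R xbar (m v' \<eta>')) \<le> ennreal (K * norm (m v \<eta> - m v' \<eta>'))"
          proof (rule K)
            have "m v \<eta> \<in> cball 0 r" if "\<eta> \<in> Y" for v \<eta>
            proof -
              have "m v \<eta> \<in> tilted_argmin (cball 0 r) v \<eta>" using m that by (simp add: Y_def)
              then show ?thesis by (simp add: tilted_argmin_def)
            qed
            then have "m v \<eta> \<in> cball 0 r" "m v' \<eta>' \<in> cball 0 r" using that by blast+
            then show "m v \<eta> \<in> cball 0 rU" "m v' \<eta>' \<in> cball 0 rU" using r(2) by auto
          qed
          ultimately show ?thesis unfolding ip_def by (rule order_trans[rotated])
        qed
      qed
    next
      assume "manifold_augmented_tilt_stability M f g \<theta> R xbar ybar \<rho>"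
      then obtain W Y V m L where W: "0 \<in> interior W" "W \<subseteq> B" and Y: "ybar \<in> interior Y"
        and conv: "\<forall>\<eta>\<in>Y. ereal_convex_on W (\<lambda>\<xi>. aug_lagrangian_R M f g \<theta> R xbar \<rho> \<xi> \<eta>)"
        and V: "0 \<in> interior V"
        and m: "\<forall>v\<in>V. \<forall>\<eta>\<in>Y.
          {p. is_arg_min (\<lambda>p. aug_lagrangian f g \<theta> \<rho> p \<eta> - ereal (metric M xbar v (retraction_inv M R xbar p)))
            (\<lambda>p. p \<in> R xbar ` W) p} = {m v \<eta>}"
        and L: "0 \<le> L" and lip: "\<forall>v\<in>V. \<forall>\<eta>\<in>Y. \<forall>v'\<in>V. \<forall>\<eta>'\<in>Y.
          riem_dist M (m v \<eta>) (m v' \<eta>') \<le> ennreal (L * ip_norm (prod_ip (metric M xbar)) ((v, \<eta>) - (v', \<eta>')))"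
        unfolding manifold_augmented_tilt_stability_def B_def[symmetric] by (elim exE conjE) (rule that)
      have convl: "ereal_convex_on W (\<lambda>\<xi>. ereal (l \<xi> y))" if "y \<in> Y" for y
        by (rule ereal_convex_on_transform[OF bspec[OF conv that]]) (use W(2) lag_R in auto)
      define n where "n v y = retraction_inv M R xbar (m v y)" for v y
      have n: "tilted_argmin W v y = {n v y}" "R xbar (n v y) = m v y" if "v \<in> V" "y \<in> Y" for v y
      proof -
        define A where "A = tilted_argmin W v y"
        have img: "R xbar ` A = {m v y}" using m that unfolding argmin[OF W(2)] A_def by blast
        have AW: "A \<subseteq> W" by (auto simp: A_def tilted_argmin_def)
        have nA: "\<xi> = n v y" if "\<xi> \<in> A" for \<xi>
        proof -
          have "R xbar \<xi> = m v y" using img that by blast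
          then show ?thesis using inv[of \<xi>] AW W(2) that by (auto simp: n_def)
        qed
        moreover have "A \<noteq> {}" using img by blast
        ultimately have "A = {n v y}" by blast
        then show "tilted_argmin W v y = {n v y}" "R xbar (n v y) = m v y" using img by (auto simp: A_def)
      qed
      have nW: "n v y \<in> W" if "v \<in> V" "y \<in> Y" for v y
        using n(1)[OF that] by (auto simp: tilted_argmin_def)
      obtain r k where r: "r > 0" "k > 0"
        and k: "\<And>\<xi> \<xi>'. \<xi> \<in> ball 0 r \<Longrightarrow> \<xi>' \<in> B \<Longrightarrow>
          ennreal (k * min (norm (\<xi> - \<xi>')) r) \<le> riem_dist M (R xbar \<xi>) (R xbar \<xi>')"
        by (rule riem_dist_diffeo_lower[OF diffeo S0(2,3) R0 injB]) (rule that; blast)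
      obtain \<delta>Y where \<delta>Y: "\<delta>Y > 0" "ball ybar \<delta>Y \<subseteq> Y" using Y by (auto simp: mem_interior)
      obtain \<delta>V where \<delta>V: "\<delta>V > 0" "ball 0 \<delta>V \<subseteq> V" using V by (auto simp: mem_interior)
      \<comment> \<open>Parameters in the \<open>\<delta>\<close>-balls below differ by less than \<open>4 \<delta>\<close>, so the factor \<open>8 P\<close> keeps the Lipschitz bound under the truncation level \<open>k r\<close>.\<close>
      define P where "P = L * C + 1"
      have P: "P > 0" "L * C \<le> P" using L C(1) by (auto simp: P_def add_nonneg_pos)
      define \<delta> where "\<delta> = min (min \<delta>Y \<delta>V) (k * r / (8 * P))"
      have \<delta>: "\<delta> > 0" "ball ybar \<delta> \<subseteq> Y" "ball 0 \<delta> \<subseteq> V" "\<delta> \<le> k * r / (8 * P)"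
        using \<delta>Y \<delta>V r P by (auto simp: \<delta>_def)
      have W0: "0 \<in> W" and Y0: "ybar \<in> Y" and V0: "0 \<in> V" using W(1) Y V interior_subset by blast+
      interpret ipb: bounded_bilinear ip by (rule inner_product_bounded_bilinear[OF ip])
      have n0: "n 0 ybar = 0"
      proof -
        have "0 \<in> tilted_argmin W 0 ybar"
          by (simp add: tilted_argmin_def W0 ipb.zero_left reference_minimizes[OF convl[OF Y0] W0])
        then show ?thesis using n(1)[OF V0 Y0] by simp
      qed
      \<comment> \<open>For close parameters the truncation in the distance estimate is not active.\<close>
      have local_lip: "norm (n v y - n v' y') < r \<and> norm (n v y - n v' y') \<le> (L * C / k) * norm ((v, y) - (v', y'))"
        if near: "v \<in> ball 0 \<delta>" "v' \<in> ball 0 \<delta>" "y \<in> ball ybar \<delta>" "y' \<in> ball ybar \<delta>" and nr: "n v y \<in> ball 0 r"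
        for v y v' y'
      proof -
        have VY: "v \<in> V" "v' \<in> V" "y \<in> Y" "y' \<in> Y" using near \<delta> by blast+
        have "n v' y' \<in> B" using nW[OF VY(2,4)] W(2) by blast
        from k[OF nr this]
        have "ennreal (k * min (norm (n v y - n v' y')) r) \<le> riem_dist M (m v y) (m v' y')"
          using n(2) VY by simp
        also have "\<dots> \<le> ennreal (L * ip_norm (prod_ip ip) ((v, y) - (v', y')))" unfolding ip_def using lip VY by blast
        finally have "k * min (norm (n v y - n v' y')) r \<le> L * ip_norm (prod_ip ip) ((v, y) - (v', y'))"
          using L ip_norm_nonneg[OF ipp] by (simp add: ennreal_le_iff)
        also have "\<dots> \<le> L * (C * norm ((v, y) - (v', y')))" using L C(3) by (intro mult_left_mono)
        finally have le: "k * min (norm (n v y - n v' y')) r \<le> L * C * norm ((v, y) - (v', y'))" by simp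
        have "norm ((v, y) - (v', y')) \<le> norm (v - v') + norm (y - y')" using norm_Pair_le[of "v - v'" "y - y'"] by simp
        also have "\<dots> \<le> (norm v + norm v') + (dist ybar y + dist ybar y')"
        proof (intro add_mono norm_triangle_ineq4)
          show "norm (y - y') \<le> dist ybar y + dist ybar y'"
            using dist_triangle3[of y y' ybar] by (simp add: dist_norm)
        qed
        also have "\<dots> < 4 * \<delta>" using near by simp
        finally have "L * C * norm ((v, y) - (v', y')) \<le> P * (4 * \<delta>)"
          using P L C(1) by (intro mult_mono) auto
        also have "\<dots> \<le> P * (4 * (k * r / (8 * P)))" using \<delta>(4) P by (intro mult_left_mono) auto
        also have "\<dots> = k * r / 2" using P by simp
        also have "\<dots> < k * r" using r by simp
        finally have "k * min (norm (n v y - n v' y')) r < k * r" using le by linarith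
        then have "norm (n v y - n v' y') < r" using r by (simp add: min_def split: if_splits)
        then show ?thesis using le r by (simp add: field_simps)
      qed
      have n_small: "n v y \<in> ball 0 r" if "v \<in> ball 0 \<delta>" "y \<in> ball ybar \<delta>" for v y
        using local_lip[of 0 v ybar y] that \<delta>(1) r(1) by (simp add: n0)
      have "variationally_strongly_convex (prod_ip ip) \<phi> (0, 0) (0, ybar)"
      proof (rule variationally_strongly_convex_if_tilt_stable[OF W(1) Y V convl n(1)])
        show "L * C / k \<ge> 0" using L C(1) r by simp
        show "\<delta> > 0" by fact
        show "norm (n v y - n v' y') \<le> (L * C / k) * norm ((v, y) - (v', y'))"
          if "v \<in> ball 0 \<delta>" "v' \<in> ball 0 \<delta>" "y \<in> ball ybar \<delta>" "y' \<in> ball ybar \<delta>" for v y v' y'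
          using local_lip[OF that n_small] that by blast
      qed
      then show "manifold_strong_variational_sufficiency M f g \<theta> R xbar ybar \<rho>" by (simp add: sufficiency)
    qed
  qed
qed

end
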